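(* Let $(M,\overline X_1,\dots,\overline X_m)$ be a parallelizable manifold with canonical connection $\nabla^c$ on $\Omega(M)$. The torsion tensor $T^c$ of $\nabla^c$ is given, for $1\le j,l\le m$, by $$T^c(L_{\overline X_j},L_{\overline X_l})=-L_{[\overline X_j,\overline X_l]},\qquad T^c(L_{\overline X_j},i_{\overline X_l})=-i_{[\overline X_j,\overline X_l]},$$ $$T^c(i_{\overline X_j},L_{\overline X_l})=i_{[\overline X_l,\overline X_j]},\qquad T^c(i_{\overline X_j},i_{\overline X_l})=0.$$ The canonical connection is flat (its curvature tensor vanishes). The canonical connection is a metric connection with respect to $G_g$, where $g$ is the metric on $M$ such that $\{\overline X_1,\dots,\overline X_m\}$ is an orthonormal basis for $g$.
   Context: A parallelizable manifold $(M,\overline X_1,\dots,\overline X_m)$ is an $m$-dimensional smooth manifold $M$ with global vector fields $\overline X_1,\dots,\overline X_m$ linearly independent at every point. $\Omega(M)$ is the $\mathbb Z_2$-graded commutative algebra of differential forms on $M$ and $\mathrm{Der}\,\Omega(M)$ the graded left $\Omega(M)$-module of graded derivations of $\Omega(M)$, with graded commutator $[X,Y]=XY-(-1)^{|X||Y|}YX$. For a vector field $\overline X$, $L_{\overline X}$ (even) is the Lie derivative and $i_{\overline X}$ (odd) the interior product; $\{L_{\overline X_j},i_{\overline X_j}\}_{j=1}^m$ is a basis of $\mathrm{Der}\,\Omega(M)$ over $\Omega(M)$. A graded connection is a $\mathbb Z_2$-degree preserving biadditive map $\nabla$ on $\mathrm{Der}\,\Omega(M)$ with $\nabla_{\alpha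 X}Y=\alpha\nabla_XY$ and $\nabla_X(\alpha Y)=X(\alpha)Y+(-1)^{|X||\alpha|}\alpha\nabla_XY$. The canonical connection $\nabla^c$ is the unique graded connection with $\nabla^c_X(L_{\overline X_j})=\nabla^c_X(i_{\overline X_j})=0$ for all $j$ and $X$. Torsion: $T(X,Y)=\nabla_XY-(-1)^{|X||Y|}\nabla_YX-[X,Y]$. Curvature: $R(X,Y)Z=\nabla_X\nabla_YZ-(-1)^{|X||Y|}\nabla_Y\nabla_XZ-\nabla_{[X,Y]}Z$. For a Riemannian metric $g$, $G_g$ is the $\Omega(M)$-valued graded symmetric bilinear form on $\mathrm{Der}\,\Omega(M)$ (satisfying $\langle X,Y\rangle=(-1)^{|X||Y|}\langle Y,X\rangle$, $\langle\alpha X,Y\rangle=\alpha\langle X,Y\rangle=(-1)^{|X||\alpha|}\langle X,\alpha Y\rangle$) determined by $\langle L_{\overline X},L_{\overline Y};G_g\rangle=d(g(\overline X,\overline Y))$, $\langle L_{\overline X},i_{\overline Y};G_g\rangle=\langle i_{\overline X},L_{\overline Y};G_g\rangle=g(\overline X,\overline Y)$, $\langle i_{\overline X},i_{\overline Y};G_g\rangle=0$. A connection is metric with respect to $G_g$ if $X\langle Y,Z;G_g\rangle=\langle\nabla_XY,Z;G_g\rangle+(-1)^{|X||Y|}\langle Y,\nabla_XZ;G_g\rangle$ for all homogeneous $X,Y,Z$. *)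

theory Defs
  imports "HOL-Analysis.Analysis" "HOL-Library.Function_Algebras"
begin

text \<open>
  Throughout, \<open>+\<close>, \<open>-\<close>, \<open>0\<close> and \<open>*\<close> on functions are the pointwise operations. The product
  \<open>*\<close> is used only for real-valued functions; composition of operators and the wedge product
  are always written differently.

  Vector fields, differential forms and derivations are total HOL functions that take the
  value \<open>0\<close> outside their mathematical domain, so that HOL equality is equality of the
  mathematical objects.
\<close>

section \<open>Smooth manifolds\<close>

primrec Ck_on ::
  "nat \<Rightarrow> 'b::real_normed_vector set \<Rightarrow> ('b \<Rightarrow> 'c::real_normed_vector) \<Rightarrow> bool" where
  "Ck_on 0 S f \<longleftrightarrow> continuous_on S f"
| "Ck_on (Suc k) S f \<longleftrightarrow> (\<forall>x\<in>S. f differentiable (at x)) \<and>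
     (\<forall>v. Ck_on k S (\<lambda>x. frechet_derivative f (at x) v))"

definition smooth_on ::
  "'b::real_normed_vector set \<Rightarrow> ('b \<Rightarrow> 'c::real_normed_vector) \<Rightarrow> bool" where
  "smooth_on S f \<longleftrightarrow> (\<forall>k. Ck_on k S f)"

text \<open>
  The manifold is the whole type \<open>'a\<close>; a chart is a pair of a domain and a coordinate map,
  which is meaningful on the domain only. The dimension is \<open>CARD('m)\<close>. The atlas need not be
  maximal.
\<close>

type_synonym ('a, 'm) chart = "'a set \<times> ('a \<Rightarrow> real^'m)"

definition smooth_atlas :: "('a::topological_space, 'm::finite) chart set \<Rightarrow> bool" where
  "smooth_atlas A \<longleftrightarrow>
     (\<Union>(U, \<phi>)\<in>A. U) = UNIV \<and>
     (\<forall>(U, \<phi>)\<in>A. open U \<and> open (\<phi> ` U) \<and> homeomorphism U (\<phi> ` U) \<phi> (inv_into U \<phi>)) \<and>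
     (\<forall>(U, \<phi>)\<in>A. \<forall>(V, \<psi>)\<in>A. smooth_on (\<phi> ` (U \<inter> V)) (\<psi> \<circ> inv_into U \<phi>))"

definition smooth_functions ::
  "('a::topological_space, 'm::finite) chart set \<Rightarrow> ('a \<Rightarrow> real) set" where
  "smooth_functions A = {f. \<forall>(U, \<phi>)\<in>A. smooth_on (\<phi> ` U) (f \<circ> inv_into U \<phi>)}"


section \<open>Vector fields\<close>

text \<open>
  Vector fields are the derivations of the algebra of smooth functions. The tangent vector of
  \<open>X\<close> at \<open>p\<close> is the derivation \<open>\<lambda>f. X f p\<close> at \<open>p\<close>.
\<close>

type_synonym 'a vfield = "('a \<Rightarrow> real) \<Rightarrow> ('a \<Rightarrow> real)"

definition vector_fields ::
  "('a::topological_space, 'm::finite) chart set \<Rightarrow> 'a vfield set" where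
  "vector_fields A = {X.
     (\<forall>f. f \<notin> smooth_functions A \<longrightarrow> X f = 0) \<and>
     (\<forall>f\<in>smooth_functions A. X f \<in> smooth_functions A) \<and>
     (\<forall>f\<in>smooth_functions A. \<forall>h\<in>smooth_functions A. X (f + h) = X f + X h) \<and>
     (\<forall>c. \<forall>f\<in>smooth_functions A. X (\<lambda>p. c * f p) = (\<lambda>p. c * X f p)) \<and>
     (\<forall>f\<in>smooth_functions A. \<forall>h\<in>smooth_functions A. X (f * h) = X f * h + f * X h)}"

definition vf_scale :: "('a \<Rightarrow> real) \<Rightarrow> 'a vfield \<Rightarrow> 'a vfield" where
  "vf_scale f X = (\<lambda>h. f * X h)"

definition lie_bracket :: "'a vfield \<Rightarrow> 'a vfield \<Rightarrow> 'a vfield" where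
  "lie_bracket X Y = (\<lambda>f. X (Y f) - Y (X f))"

definition parallelizable_manifold ::
  "('a::topological_space, 'm::finite) chart set \<Rightarrow> ('m \<Rightarrow> 'a vfield) \<Rightarrow> bool" where
  "parallelizable_manifold A X \<longleftrightarrow>
     smooth_atlas A \<and>
     (\<forall>j. X j \<in> vector_fields A) \<and>
     (\<forall>p. \<forall>c::'m \<Rightarrow> real.
        (\<forall>f\<in>smooth_functions A. (\<Sum>j\<in>UNIV. c j * X j f p) = 0) \<longrightarrow> (\<forall>j. c j = 0))"

definition riemannian_metric ::
  "('a::topological_space, 'm::finite) chart set \<Rightarrow>
   ('a vfield \<Rightarrow> 'a vfield \<Rightarrow> ('a \<Rightarrow> real)) \<Rightarrow> bool" where
  "riemannian_metric A g \<longleftrightarrow>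
     (\<forall>X\<in>vector_fields A. \<forall>Y\<in>vector_fields A. g X Y \<in> smooth_functions A \<and> g X Y = g Y X) \<and>
     (\<forall>X\<in>vector_fields A. \<forall>Y\<in>vector_fields A. \<forall>Z\<in>vector_fields A.
        g (X + Y) Z = g X Z + g Y Z) \<and>
     (\<forall>f\<in>smooth_functions A. \<forall>X\<in>vector_fields A. \<forall>Y\<in>vector_fields A.
        g (vf_scale f X) Y = f * g X Y) \<and>
     (\<forall>X\<in>vector_fields A. \<forall>p. (\<exists>f\<in>smooth_functions A. X f p \<noteq> 0) \<longrightarrow> g X X p > 0)"


section \<open>Differential forms\<close>

text \<open>
  Differential forms of degree \<open>k\<close> are the alternating \<open>k\<close>-linear maps, over the ring of smooth
  functions, from vector fields to smooth functions. An element of the direct sum over all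
  degrees is a single function on lists of vector fields, whose restriction to lists of length
  \<open>k\<close> is its component of degree \<open>k\<close>.
\<close>

type_synonym 'a form = "'a vfield list \<Rightarrow> ('a \<Rightarrow> real)"

definition diff_forms :: "('a::topological_space, 'm::finite) chart set \<Rightarrow> 'a form set" where
  "diff_forms A = {\<omega>.
     (\<forall>Xs. \<not> set Xs \<subseteq> vector_fields A \<longrightarrow> \<omega> Xs = 0) \<and>
     (\<forall>Xs. set Xs \<subseteq> vector_fields A \<longrightarrow> \<omega> Xs \<in> smooth_functions A) \<and>
     (\<forall>Xs i. set Xs \<subseteq> vector_fields A \<longrightarrow> i < length Xs \<longrightarrow>
        (\<forall>Y\<in>vector_fields A. \<forall>Z\<in>vector_fields A. \<forall>f\<in>smooth_functions A. \<forall>h\<in>smooth_functions A.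
           \<omega> (Xs[i := vf_scale f Y + vf_scale h Z]) = f * \<omega> (Xs[i := Y]) + h * \<omega> (Xs[i := Z]))) \<and>
     (\<forall>Xs i j. i < j \<longrightarrow> j < length Xs \<longrightarrow> Xs ! i = Xs ! j \<longrightarrow> \<omega> Xs = 0) \<and>
     (\<exists>n. \<forall>Xs. n < length Xs \<longrightarrow> \<omega> Xs = 0)}"

text \<open>Degrees in \<open>\<int>/2\<close> are represented by natural numbers, of which only the parity matters.\<close>

definition diff_forms_deg ::
  "('a::topological_space, 'm::finite) chart set \<Rightarrow> nat \<Rightarrow> 'a form set" where
  "diff_forms_deg A r = {\<omega>\<in>diff_forms A. \<forall>Xs. odd (length Xs + r) \<longrightarrow> \<omega> Xs = 0}"

text \<open>
  The shuffle formula, normalised so that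
  \<open>(\<alpha> \<and> \<beta>)(X, Y) = \<alpha>(X) \<beta>(Y) - \<alpha>(Y) \<beta>(X)\<close> for 1-forms. The arguments with index in \<open>S\<close> go
  to \<open>\<alpha>\<close>, and the exponent counts the inversions of the shuffle.
\<close>

definition wedge :: "'a form \<Rightarrow> 'a form \<Rightarrow> 'a form" where
  "wedge \<alpha> \<beta> = (\<lambda>Xs p. \<Sum>S\<in>Pow {..<length Xs}.
     (-1) ^ card {(i, j). i < j \<and> j < length Xs \<and> i \<notin> S \<and> j \<in> S} *
       \<alpha> (nths Xs S) p * \<beta> (nths Xs (- S)) p)"

definition zero_form :: "('a \<Rightarrow> real) \<Rightarrow> 'a form" where
  "zero_form f = (\<lambda>Xs. if Xs = [] then f else 0)"

text \<open>The 1-form \<open>df\<close>; the exterior derivative is needed on functions only.\<close>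

definition differential ::
  "('a::topological_space, 'm::finite) chart set \<Rightarrow> ('a \<Rightarrow> real) \<Rightarrow> 'a form" where
  "differential A f =
     (\<lambda>Xs. if length Xs = 1 \<and> set Xs \<subseteq> vector_fields A then hd Xs f else 0)"


section \<open>Graded derivations\<close>

type_synonym 'a fderiv = "'a form \<Rightarrow> 'a form"

text \<open>\<open>gsign n x\<close> is \<open>(-1)\<^sup>n x\<close>.\<close>

definition gsign :: "nat \<Rightarrow> 'b::uminus \<Rightarrow> 'b" where
  "gsign n x = (if even n then x else - x)"

definition derivations_deg ::
  "('a::topological_space, 'm::finite) chart set \<Rightarrow> nat \<Rightarrow> 'a fderiv set" where
  "derivations_deg A r = {D.
     (\<forall>\<omega>. \<omega> \<notin> diff_forms A \<longrightarrow> D \<omega> = 0) \<and>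
     (\<forall>s. \<forall>\<omega>\<in>diff_forms_deg A s. D \<omega> \<in> diff_forms_deg A (r + s)) \<and>
     (\<forall>\<alpha>\<in>diff_forms A. \<forall>\<beta>\<in>diff_forms A. D (\<alpha> + \<beta>) = D \<alpha> + D \<beta>) \<and>
     (\<forall>c. \<forall>\<alpha>\<in>diff_forms A. D (\<lambda>Xs p. c * \<alpha> Xs p) = (\<lambda>Xs p. c * D \<alpha> Xs p)) \<and>
     (\<forall>s. \<forall>\<alpha>\<in>diff_forms_deg A s. \<forall>\<beta>\<in>diff_forms A.
        D (wedge \<alpha> \<beta>) = wedge (D \<alpha>) \<beta> + gsign (r * s) (wedge \<alpha> (D \<beta>)))}"

definition derivations ::
  "('a::topological_space, 'm::finite) chart set \<Rightarrow> 'a fderiv set" where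
  "derivations A = {D + E | D E. D \<in> derivations_deg A 0 \<and> E \<in> derivations_deg A 1}"

definition der_scale :: "'a form \<Rightarrow> 'a fderiv \<Rightarrow> 'a fderiv" where
  "der_scale \<alpha> D = (\<lambda>\<omega>. wedge \<alpha> (D \<omega>))"

definition lie_derivative ::
  "('a::topological_space, 'm::finite) chart set \<Rightarrow> 'a vfield \<Rightarrow> 'a fderiv" where
  "lie_derivative A X = (\<lambda>\<omega> Ys.
     if \<omega> \<in> diff_forms A \<and> set Ys \<subseteq> vector_fields A
     then X (\<omega> Ys) - (\<Sum>i<length Ys. \<omega> (Ys[i := lie_bracket X (Ys ! i)]))
     else 0)"

definition interior_product ::
  "('a::topological_space, 'm::finite) chart set \<Rightarrow> 'a vfield \<Rightarrow> 'a fderiv" where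
  "interior_product A X = (\<lambda>\<omega> Ys. if \<omega> \<in> diff_forms A then \<omega> (X # Ys) else 0)"

text \<open>
  The graded commutator, torsion and curvature below are given on homogeneous arguments \<open>X\<close>, \<open>Y\<close>,
  whose degrees are the parameters \<open>r\<close>, \<open>s\<close>; a homogeneous element does not determine its degree,
  because \<open>0\<close> has both.
\<close>

definition graded_commutator :: "nat \<Rightarrow> nat \<Rightarrow> 'a fderiv \<Rightarrow> 'a fderiv \<Rightarrow> 'a fderiv" where
  "graded_commutator r s X Y = (\<lambda>\<omega>. X (Y \<omega>) - gsign (r * s) (Y (X \<omega>)))"


section \<open>Graded connections\<close>

type_synonym 'a gconnection = "'a fderiv \<Rightarrow> 'a fderiv \<Rightarrow> 'a fderiv"

definition graded_connection ::
  "('a::topological_space, 'm::finite) chart set \<Rightarrow> 'a gconnection \<Rightarrow> bool" where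
  "graded_connection A nabla \<longleftrightarrow>
     (\<forall>r s. \<forall>X\<in>derivations_deg A r. \<forall>Y\<in>derivations_deg A s.
        nabla X Y \<in> derivations_deg A (r + s)) \<and>
     (\<forall>X\<in>derivations A. \<forall>Y\<in>derivations A. \<forall>Z\<in>derivations A.
        nabla (X + Y) Z = nabla X Z + nabla Y Z \<and> nabla X (Y + Z) = nabla X Y + nabla X Z) \<and>
     (\<forall>\<alpha>\<in>diff_forms A. \<forall>X\<in>derivations A. \<forall>Y\<in>derivations A.
        nabla (der_scale \<alpha> X) Y = der_scale \<alpha> (nabla X Y)) \<and>
     (\<forall>r s. \<forall>X\<in>derivations_deg A r. \<forall>\<alpha>\<in>diff_forms_deg A s. \<forall>Y\<in>derivations A.
        nabla X (der_scale \<alpha> Y) =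
          der_scale (X \<alpha>) Y + gsign (r * s) (der_scale \<alpha> (nabla X Y)))"

definition canonical_connection ::
  "('a::topological_space, 'm::finite) chart set \<Rightarrow> ('m \<Rightarrow> 'a vfield) \<Rightarrow> 'a gconnection \<Rightarrow> bool"
  where
  "canonical_connection A X nabla \<longleftrightarrow>
     graded_connection A nabla \<and>
     (\<forall>D\<in>derivations A. \<forall>j.
        nabla D (lie_derivative A (X j)) = 0 \<and> nabla D (interior_product A (X j)) = 0)"

definition torsion :: "'a gconnection \<Rightarrow> nat \<Rightarrow> nat \<Rightarrow> 'a fderiv \<Rightarrow> 'a fderiv \<Rightarrow> 'a fderiv" where
  "torsion nabla r s X Y =
     nabla X Y - gsign (r * s) (nabla Y X) - graded_commutator r s X Y"

definition curvature ::
  "'a gconnection \<Rightarrow> nat \<Rightarrow> nat \<Rightarrow> 'a fderiv \<Rightarrow> 'a fderiv \<Rightarrow> 'a fderiv \<Rightarrow> 'a fderiv" where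
  "curvature nabla r s X Y Z =
     nabla X (nabla Y Z) - gsign (r * s) (nabla Y (nabla X Z))
       - nabla (graded_commutator r s X Y) Z"

definition flat_connection ::
  "('a::topological_space, 'm::finite) chart set \<Rightarrow> 'a gconnection \<Rightarrow> bool" where
  "flat_connection A nabla \<longleftrightarrow>
     (\<forall>r s. \<forall>X\<in>derivations_deg A r. \<forall>Y\<in>derivations_deg A s. \<forall>Z\<in>derivations A.
        curvature nabla r s X Y Z = 0)"


section \<open>Graded metrics\<close>

type_synonym 'a gform = "'a fderiv \<Rightarrow> 'a fderiv \<Rightarrow> 'a form"

definition graded_symmetric_form ::
  "('a::topological_space, 'm::finite) chart set \<Rightarrow> 'a gform \<Rightarrow> bool" where
  "graded_symmetric_form A G \<longleftrightarrow>
     (\<forall>X\<in>derivations A. \<forall>Y\<in>derivations A. G X Y \<in> diff_forms A) \<and>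
     (\<forall>X\<in>derivations A. \<forall>Y\<in>derivations A. \<forall>Z\<in>derivations A.
        G (X + Y) Z = G X Z + G Y Z \<and> G X (Y + Z) = G X Y + G X Z) \<and>
     (\<forall>r s. \<forall>X\<in>derivations_deg A r. \<forall>Y\<in>derivations_deg A s. G X Y = gsign (r * s) (G Y X)) \<and>
     (\<forall>\<alpha>\<in>diff_forms A. \<forall>X\<in>derivations A. \<forall>Y\<in>derivations A.
        G (der_scale \<alpha> X) Y = wedge \<alpha> (G X Y)) \<and>
     (\<forall>r s. \<forall>X\<in>derivations_deg A r. \<forall>\<alpha>\<in>diff_forms_deg A s. \<forall>Y\<in>derivations A.
        wedge \<alpha> (G X Y) = gsign (r * s) (G X (der_scale \<alpha> Y)))"

text \<open>\<open>is_graded_metric_of A g G\<close> says that \<open>G\<close> is the form \<open>G\<^sub>g\<close> determined by \<open>g\<close>.\<close>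

definition is_graded_metric_of ::
  "('a::topological_space, 'm::finite) chart set \<Rightarrow>
   ('a vfield \<Rightarrow> 'a vfield \<Rightarrow> ('a \<Rightarrow> real)) \<Rightarrow> 'a gform \<Rightarrow> bool" where
  "is_graded_metric_of A g G \<longleftrightarrow>
     graded_symmetric_form A G \<and>
     (\<forall>X\<in>vector_fields A. \<forall>Y\<in>vector_fields A.
        G (lie_derivative A X) (lie_derivative A Y) = differential A (g X Y) \<and>
        G (lie_derivative A X) (interior_product A Y) = zero_form (g X Y) \<and>
        G (interior_product A X) (lie_derivative A Y) = zero_form (g X Y) \<and>
        G (interior_product A X) (interior_product A Y) = 0)"

definition metric_connection ::
  "('a::topological_space, 'm::finite) chart set \<Rightarrow> 'a gconnection \<Rightarrow> 'a gform \<Rightarrow> bool" where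
  "metric_connection A nabla G \<longleftrightarrow>
     (\<forall>r s t. \<forall>X\<in>derivations_deg A r. \<forall>Y\<in>derivations_deg A s. \<forall>Z\<in>derivations_deg A t.
        X (G Y Z) = G (nabla X Y) Z + gsign (r * s) (G Y (nabla X Z)))"

end

theory Submission
  imports Defs
begin

text \<open>
  A vector field is the combination of the frame fields with smooth coefficients: multiplying
  Hadamard's expansion of a function at a point by the square of a bump function makes all of its
  factors globally smooth, so a derivation is determined at the point by its values on \<open>CARD('m)\<close>
  functions, and Cramer's rule gives the coefficients. Consequently every graded derivation \<open>D\<close> is
  a combination of Lie derivatives and interior products along the frame: the coefficients of the
  Lie derivatives are read off from \<open>D\<close> on functions, those of the interior products from
  \<open>D\<close> minus the Lie part on the dual coframe. What remains kills functions and the coframe,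
  hence is \<open>0\<close>. The frame derivations are parallel, so curvature and the metric identity,
  being tensorial, need only be checked on them; there the curvature vanishes, and the pairings
  of \<open>G\<close> are the zero form and constants, which every derivation kills. The torsion on the
  frame is minus the graded commutator, given by Cartan's identities.
\<close>

section \<open>Calculus of smooth functions\<close>

text \<open>All objects are global: vector fields are derivations of the algebra of globally defined
  smooth functions, and forms are functions of lists of such fields, so nothing can be restricted to
  a chart. Hence the square of the bump function: one factor cuts off the coordinate, the other the
  Hadamard coefficient, and the product rule of a vector field applies to the resulting global
  functions. That a derivation killing functions and the coframe is zero does not rest on a basis of
  monomials in the coframe, but on Euler's identity: in degree k, the sum over j of theta_j wedge
  i_{X_j} omega is k times omega. It allows induction on the degree. The Lie coefficients of a
  derivation are built separately for each list of arguments; that they are forms of bounded degree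
  needs a degree bound valid for the images of all functions at once, which is where the dimension
  enters. Degrees are parities, so the comparison of signs always comes down to a congruence of
  exponents modulo 2.\<close>

lemma Ck_on_Suc_has_derivative:
  "Ck_on (Suc k) S f \<Longrightarrow> x \<in> S \<Longrightarrow> (f has_derivative frechet_derivative f (at x)) (at x)"
  by (simp add: frechet_derivative_works)

text \<open>Openness of \<open>S\<close> turns agreement on \<open>S\<close> into agreement near
  each of its points, so the derivatives agree on \<open>S\<close> as well and the induction can
  proceed.\<close>

lemma Ck_on_cong:
  assumes "open S" "\<And>x. x \<in> S \<Longrightarrow> f x = g x" "Ck_on k S f"
  shows "Ck_on k S g"
  using assms(2,3)
proof (induction k arbitrary: f g)
  case 0
  then show ?case by (auto cong: continuous_on_cong)
next
  case (Suc k)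
  have d: "(g has_derivative frechet_derivative f (at x)) (at x)" if "x \<in> S" for x
    by (rule has_derivative_transform_within_open[OF
        Ck_on_Suc_has_derivative[OF Suc.prems(2) that] \<open>open S\<close> that Suc.prems(1)])
  have "Ck_on k S (\<lambda>x. frechet_derivative g (at x) v)" for v
  proof (rule Suc.IH)
    show "frechet_derivative f (at x) v = frechet_derivative g (at x) v" if "x \<in> S" for x
      using frechet_derivative_at[OF d[OF that]] by simp
    show "Ck_on k S (\<lambda>x. frechet_derivative f (at x) v)" using Suc.prems(2) by simp
  qed
  then show ?case using d by (auto simp: differentiable_def)
qed

text \<open>Derivatives at a point are unique, so an explicitly computed derivative may stand in for
  \<open>frechet_derivative\<close>. The closure properties below are inductions through this
  rule.\<close>

lemma Ck_on_SucI:
  assumes "open S" "\<And>x. x \<in> S \<Longrightarrow> (f has_derivative f' x) (at x)"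
    "\<And>v. Ck_on k S (\<lambda>x. f' x v)"
  shows "Ck_on (Suc k) S f"
proof -
  have "Ck_on k S (\<lambda>x. frechet_derivative f (at x) v)" for v
  proof (rule Ck_on_cong[OF assms(1) _ assms(3)])
    show "f' x v = frechet_derivative f (at x) v" if "x \<in> S" for x
      using frechet_derivative_at[OF assms(2)[OF that]] by simp
  qed
  then show ?thesis using assms(2) by (auto simp: differentiable_def)
qed

lemma Ck_on_frechet_derivative: "Ck_on (Suc k) S f \<Longrightarrow> Ck_on k S (\<lambda>x. frechet_derivative f (at x) v)"
  by simp

lemma Ck_on_subset: "Ck_on k S f \<Longrightarrow> T \<subseteq> S \<Longrightarrow> Ck_on k T f"
  by (induction k arbitrary: f) (auto intro: continuous_on_subset)

text \<open>Differentiability and continuity at a point concern a neighbourhood only. Smoothness can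
  thus be checked with a different formula around each point, as is done for quotients and for
  extensions by zero.\<close>

lemma Ck_on_local:
  assumes "\<And>x. x \<in> S \<Longrightarrow> \<exists>T. open T \<and> x \<in> T \<and> Ck_on k T f"
  shows "Ck_on k S f"
  using assms
proof (induction k arbitrary: f)
  case 0
  have "isCont f x" if "x \<in> S" for x
    using 0[OF that] continuous_on_eq_continuous_at by auto
  then show ?case by (simp add: continuous_at_imp_continuous_on)
next
  case (Suc k)
  have "f differentiable at x" if "x \<in> S" for x
    using Suc.prems[OF that] by auto
  moreover have "Ck_on k S (\<lambda>x. frechet_derivative f (at x) v)" for v
    using Suc.prems by (intro Suc.IH) (metis Ck_on_frechet_derivative)
  ultimately show ?case by simp
qed

lemma Ck_on_SucD: "Ck_on (Suc k) S f \<Longrightarrow> Ck_on k S f"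
proof (induction k arbitrary: f)
  case 0
  then show ?case
    by (auto intro!: continuous_at_imp_continuous_on differentiable_imp_continuous_within)
next
  case (Suc k)
  then show ?case by (metis Ck_on.simps(2))
qed

lemma Ck_on_const: "Ck_on k S (\<lambda>x. c)"
  by (induction k arbitrary: c) auto

lemma Ck_on_linear:
  assumes "open S" "bounded_linear f" shows "Ck_on k S f"
proof (cases k)
  case 0
  then show ?thesis using assms by (simp add: linear_continuous_on)
next
  case (Suc n)
  have "Ck_on (Suc n) S f"
    using assms by (intro Ck_on_SucI[of _ _ "\<lambda>_. f"])
      (auto intro: bounded_linear_imp_has_derivative Ck_on_const)
  with Suc show ?thesis by simp
qed

lemma Ck_on_linear_compose:
  assumes "open S" "bounded_linear L" "Ck_on k S f" shows "Ck_on k S (\<lambda>x. L (f x))"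
  using assms(3)
proof (induction k arbitrary: f)
  case 0
  then show ?case using assms(2)
    by (auto intro: continuous_on_compose2[OF linear_continuous_on[of L UNIV]])
next
  case (Suc k)
  have "((\<lambda>x. L (f x)) has_derivative (\<lambda>v. L (frechet_derivative f (at x) v))) (at x)" if "x \<in> S" for x
    by (rule bounded_linear.has_derivative[OF assms(2) Ck_on_Suc_has_derivative[OF Suc.prems that]])
  moreover have "Ck_on k S (\<lambda>x. L (frechet_derivative f (at x) v))" for v
    by (intro Suc.IH Ck_on_frechet_derivative[OF Suc.prems])
  ultimately show ?case by (rule Ck_on_SucI[OF assms(1)])
qed

lemma Ck_on_add:
  assumes "open S" "Ck_on k S f" "Ck_on k S g" shows "Ck_on k S (\<lambda>x. f x + g x)"
  using assms(2,3)
proof (induction k arbitrary: f g)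
  case 0
  then show ?case by (auto intro: continuous_on_add)
next
  case (Suc k)
  show ?case
    by (rule Ck_on_SucI[OF assms(1) has_derivative_add[OF
          Ck_on_Suc_has_derivative[OF Suc.prems(1)] Ck_on_Suc_has_derivative[OF Suc.prems(2)]]])
      (use Suc in auto)
qed

lemma Ck_on_sum:
  assumes "open S" "\<And>i. i \<in> I \<Longrightarrow> Ck_on k S (f i)" shows "Ck_on k S (\<lambda>x. \<Sum>i\<in>I. f i x)"
  using assms(2)
proof (induction I rule: infinite_finite_induct)
  case (insert i I)
  then show ?case by (auto intro: Ck_on_add[OF assms(1)])
qed (auto intro: Ck_on_const)

lemma Ck_on_mult:
  fixes f g :: "'b::real_normed_vector \<Rightarrow> real"
  assumes "open S" "Ck_on k S f" "Ck_on k S g" shows "Ck_on k S (\<lambda>x. f x * g x)"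
  using assms(2,3)
proof (induction k arbitrary: f g)
  case 0
  then show ?case by (auto intro: continuous_on_mult)
next
  case (Suc k)
  have "((\<lambda>x. f x * g x) has_derivative
      (\<lambda>v. f x * frechet_derivative g (at x) v + frechet_derivative f (at x) v * g x)) (at x)"
    if "x \<in> S" for x
    by (intro has_derivative_mult Ck_on_Suc_has_derivative[OF Suc.prems(1) that]
        Ck_on_Suc_has_derivative[OF Suc.prems(2) that])
  moreover have "Ck_on k S (\<lambda>x. f x * frechet_derivative g (at x) v + frechet_derivative f (at x) v * g x)"
    for v
    by (intro Ck_on_add assms(1) Suc.IH Ck_on_SucD[OF Suc.prems(1)] Ck_on_SucD[OF Suc.prems(2)]
        Ck_on_frechet_derivative[OF Suc.prems(1)] Ck_on_frechet_derivative[OF Suc.prems(2)])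
  ultimately show ?case by (rule Ck_on_SucI[OF assms(1)])
qed

lemma Ck_on_prod:
  fixes f :: "'i \<Rightarrow> 'b::real_normed_vector \<Rightarrow> real"
  assumes "open S" "\<And>i. i \<in> I \<Longrightarrow> Ck_on k S (f i)" shows "Ck_on k S (\<lambda>x. \<Prod>i\<in>I. f i x)"
  using assms(2)
proof (induction I rule: infinite_finite_induct)
  case (insert i I)
  then show ?case by (auto intro: Ck_on_mult[OF assms(1)])
qed (auto intro: Ck_on_const)

lemma Ck_on_inverse:
  fixes f :: "'b::real_normed_vector \<Rightarrow> real"
  assumes "open S" "Ck_on k S f" "\<And>x. x \<in> S \<Longrightarrow> f x \<noteq> 0" shows "Ck_on k S (\<lambda>x. inverse (f x))"
  using assms(2)
proof (induction k)
  case 0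
  then show ?case using assms(3) by (auto intro: continuous_on_inverse)
next
  case (Suc k)
  \<comment> \<open>The derivative of the inverse is a product that contains the inverse again, so
    its own regularity one order lower is needed.\<close>
  have i: "Ck_on k S (\<lambda>x. inverse (f x))" using Suc Ck_on_SucD by blast
  let ?D = "\<lambda>x v. (-1) * (inverse (f x) * frechet_derivative f (at x) v * inverse (f x))"
  have "((\<lambda>x. inverse (f x)) has_derivative ?D x) (at x)" if "x \<in> S" for x
    using Deriv.has_derivative_inverse[OF assms(3)[OF that] Ck_on_Suc_has_derivative[OF Suc.prems that]]
    by simp
  moreover have "Ck_on k S (\<lambda>x. ?D x v)" for v
    by (intro Ck_on_mult Ck_on_const assms(1) i Ck_on_frechet_derivative[OF Suc.prems])
  ultimately show ?case by (rule Ck_on_SucI[OF assms(1)])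
qed

text \<open>The chain rule evaluates the derivative of \<open>f\<close> in a direction that varies
  with \<open>x\<close>, whereas \<open>Ck_on\<close> speaks of fixed directions. Expanding the
  direction in the basis of the Euclidean space in between leaves partial derivatives of
  \<open>f\<close> composed with \<open>g\<close>, which is why the induction generalises
  \<open>f\<close>.\<close>

lemma Ck_on_compose:
  fixes g :: "'b::real_normed_vector \<Rightarrow> 'c::euclidean_space" and f :: "'c \<Rightarrow> real"
  assumes "open S" "open T" "g ` S \<subseteq> T" "Ck_on k S g" "Ck_on k T f"
  shows "Ck_on k S (\<lambda>x. f (g x))"
  using assms(4,5)
proof (induction k arbitrary: f)
  case 0
  then show ?case using assms(3) by (auto intro: continuous_on_compose2)
next
  case (Suc k)
  let ?D = "\<lambda>x v. \<Sum>b\<in>Basis. (frechet_derivative g (at x) v \<bullet> b) * frechet_derivative f (at (g x)) b"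
  have "((\<lambda>x. f (g x)) has_derivative ?D x) (at x)" if "x \<in> S" for x
  proof -
    have f: "(f has_derivative frechet_derivative f (at (g x))) (at (g x))"
      using Suc.prems(2) assms(3) that by (auto intro!: Ck_on_Suc_has_derivative)
    have "frechet_derivative f (at (g x)) w =
        (\<Sum>b\<in>Basis. (w \<bullet> b) * frechet_derivative f (at (g x)) b)" for w
      using Linear_Algebra.linear_componentwise[OF has_derivative_linear[OF f], of w 1] by simp
    then have "frechet_derivative f (at (g x)) (frechet_derivative g (at x) v) = ?D x v" for v .
    then show ?thesis
      using has_derivative_compose[OF Ck_on_Suc_has_derivative[OF Suc.prems(1) that] f]
      by (simp add: fun_eq_iff)
  qed
  moreover have "Ck_on k S (\<lambda>x. ?D x v)" for v
    by (intro Ck_on_sum Ck_on_mult Ck_on_linear_compose[where L="\<lambda>x. x \<bullet> _"] bounded_linear_inner_left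
        assms(1) Ck_on_frechet_derivative[OF Suc.prems(1)] Suc.IH[of "\<lambda>y. frechet_derivative f (at y) _"]
        Ck_on_SucD[OF Suc.prems(1)] Ck_on_frechet_derivative[OF Suc.prems(2)])
  ultimately show ?case by (rule Ck_on_SucI[OF assms(1)])
qed

section \<open>A smooth bump function\<close>

lemma exp_minus_inverse_quotient_tendsto_0:
  "((\<lambda>x::real. inverse x ^ n * exp (- inverse x)) \<longlongrightarrow> 0) (at_right 0)"
proof -
  have "((\<lambda>y::real. y ^ n / exp y) \<longlongrightarrow> 0) at_top"
    by (rule tendsto_power_div_exp_0)
  from filterlim_compose[OF this filterlim_inverse_at_top_right]
  show ?thesis by (simp add: exp_minus field_simps)
qed

text \<open>For \<open>n = 0\<close> this is the classical smooth function that is flat at 0. The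
  powers of the inverse are included because the derivative of each member of the family is a linear
  combination of two others.\<close>

definition exp_flat :: "nat \<Rightarrow> real \<Rightarrow> real" where
  "exp_flat n x = (if x > 0 then inverse x ^ n * exp (- inverse x) else 0)"

lemma exp_flat_has_derivative:
  "(exp_flat n has_real_derivative (exp_flat (n + 2) x - n * exp_flat (n + 1) x)) (at x)"
proof -
  consider "x > 0" | "x < 0" | "x = 0" by linarith
  then show ?thesis
  proof cases
    case 1
    have "((\<lambda>x. inverse x ^ n * exp (- inverse x)) has_real_derivative
        (exp_flat (n + 2) x - n * exp_flat (n + 1) x)) (at x)"
    proof (rule DERIV_cong)
      show "((\<lambda>x. inverse x ^ n * exp (- inverse x)) has_real_derivative
          inverse x ^ n * (exp (- inverse x) * (inverse x)\<^sup>2)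
            - n * inverse x ^ (n - 1) * (inverse x)\<^sup>2 * exp (- inverse x)) (at x)"
        using 1 by (auto intro!: derivative_eq_intros simp: power2_eq_square)
      \<comment> \<open>The case \<open>n = 0\<close> needs separate treatment, as
        \<open>n - 1\<close> is truncated; both sides are then 0.\<close>
      have "n * inverse x ^ (n - 1) * (inverse x)\<^sup>2 = n * inverse x ^ (n + 1)"
        by (cases n) (simp_all add: power2_eq_square)
      then show "inverse x ^ n * (exp (- inverse x) * (inverse x)\<^sup>2)
            - n * inverse x ^ (n - 1) * (inverse x)\<^sup>2 * exp (- inverse x)
          = exp_flat (n + 2) x - n * exp_flat (n + 1) x"
        using 1 by (simp only: exp_flat_def power_add) simp
    qed
    then show ?thesis
      by (rule has_field_derivative_transform_within_open[of _ _ _ "{0<..}"])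
        (use 1 in \<open>auto simp: exp_flat_def\<close>)
  next
    case 2
    have "((\<lambda>x. 0) has_real_derivative 0) (at x)" by simp
    then have "(exp_flat n has_real_derivative 0) (at x)"
      by (rule has_field_derivative_transform_within_open[of _ _ _ "{..<0}"])
        (use 2 in \<open>auto simp: exp_flat_def\<close>)
    then show ?thesis using 2 by (simp add: exp_flat_def)
  next
    case 3
    have "((\<lambda>h. (exp_flat n (0 + h) - exp_flat n 0) / h) \<longlongrightarrow> 0) (at 0)"
    proof (subst at_eq_sup_left_right, rule filterlim_sup)
      show "((\<lambda>h. (exp_flat n (0 + h) - exp_flat n 0) / h) \<longlongrightarrow> 0) (at_left 0)"
        by (rule tendsto_eventually, simp add: exp_flat_def eventually_at_filter)
      \<comment> \<open>Dividing by \<open>h\<close> raises the power of the inverse by one, hence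
        the limit for \<open>Suc n\<close>.\<close>
      show "((\<lambda>h. (exp_flat n (0 + h) - exp_flat n 0) / h) \<longlongrightarrow> 0) (at_right 0)"
        using exp_minus_inverse_quotient_tendsto_0[of "Suc n"]
        by (rule Lim_transform_eventually)
          (auto simp: exp_flat_def eventually_at_filter field_simps)
    qed
    then show ?thesis using 3 by (simp add: DERIV_def exp_flat_def)
  qed
qed

lemma Ck_on_exp_flat: "Ck_on k UNIV (exp_flat n)"
proof (induction k arbitrary: n)
  case 0
  show ?case using exp_flat_has_derivative
    by (auto intro!: continuous_at_imp_continuous_on DERIV_isCont)
next
  case (Suc k)
  have "Ck_on k UNIV (\<lambda>x. (exp_flat (n + 2) x + (-real n) * exp_flat (n + 1) x) * v)" for v
    by (intro Ck_on_mult Ck_on_add Ck_on_const Suc) auto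
  moreover have "(exp_flat n has_derivative (\<lambda>v. (exp_flat (n + 2) x + (-real n) * exp_flat (n + 1) x) * v)) (at x)" for x
    using exp_flat_has_derivative[of n x] by (simp add: has_field_derivative_def)
  ultimately show ?case by (intro Ck_on_SucI) auto
qed

lemma smooth_bump:
  fixes a :: "'b::euclidean_space"
  assumes "r > 0"
  obtains h :: "'b \<Rightarrow> real" where "smooth_on UNIV h" "h a \<noteq> 0" "\<And>x. x \<notin> ball a r \<Longrightarrow> h x = 0"
proof
  \<comment> \<open>The squared norm is spelled out over the basis because sums and products of
    affine functions are already known to be smooth.\<close>
  let ?h = "\<lambda>x. exp_flat 0 (r\<^sup>2 - (\<Sum>b\<in>Basis. ((x - a) \<bullet> b) * ((x - a) \<bullet> b)))"
  have eq: "(\<Sum>b\<in>Basis. ((x - a) \<bullet> b) * ((x - a) \<bullet> b)) = (dist a x)\<^sup>2" for x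
    by (simp add: euclidean_inner[symmetric] dist_norm norm_minus_commute[of a] power2_norm_eq_inner)
  show "smooth_on UNIV ?h"
    unfolding smooth_on_def
  proof
    fix k
    have *: "Ck_on k UNIV (\<lambda>x::'b. ((x - a) \<bullet> b))" for b
      using Ck_on_add[OF _ Ck_on_linear[OF _ bounded_linear_inner_left[of b]] Ck_on_const[of k UNIV "- (a \<bullet> b)"]]
      by (simp add: inner_diff_left)
    have "Ck_on k UNIV (\<lambda>x::'b. r\<^sup>2 + (-1) * (\<Sum>b\<in>Basis. ((x - a) \<bullet> b) * ((x - a) \<bullet> b)))"
      by (intro Ck_on_add Ck_on_const Ck_on_mult Ck_on_sum * open_UNIV)
    from Ck_on_compose[OF open_UNIV open_UNIV _ this Ck_on_exp_flat]
    show "Ck_on k UNIV ?h" by simp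
  qed
  show "?h a \<noteq> 0" using assms by (simp add: exp_flat_def)
  show "?h x = 0" if "x \<notin> ball a r" for x
    using that assms unfolding eq by (simp add: exp_flat_def not_less power_mono)
qed

section \<open>Hadamard's expansion on a ball\<close>

lemma segment_in_ball:
  fixes a :: "'b::euclidean_space"
  assumes "x \<in> ball a r" "t \<in> {0..1}" shows "a + t *\<^sub>R (x - a) \<in> ball a r"
proof -
  have "t * norm (x - a) \<le> norm (x - a)" using assms by (simp add: mult_left_le_one_le)
  then show ?thesis using assms by (auto simp: dist_norm norm_minus_commute)
qed

text \<open>Differentiation under the integral sign. The derivative in \<open>x\<close> of the
  integrand brings out a factor \<open>t\<close>, so the weight \<open>t ^ n\<close> is what makes
  the class of integrals closed under differentiation: \<open>n\<close> grows by one and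
  \<open>F\<close> becomes a directional derivative of \<open>F\<close>.\<close>

lemma Ck_on_segment_integral:
  fixes F :: "'b::euclidean_space \<Rightarrow> real"
  assumes "smooth_on (ball a r) F"
  shows "Ck_on k (ball a r) (\<lambda>x. integral {0..1} (\<lambda>t. t ^ n * F (a + t *\<^sub>R (x - a))))"
  using assms
proof (induction k arbitrary: n F)
  have cont: "continuous_on (ball a r \<times> {0..1}) (\<lambda>p. snd p ^ n * F (a + snd p *\<^sub>R (fst p - a)))"
    if "smooth_on (ball a r) F" for F :: "'b \<Rightarrow> real" and n
  proof -
    have "continuous_on (ball a r) F"
      using that unfolding smooth_on_def by (metis Ck_on.simps(1))
    moreover have "continuous_on (ball a r \<times> {0..1}) (\<lambda>p. a + snd p *\<^sub>R (fst p - a))"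
      by (intro continuous_intros)
    ultimately have "continuous_on (ball a r \<times> {0..1}) (\<lambda>p. F (a + snd p *\<^sub>R (fst p - a)))"
      by (rule continuous_on_compose2) (use segment_in_ball in fastforce)
    then show ?thesis by (intro continuous_intros)
  qed
  {
    case 0
    show ?case
      using integral_continuous_on_param[of "ball a r" 0 1 "\<lambda>x t. t ^ n * F (a + t *\<^sub>R (x - a))"]
        cont[OF 0, of n] by (simp add: split_def)
  next
    case (Suc k)
    let ?F' = "\<lambda>x. frechet_derivative F (at x)"
    let ?y = "\<lambda>x t. a + t *\<^sub>R (x - a)"
    have F': "(F has_derivative ?F' x) (at x)" if "x \<in> ball a r" for x
      using Ck_on_Suc_has_derivative[of 0] Suc.prems that unfolding smooth_on_def by blast
    have sF': "smooth_on (ball a r) (\<lambda>x. ?F' x v)" for v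
      using Suc.prems unfolding smooth_on_def by (metis Ck_on.simps(2))
    \<comment> \<open>The Leibniz rule wants the derivative as a continuous family of bounded linear
      maps. The linear map is wrapped in \<open>Blinfun\<close>, which has the intended value for
      \<open>x\<close> in the ball and \<open>t\<close> in the unit interval.\<close>
    define fx where "fx x t = Blinfun (\<lambda>v. t ^ Suc n * ?F' (?y x t) v)" for x t
    have fx: "blinfun_apply (fx x t) = (\<lambda>v. t ^ Suc n * ?F' (?y x t) v)"
      if "x \<in> ball a r" "t \<in> {0..1}" for x t
      using F'[OF segment_in_ball[OF that]] unfolding fx_def
      by (intro bounded_linear_Blinfun_apply bounded_linear_const_mult has_derivative_bounded_linear)
    have d: "((\<lambda>x. t ^ n * F (?y x t)) has_derivative blinfun_apply (fx x t)) (at x within ball a r)"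
      if "x \<in> ball a r" "t \<in> cbox 0 1" for x t
    proof -
      have t: "t \<in> {0..1}" using that by simp
      have F'': "(F has_derivative ?F' (?y x t)) (at (?y x t))"
        using F'[OF segment_in_ball[OF that(1) t]] .
      have "((\<lambda>x. F (?y x t)) has_derivative (\<lambda>v. ?F' (?y x t) (t *\<^sub>R v))) (at x within ball a r)"
        by (rule has_derivative_compose[of "\<lambda>x. ?y x t" "\<lambda>v. t *\<^sub>R v" x "ball a r" F, OF _ F'']) (auto intro!: derivative_eq_intros)
      then have "((\<lambda>x. t ^ n * F (?y x t)) has_derivative (\<lambda>v. t ^ n * ?F' (?y x t) (t *\<^sub>R v))) (at x within ball a r)"
        by (intro has_derivative_mult_right)
      then show ?thesis
        using linear_cmul[OF has_derivative_linear[OF F'']] by (simp add: fx[OF that(1) t] mult_ac)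
    qed
    have cF: "continuous_on {0..1} (\<lambda>t. t ^ j * G (?y x t))"
      if "x \<in> ball a r" "smooth_on (ball a r) G" for x j and G :: "'b \<Rightarrow> real"
      using continuous_on_compose2[OF cont[OF that(2), of j], of "{0..1}" "Pair x"] that(1)
      by (simp add: continuous_on_Pair image_subset_iff)
    have cfx: "continuous_on (ball a r \<times> {0..1}) (\<lambda>p. fx (fst p) (snd p))"
    proof (rule continuous_on_blinfun_componentwise)
      fix i :: 'b
      show "continuous_on (ball a r \<times> {0..1}) (\<lambda>p. blinfun_apply (fx (fst p) (snd p)) i)"
        using cont[OF sF'[of i], of "Suc n"] by (rule continuous_on_eq) (auto simp: fx)
    qed
    have int: "blinfun_apply (integral {0..1} (fx x)) v = integral {0..1} (\<lambda>t. t ^ Suc n * ?F' (?y x t) v)"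
      if "x \<in> ball a r" for x v
    proof -
      have "continuous_on {0..1} (fx x)"
        using continuous_on_compose2[OF cfx, of "{0..1}" "Pair x"] that by (simp add: continuous_on_Pair image_subset_iff)
      then have "fx x integrable_on {0..1}" by (rule integrable_continuous_interval)
      from blinfun_apply_integral[OF this] show ?thesis
        by (rule trans) (rule integral_cong, simp only: fx[OF that])
    qed
    have "((\<lambda>x. integral {0..1} (\<lambda>t. t ^ n * F (?y x t))) has_derivative
        (\<lambda>v. integral {0..1} (\<lambda>t. t ^ Suc n * ?F' (?y x t) v))) (at x)" if "x \<in> ball a r" for x
    proof -
      have "((\<lambda>x. integral (cbox 0 1) (\<lambda>t. t ^ n * F (?y x t))) has_derivative
          blinfun_apply (integral (cbox 0 1) (fx x))) (at x within ball a r)"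
        using cfx cF[OF _ Suc.prems]
        by (intro leibniz_rule d that) (auto simp: split_def intro: integrable_continuous_interval)
      then show ?thesis
        using that at_within_open[of x "ball a r"] ext[of "blinfun_apply _", OF int[OF that]]
        by simp
    qed
    then show ?case
      by (rule Ck_on_SucI[OF open_ball _ Suc.IH[OF sF']])
  }
qed

text \<open>The fundamental theorem of calculus along the segment from \<open>a\<close> to
  \<open>x\<close>; the factor \<open>g b\<close> is the average over that segment of the partial
  derivative of \<open>f\<close> in direction \<open>b\<close>.\<close>

lemma smooth_on_Hadamard:
  fixes f :: "'b::euclidean_space \<Rightarrow> real"
  assumes "smooth_on (ball a r) f" "r > 0"
  obtains g where "\<And>b. smooth_on (ball a r) (g b)"
    "\<And>x. x \<in> ball a r \<Longrightarrow> f x = f a + (\<Sum>b\<in>Basis. ((x - a) \<bullet> b) * g b x)"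
proof
  let ?f' = "\<lambda>x. frechet_derivative f (at x)"
  \<comment> \<open>The weight \<open>t ^ 0\<close> puts the integral into the form of
    \<open>Ck_on_segment_integral\<close>.\<close>
  let ?g = "\<lambda>b x. integral {0..1} (\<lambda>t. t ^ 0 * ?f' (a + t *\<^sub>R (x - a)) b)"
  have sF': "smooth_on (ball a r) (\<lambda>x. ?f' x v)" for v
    using assms(1) unfolding smooth_on_def by (metis Ck_on.simps(2))
  show "smooth_on (ball a r) (?g b)" for b
    unfolding smooth_on_def[of _ "?g b"] by (intro allI Ck_on_segment_integral sF')
  fix x assume x: "x \<in> ball a r"
  let ?y = "\<lambda>t. a + t *\<^sub>R (x - a)"
  have F': "(f has_derivative ?f' x) (at x)" if "x \<in> ball a r" for x
    using Ck_on_Suc_has_derivative[of 0] assms(1) that unfolding smooth_on_def by blast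
  have int: "(\<lambda>t. ?f' (?y t) v) integrable_on {0..1}" for v
  proof (rule integrable_continuous_interval)
    have "continuous_on (ball a r) (\<lambda>x. ?f' x v)"
      using sF'[of v] unfolding smooth_on_def by (metis Ck_on.simps(1))
    moreover have "continuous_on {0..1} ?y" by (intro continuous_intros)
    ultimately show "continuous_on {0..1} (\<lambda>t. ?f' (?y t) v)"
      by (rule continuous_on_compose2) (use segment_in_ball[OF x] in blast)
  qed
  have "((\<lambda>t. ?f' (?y t) (x - a)) has_integral f (?y 1) - f (?y 0)) {0..1}"
  proof (rule fundamental_theorem_of_calculus)
    fix t :: real assume t: "t \<in> {0..1}"
    have "((\<lambda>t. f (?y t)) has_derivative (\<lambda>h. ?f' (?y t) (h *\<^sub>R (x - a)))) (at t within {0..1})"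
      by (rule has_derivative_compose[of ?y "\<lambda>h. h *\<^sub>R (x - a)" t "{0..1}" f, OF _ F'[OF segment_in_ball[OF x t]]])
        (auto intro!: derivative_eq_intros)
    then show "((\<lambda>t. f (?y t)) has_vector_derivative ?f' (?y t) (x - a)) (at t within {0..1})"
      using linear_cmul[OF has_derivative_linear[OF F'[OF segment_in_ball[OF x t]]]]
      by (simp add: has_vector_derivative_def)
  qed simp
  then have "f x - f a = integral {0..1} (\<lambda>t. ?f' (?y t) (x - a))"
    by (simp add: integral_unique)
  also have "\<dots> = integral {0..1} (\<lambda>t. \<Sum>b\<in>Basis. ((x - a) \<bullet> b) * ?f' (?y t) b)"
  proof (rule integral_cong)
    fix t :: real assume t: "t \<in> {0..1}"
    show "?f' (?y t) (x - a) = (\<Sum>b\<in>Basis. ((x - a) \<bullet> b) * ?f' (?y t) b)"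
      using Linear_Algebra.linear_componentwise[OF has_derivative_linear[OF F'[OF segment_in_ball[OF x t]]], of "x - a" 1]
      by simp
  qed
  also have "\<dots> = (\<Sum>b\<in>Basis. ((x - a) \<bullet> b) * ?g b x)"
    using int by (subst integral_sum) (auto intro: integrable_on_mult_right)
  finally show "f x = f a + (\<Sum>b\<in>Basis. ((x - a) \<bullet> b) * ?g b x)" by simp
qed

section \<open>Smooth functions and vector fields\<close>

lemma sum_fun_apply: "(\<Sum>i\<in>I. f i) x = (\<Sum>i\<in>I. f i x)" for f :: "'i \<Rightarrow> 'b \<Rightarrow> 'c::comm_monoid_add"
  by (induction I rule: infinite_finite_induct) auto

locale smooth_manifold =
  fixes A :: "('a::t2_space, 'm::finite) chart set"
  assumes atlas: "smooth_atlas A"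
begin

abbreviation C :: "('a \<Rightarrow> real) set" where "C \<equiv> smooth_functions A"
abbreviation V :: "'a vfield set" where "V \<equiv> vector_fields A"

lemma chart_cover: obtains U \<phi> where "(U, \<phi>) \<in> A" "p \<in> U"
proof -
  have "p \<in> (\<Union>(U, \<phi>)\<in>A. U)" using atlas unfolding smooth_atlas_def by simp
  then show ?thesis using that by auto
qed

lemma
  assumes "(U, \<phi>) \<in> A"
  shows chart_open: "open U" and chart_image_open: "open (\<phi> ` U)"
    and chart_homeomorphism: "homeomorphism U (\<phi> ` U) \<phi> (inv_into U \<phi>)"
proof -
  have "\<forall>(U, \<phi>)\<in>A. open U \<and> open (\<phi> ` U) \<and> homeomorphism U (\<phi> ` U) \<phi> (inv_into U \<phi>)"
    using atlas unfolding smooth_atlas_def by (elim conjE)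
  from bspec[OF this assms] show "open U" "open (\<phi> ` U)" "homeomorphism U (\<phi> ` U) \<phi> (inv_into U \<phi>)"
    by simp_all
qed

lemma chart_inverse: "(U, \<phi>) \<in> A \<Longrightarrow> p \<in> U \<Longrightarrow> inv_into U \<phi> (\<phi> p) = p"
  using chart_homeomorphism unfolding homeomorphism_def by blast

lemma chart_transition:
  "(U, \<phi>) \<in> A \<Longrightarrow> (W, \<psi>) \<in> A \<Longrightarrow> smooth_on (\<phi> ` (U \<inter> W)) (\<psi> \<circ> inv_into U \<phi>)"
  using atlas unfolding smooth_atlas_def by fastforce

lemma chart_image_open_subset:
  assumes "(U, \<phi>) \<in> A" "open W" shows "open (\<phi> ` (U \<inter> W))"
proof -
  have "openin (top_of_set (\<phi> ` U)) (\<phi> ` (U \<inter> W))"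
    by (rule homeomorphism_imp_open_map[OF chart_homeomorphism[OF assms(1)]])
      (use assms(2) in blast)
  then show ?thesis using chart_image_open[OF assms(1)] openin_open_trans by blast
qed

lemma smooth_functions_Ck_on:
  "f \<in> C \<Longrightarrow> (U, \<phi>) \<in> A \<Longrightarrow> Ck_on k (\<phi> ` U) (\<lambda>x. f (inv_into U \<phi> x))"
  unfolding smooth_functions_def smooth_on_def comp_def by fastforce

lemma smooth_functionsI:
  assumes "\<And>U \<phi> k. (U, \<phi>) \<in> A \<Longrightarrow> Ck_on k (\<phi> ` U) (\<lambda>x. f (inv_into U \<phi> x))"
  shows "f \<in> C"
  using assms unfolding smooth_functions_def smooth_on_def comp_def by fastforce

section \<open>The algebra of smooth functions\<close>

lemma smooth_const: "(\<lambda>_. c) \<in> C"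
  by (rule smooth_functionsI) (rule Ck_on_const)

lemma smooth_add: "f \<in> C \<Longrightarrow> h \<in> C \<Longrightarrow> (\<lambda>p. f p + h p) \<in> C"
  by (rule smooth_functionsI) (simp add: Ck_on_add chart_image_open smooth_functions_Ck_on)

lemma smooth_mult: "f \<in> C \<Longrightarrow> h \<in> C \<Longrightarrow> (\<lambda>p. f p * h p) \<in> C"
  by (rule smooth_functionsI) (simp add: Ck_on_mult chart_image_open smooth_functions_Ck_on)

lemma smooth_sum: "(\<And>i. i \<in> I \<Longrightarrow> f i \<in> C) \<Longrightarrow> (\<lambda>p. \<Sum>i\<in>I. f i p) \<in> C"
  by (rule smooth_functionsI) (simp add: Ck_on_sum chart_image_open smooth_functions_Ck_on)

lemma smooth_prod: "(\<And>i. i \<in> I \<Longrightarrow> f i \<in> C) \<Longrightarrow> (\<lambda>p. \<Prod>i\<in>I. f i p) \<in> C"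
  by (rule smooth_functionsI) (simp add: Ck_on_prod chart_image_open smooth_functions_Ck_on)

lemma smooth_det:
  fixes M :: "'a \<Rightarrow> real^'n^'n"
  shows "(\<And>i j. (\<lambda>p. M p $ i $ j) \<in> C) \<Longrightarrow> (\<lambda>p. det (M p)) \<in> C"
  unfolding det_def by (intro smooth_sum smooth_mult smooth_prod smooth_const)

lemma open_smooth_nonzero:
  assumes "f \<in> C" shows "open {p. f p \<noteq> 0}"
proof (subst open_subopen, intro ballI)
  fix p assume p: "p \<in> {p. f p \<noteq> 0}"
  obtain U \<phi> where U: "(U, \<phi>) \<in> A" "p \<in> U" by (rule chart_cover)
  have "continuous_on (\<phi> ` U) (\<lambda>x. f (inv_into U \<phi> x))"
    using smooth_functions_Ck_on[OF assms U(1), of 0] by simp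
  moreover have "continuous_on U \<phi>"
    using chart_homeomorphism[OF U(1)] unfolding homeomorphism_def by blast
  ultimately have "continuous_on U (\<lambda>q. f (inv_into U \<phi> (\<phi> q)))"
    by (rule continuous_on_compose2) simp
  then have "continuous_on U f"
    by (rule continuous_on_eq) (simp add: chart_inverse[OF U(1)])
  then have "open (f -` (- {0}) \<inter> U)"
    using chart_open[OF U(1)] continuous_on_open_vimage by blast
  then show "\<exists>T. open T \<and> p \<in> T \<and> T \<subseteq> {p. f p \<noteq> 0}"
    using p U(2) by (intro exI[of _ "f -` (- {0}) \<inter> U"]) auto
qed

text \<open>Around a point where \<open>b\<close> does not vanish the quotient is smooth in every
  chart. This is the shape in which Cramer's rule delivers the coefficients of a vector field:
  around each point a quotient of two global functions, but not the same two everywhere.\<close>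

lemma smooth_local_quotient:
  assumes "\<And>p. \<exists>a\<in>C. \<exists>b\<in>C. b p \<noteq> 0 \<and> (\<forall>q. b q \<noteq> 0 \<longrightarrow> f q = a q * inverse (b q))"
  shows "f \<in> C"
proof (rule smooth_functionsI, rule Ck_on_local)
  fix U \<phi> k x assume U: "(U, \<phi>) \<in> A" and x: "x \<in> \<phi> ` U"
  let ?i = "inv_into U \<phi>"
  obtain a b where ab: "a \<in> C" "b \<in> C" "b (?i x) \<noteq> 0"
    "\<And>q. b q \<noteq> 0 \<Longrightarrow> f q = a q * inverse (b q)"
    using assms by blast
  let ?T = "\<phi> ` (U \<inter> {q. b q \<noteq> 0})"
  have T: "open ?T" using chart_image_open_subset[OF U open_smooth_nonzero[OF ab(2)]] .
  have "x = \<phi> (?i x)" "?i x \<in> U" using x by (simp_all add: f_inv_into_f inv_into_into)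
  then have "x \<in> ?T" using ab(3) by blast
  moreover have bT: "b (?i y) \<noteq> 0" if "y \<in> ?T" for y using that chart_inverse[OF U] by auto
  have "Ck_on k ?T (\<lambda>y. a (?i y) * inverse (b (?i y)))"
    by (intro Ck_on_mult Ck_on_inverse T bT)
      (auto intro: Ck_on_subset[OF smooth_functions_Ck_on[OF _ U]] ab)
  then have "Ck_on k ?T (\<lambda>y. f (?i y))"
    by (rule Ck_on_cong[OF T, rotated]) (simp add: ab(4) bT)
  ultimately show "\<exists>T. open T \<and> x \<in> T \<and> Ck_on k T (\<lambda>y. f (?i y))" using T by blast
qed

text \<open>The Hausdorff property makes the image of \<open>K\<close> closed, so that the extension by zero is smooth.\<close>

lemma smooth_extension_by_zero:
  assumes U: "(U, \<phi>) \<in> A" and K: "compact K" "K \<subseteq> S" and S: "open S" "S \<subseteq> \<phi> ` U"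
    and h: "smooth_on S h" "\<And>x. x \<notin> K \<Longrightarrow> h x = 0"
  shows "(\<lambda>q. if q \<in> U then h (\<phi> q) else 0) \<in> C"
proof (rule smooth_functionsI, rule Ck_on_local)
  fix W \<psi> k y assume W: "(W, \<psi>) \<in> A" and y: "y \<in> \<psi> ` W"
  let ?i = "inv_into W \<psi>" and ?j = "inv_into U \<phi>"
  let ?f = "\<lambda>q. if q \<in> U then h (\<phi> q) else 0"
  have iy: "y = \<psi> (?i y)" "?i y \<in> W" using y by (simp_all add: f_inv_into_f inv_into_into)
  have cj: "continuous_on (\<phi> ` U) ?j" and c\<phi>: "continuous_on U \<phi>"
    using chart_homeomorphism[OF U] unfolding homeomorphism_def by blast+
  show "\<exists>T. open T \<and> y \<in> T \<and> Ck_on k T (\<lambda>x. ?f (?i x))"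
  \<comment> \<open>Two kinds of neighbourhoods suffice: the preimage of \<open>S\<close>, where the
    function is \<open>h\<close> composed with a transition map, and the complement of the closed
    image of \<open>K\<close>, where it is zero.\<close>
  proof (cases "?i y \<in> U \<and> \<phi> (?i y) \<in> S")
    case True
    have "open (\<phi> -` S \<inter> U)" using chart_open[OF U] c\<phi> S(1) continuous_on_open_vimage by blast
    then have T: "open (\<psi> ` (W \<inter> (\<phi> -` S \<inter> U)))" (is "open ?T")
      by (rule chart_image_open_subset[OF W])
    have "Ck_on k (\<psi> ` (W \<inter> U)) (\<lambda>x. \<phi> (?i x))"
      using chart_transition[OF W U] by (simp add: smooth_on_def comp_def)
    then have "Ck_on k ?T (\<lambda>x. \<phi> (?i x))" by (rule Ck_on_subset) blast
    moreover have "Ck_on k S h" using h(1) by (simp add: smooth_on_def)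
    ultimately have "Ck_on k ?T (\<lambda>x. h (\<phi> (?i x)))"
      by (rule Ck_on_compose[OF T S(1), rotated]) (auto simp: chart_inverse[OF W])
    then have "Ck_on k ?T (\<lambda>x. ?f (?i x))"
      by (rule Ck_on_cong[OF T, rotated]) (auto simp: chart_inverse[OF W])
    moreover have "y \<in> ?T" using True iy by blast
    ultimately show ?thesis using T by blast
  next
    case False
    have "compact (?j ` K)"
      using K S by (intro compact_continuous_image continuous_on_subset[OF cj]) auto
    then have "open (- (?j ` K))" by (simp add: compact_imp_closed open_Compl)
    then have T: "open (\<psi> ` (W \<inter> - (?j ` K)))" (is "open ?T")
      by (rule chart_image_open_subset[OF W])
    have z: "h (\<phi> q) = 0" if "q \<in> U" "q \<notin> ?j ` K" for q
      using that h(2)[of "\<phi> q"] chart_inverse[OF U, of q] by force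
    have "Ck_on k ?T (\<lambda>x. 0 :: real)" by (rule Ck_on_const)
    then have "Ck_on k ?T (\<lambda>x. ?f (?i x))"
    proof (rule Ck_on_cong[OF T, rotated])
      fix x assume "x \<in> ?T"
      then obtain q where "q \<in> W" "q \<notin> ?j ` K" "x = \<psi> q" by blast
      then show "0 = ?f (?i x)" using z[of q] chart_inverse[OF W, of q] by auto
    qed
    moreover have "?i y \<notin> ?j ` K"
    proof
      assume "?i y \<in> ?j ` K"
      then obtain x where x: "x \<in> K" "?i y = ?j x" by blast
      then have "x \<in> \<phi> ` U" using K S by blast
      then have "?j x \<in> U" "\<phi> (?j x) = x" by (simp_all add: f_inv_into_f inv_into_into)
      then show False using False x K by auto
    qed
    then have "y \<in> ?T" using iy by blast
    ultimately show ?thesis using T by blast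
  qed
qed

text \<open>With a bump \<open>h\<close> in a chart, \<open>\<rho>\<close> is \<open>h\<close>,
  \<open>\<xi> i\<close> is \<open>h\<close> times the centred coordinate and
  \<open>\<gamma> i\<close> is \<open>h\<close> times the Hadamard factor, all extended by zero.
  Only \<open>\<gamma>\<close> depends on \<open>f\<close>, so finitely many functions
  \<open>\<xi> i\<close> test all \<open>f\<close> at once.\<close>

lemma local_coordinates:
  "\<exists>\<rho> (\<xi> :: 'm \<Rightarrow> 'a \<Rightarrow> real). \<rho> \<in> C \<and> \<rho> p \<noteq> 0 \<and> (\<forall>i. \<xi> i \<in> C \<and> \<xi> i p = 0) \<and>
    (\<forall>f\<in>C. \<exists>\<gamma>. (\<forall>i. \<gamma> i \<in> C) \<and>
      (\<forall>q. \<rho> q * \<rho> q * (f q - f p) = (\<Sum>i\<in>UNIV. \<xi> i q * \<gamma> i q)))"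
proof -
  obtain U \<phi> where U: "(U, \<phi>) \<in> A" "p \<in> U" by (rule chart_cover)
  define a where "a = \<phi> p"
  obtain R where R: "R > 0" "cball a R \<subseteq> \<phi> ` U"
    using chart_image_open[OF U(1)] U(2) open_contains_cball[of "\<phi> ` U"] a_def by blast
  \<comment> \<open>Half the radius leaves room for the compact set required by the extension: the
    closed ball of radius \<open>R / 2\<close> lies in the open ball of radius
    \<open>R\<close>.\<close>
  obtain h :: "real^'m \<Rightarrow> real" where h: "smooth_on UNIV h" "h a \<noteq> 0" "\<And>x. x \<notin> ball a (R / 2) \<Longrightarrow> h x = 0"
    using smooth_bump[of "R / 2" a] R(1) by (metis half_gt_zero)
  let ?K = "cball a (R / 2)" and ?S = "ball a R"
  have KS: "compact ?K" "?K \<subseteq> ?S" "open ?S" "?S \<subseteq> \<phi> ` U" using R by auto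
  define ext where "ext = (\<lambda>k q. if q \<in> U then k (\<phi> q) else (0::real))"
  have ext: "ext (\<lambda>x. h x * k x) \<in> C" if k: "smooth_on ?S k" for k
    unfolding ext_def
  proof (rule smooth_extension_by_zero[OF U(1) KS])
    show "smooth_on ?S (\<lambda>x. h x * k x)"
      unfolding smooth_on_def
    proof
      fix n
      have "Ck_on n ?S h" "Ck_on n ?S k"
        using h(1) k Ck_on_subset[of n UNIV h ?S] by (simp_all add: smooth_on_def)
      then show "Ck_on n ?S (\<lambda>x. h x * k x)" by (rule Ck_on_mult[OF open_ball])
    qed
    show "h x * k x = 0" if "x \<notin> ?K" for x using that h(3)[of x] by auto
  qed
  have lin: "smooth_on ?S (\<lambda>x. (x - a) $ i)" for i
    unfolding smooth_on_def
    using Ck_on_add[OF open_ball Ck_on_linear[OF open_ball bounded_linear_vec_nth[of i]]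
        Ck_on_const[of _ _ "- a $ i"]] by simp
  show ?thesis
  proof (rule exI, rule exI, intro conjI allI ballI)
    \<comment> \<open>The factor 1 makes the bump itself an instance of the extension fact
      \<open>ext\<close>.\<close>
    let ?\<rho> = "ext (\<lambda>x. h x * 1)" and ?\<xi> = "\<lambda>i. ext (\<lambda>x. h x * (x - a) $ i)"
    show "?\<rho> \<in> C" by (rule ext) (simp add: smooth_on_def Ck_on_const)
    show "?\<rho> p \<noteq> 0" using h(2) U(2) by (simp add: ext_def a_def)
    show "?\<xi> i \<in> C" for i by (rule ext[OF lin])
    show "?\<xi> i p = 0" for i by (simp add: ext_def a_def)
    fix f assume f: "f \<in> C"
    let ?F = "\<lambda>x. f (inv_into U \<phi> x)"
    have "smooth_on ?S ?F"
      unfolding smooth_on_def using Ck_on_subset[OF smooth_functions_Ck_on[OF f U(1)] KS(4)] by blast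
    then obtain g where g: "\<And>b. smooth_on ?S (g b)"
      "\<And>x. x \<in> ?S \<Longrightarrow> ?F x = ?F a + (\<Sum>b\<in>Basis. ((x - a) \<bullet> b) * g b x)"
      using R(1) by (rule smooth_on_Hadamard) blast
    have bij: "bij_betw (\<lambda>i. axis i (1::real)) (UNIV :: 'm set) Basis"
      by (auto simp: bij_betw_def inj_on_def axis_eq_axis Basis_vec_def)
    have g': "?F x - ?F a = (\<Sum>i\<in>UNIV. (x - a) $ i * g (axis i 1) x)" if "x \<in> ?S" for x
      using g(2)[OF that] sum.reindex_bij_betw[OF bij, of "\<lambda>b. ((x - a) \<bullet> b) * g b x"]
      by (simp add: inner_axis)
    have "?\<rho> q * ?\<rho> q * (f q - f p) = (\<Sum>i\<in>UNIV. ?\<xi> i q * ext (\<lambda>x. h x * g (axis i 1) x) q)" for q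
    proof (cases "q \<in> U \<and> \<phi> q \<in> ?S")
      case True
      then have "f q - f p = (\<Sum>i\<in>UNIV. (\<phi> q - a) $ i * g (axis i 1) (\<phi> q))"
        using g'[of "\<phi> q"] chart_inverse[OF U(1)] U(2) by (simp add: a_def)
      then show ?thesis using True by (simp add: ext_def sum_distrib_left mult_ac)
    next
      case False
      then show ?thesis using h(3)[of "\<phi> q"] R(1) by (auto simp: ext_def)
    qed
    moreover have "ext (\<lambda>x. h x * g (axis i 1) x) \<in> C" for i by (rule ext[OF g(1)])
    ultimately show "\<exists>\<gamma>. (\<forall>i. \<gamma> i \<in> C) \<and> (\<forall>q. ?\<rho> q * ?\<rho> q * (f q - f p) = (\<Sum>i\<in>UNIV. ?\<xi> i q * \<gamma> i q))"
      by (intro exI[of _ "\<lambda>i. ext (\<lambda>x. h x * g (axis i 1) x)"] conjI allI)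
  qed
qed

lemma smooth_plus: "f \<in> C \<Longrightarrow> h \<in> C \<Longrightarrow> f + h \<in> C"
  using smooth_add by (simp add: plus_fun_def)

lemma smooth_times: "f \<in> C \<Longrightarrow> h \<in> C \<Longrightarrow> f * h \<in> C"
  using smooth_mult by (simp add: times_fun_def)

lemma smooth_scale: "f \<in> C \<Longrightarrow> (\<lambda>p. c * f p) \<in> C"
  by (rule smooth_mult[OF smooth_const])

lemma smooth_uminus: "f \<in> C \<Longrightarrow> - f \<in> C"
  using smooth_scale[of f "-1"] by (simp add: fun_Compl_def)

lemma smooth_minus: "f \<in> C \<Longrightarrow> h \<in> C \<Longrightarrow> f - h \<in> C"
  using smooth_plus[OF _ smooth_uminus] by (metis diff_conv_add_uminus)

lemma smooth_zero: "0 \<in> C" and smooth_one: "1 \<in> C"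
  using smooth_const[of 0] smooth_const[of 1] by (simp_all add: zero_fun_def one_fun_def)

lemma smooth_sum_fun: "(\<And>i. i \<in> I \<Longrightarrow> f i \<in> C) \<Longrightarrow> sum f I \<in> C"
  by (induction I rule: infinite_finite_induct) (auto intro: smooth_zero smooth_plus)

section \<open>Vector fields as derivations\<close>

lemma vector_field_smooth: "Y \<in> V \<Longrightarrow> Y f \<in> C"
  using smooth_zero unfolding vector_fields_def by (cases "f \<in> C") auto

lemma vector_field_not_smooth: "Y \<in> V \<Longrightarrow> f \<notin> C \<Longrightarrow> Y f = 0"
  unfolding vector_fields_def by auto

lemma vector_field_add: "Y \<in> V \<Longrightarrow> f \<in> C \<Longrightarrow> h \<in> C \<Longrightarrow> Y (f + h) = Y f + Y h"
  unfolding vector_fields_def by blast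

lemma vector_field_scale: "Y \<in> V \<Longrightarrow> f \<in> C \<Longrightarrow> Y (\<lambda>p. c * f p) = (\<lambda>p. c * Y f p)"
  unfolding vector_fields_def by blast

lemma vector_field_mult: "Y \<in> V \<Longrightarrow> f \<in> C \<Longrightarrow> h \<in> C \<Longrightarrow> Y (f * h) = Y f * h + f * Y h"
  unfolding vector_fields_def by blast

lemma vector_field_const: assumes "Y \<in> V" shows "Y (\<lambda>_. c) = 0"
proof -
  have "Y 1 = 0" using vector_field_mult[OF assms smooth_one smooth_one] by simp
  then show ?thesis
    using vector_field_scale[OF assms smooth_one, of c] by (simp add: one_fun_def zero_fun_def)
qed

lemma vector_field_zero: "Y \<in> V \<Longrightarrow> Y 0 = 0"
  using vector_field_const[of Y 0] by (simp add: zero_fun_def)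

lemma vector_field_uminus: "Y \<in> V \<Longrightarrow> f \<in> C \<Longrightarrow> Y (- f) = - Y f"
  using vector_field_scale[of Y f "-1"] by (simp add: fun_Compl_def)

lemma vector_field_minus: "Y \<in> V \<Longrightarrow> f \<in> C \<Longrightarrow> h \<in> C \<Longrightarrow> Y (f - h) = Y f - Y h"
  using vector_field_add[of Y f "- h"] smooth_uminus[of h] vector_field_uminus[of Y h]
  by (metis diff_conv_add_uminus)

lemma vector_field_sum:
  "Y \<in> V \<Longrightarrow> (\<And>i. i \<in> I \<Longrightarrow> f i \<in> C) \<Longrightarrow> Y (sum f I) = (\<Sum>i\<in>I. Y (f i))"
  by (induction I rule: infinite_finite_induct)
    (auto simp: vector_field_zero vector_field_add smooth_sum_fun)

text \<open>In each application of the product rule one of the two terms vanishes at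
  \<open>p\<close>, because \<open>f - f p\<close> and all \<open>\<xi> i\<close> are zero
  there.\<close>

lemma vector_field_local_coordinates:
  assumes Y: "Y \<in> V" and f: "f \<in> C" and \<rho>: "\<rho> \<in> C"
    and \<xi>: "\<And>i. \<xi> i \<in> C" "\<And>i. \<xi> i p = 0" and \<gamma>: "\<And>i. \<gamma> i \<in> C"
    and eq: "\<And>q. \<rho> q * \<rho> q * (f q - f p) = (\<Sum>i\<in>I. \<xi> i q * \<gamma> i q)"
  shows "\<rho> p * \<rho> p * Y f p = (\<Sum>i\<in>I. Y (\<xi> i) p * \<gamma> i p)"
proof -
  have c: "f - (\<lambda>_. f p) \<in> C" by (intro smooth_minus f smooth_const)
  have "\<rho> * \<rho> * (f - (\<lambda>_. f p)) = (\<Sum>i\<in>I. \<xi> i * \<gamma> i)"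
    using eq by (simp add: fun_eq_iff sum_fun_apply)
  then have "Y (\<rho> * \<rho> * (f - (\<lambda>_. f p))) p = (\<Sum>i\<in>I. Y (\<xi> i * \<gamma> i)) p"
    by (simp add: vector_field_sum[OF Y] smooth_times \<xi> \<gamma>)
  then show ?thesis
    by (simp add: vector_field_mult[OF Y] vector_field_minus[OF Y] vector_field_const[OF Y]
        f \<rho> \<xi> \<gamma> c smooth_times smooth_const sum_fun_apply)
qed

end

section \<open>Coefficients of a vector field with respect to the frame\<close>

locale parallelizable = smooth_manifold A for A :: "('a::t2_space, 'm::finite) chart set" +
  fixes X :: "'m \<Rightarrow> 'a vfield"
  assumes parallelizable: "parallelizable_manifold A X"
begin

lemma X_in: "X j \<in> V"
  using parallelizable unfolding parallelizable_manifold_def by blast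

lemma X_independent:
  "(\<And>f. f \<in> C \<Longrightarrow> (\<Sum>j\<in>UNIV. c j * X j f p) = 0) \<Longrightarrow> c j = 0"
  using parallelizable unfolding parallelizable_manifold_def by blast

text \<open>Since \<open>\<rho>\<close> and \<open>\<gamma>\<close> do not depend on
  \<open>Y\<close>, the value of \<open>Y f\<close> at \<open>p\<close> is a fixed linear function
  of the values of \<open>Y\<close> on the \<open>\<xi> i\<close>. A combination of the frame that
  kills all \<open>\<xi> i\<close> therefore kills all \<open>f\<close>, so independence of the
  frame makes the matrix invertible.\<close>

lemma frame_matrix:
  "\<exists>\<rho> (\<xi> :: 'm \<Rightarrow> 'a \<Rightarrow> real). \<rho> \<noteq> 0 \<and> (\<forall>i. \<xi> i \<in> C) \<and>
    (\<forall>f\<in>C. \<exists>\<gamma>. \<forall>Y\<in>V. \<rho> * Y f p = (\<Sum>i\<in>UNIV. Y (\<xi> i) p * \<gamma> i)) \<and>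
    det (\<chi> i j. X j (\<xi> i) p) \<noteq> 0"
proof -
  obtain \<rho> and \<xi> :: "'m \<Rightarrow> 'a \<Rightarrow> real" where "\<rho> \<in> C \<and> \<rho> p \<noteq> 0 \<and> (\<forall>i. \<xi> i \<in> C \<and> \<xi> i p = 0) \<and>
    (\<forall>f\<in>C. \<exists>\<gamma>. (\<forall>i. \<gamma> i \<in> C) \<and>
      (\<forall>q. \<rho> q * \<rho> q * (f q - f p) = (\<Sum>i\<in>UNIV. \<xi> i q * \<gamma> i q)))"
    using local_coordinates[of p] by (elim exE)
  then have \<rho>: "\<rho> \<in> C" "\<rho> p \<noteq> 0" and \<xi>: "\<And>i. \<xi> i \<in> C" "\<And>i::'m. \<xi> i p = 0"
    and \<gamma>: "\<And>f. f \<in> C \<Longrightarrow> \<exists>\<gamma>. (\<forall>i. \<gamma> i \<in> C) \<and>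
      (\<forall>q. \<rho> q * \<rho> q * (f q - f p) = (\<Sum>i\<in>UNIV. \<xi> i q * \<gamma> i q))"
    by simp_all
  have ex: "\<exists>\<gamma>. \<forall>Y\<in>V. \<rho> p * \<rho> p * Y f p = (\<Sum>i\<in>UNIV. Y (\<xi> i) p * \<gamma> i)" if f: "f \<in> C" for f
  proof -
    obtain \<gamma> where "\<And>i. \<gamma> i \<in> C" "\<And>q. \<rho> q * \<rho> q * (f q - f p) = (\<Sum>i\<in>UNIV. \<xi> i q * \<gamma> i q)"
      using \<gamma>[OF f] by blast
    then have "\<rho> p * \<rho> p * Y f p = (\<Sum>i\<in>UNIV. Y (\<xi> i) p * \<gamma> i p)" if "Y \<in> V" for Y
      by (rule vector_field_local_coordinates[OF that f \<rho>(1) \<xi>])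
    then show ?thesis by (intro exI[of _ "\<lambda>i. \<gamma> i p"] ballI)
  qed
  let ?N = "\<chi> i j. X j (\<xi> i) p"
  \<comment> \<open>A kernel vector is a list of coefficients of a combination of the frame that
    vanishes at \<open>p\<close> on every smooth function.\<close>
  have "v = 0" if "?N *v v = 0" for v
  proof -
    have v: "(\<Sum>j\<in>UNIV. v $ j * X j (\<xi> i) p) = 0" for i
      using that by (simp add: matrix_vector_mult_def vec_eq_iff mult.commute)
    have "v $ j = 0" for j
    proof (rule X_independent)
      fix f assume "f \<in> C"
      then obtain \<gamma> where \<gamma>: "\<And>Y. Y \<in> V \<Longrightarrow> \<rho> p * \<rho> p * Y f p = (\<Sum>i\<in>UNIV. Y (\<xi> i) p * \<gamma> i)"
        using ex by blast
      have "\<rho> p * \<rho> p * (\<Sum>j\<in>UNIV. v $ j * X j f p) = (\<Sum>j\<in>UNIV. v $ j * (\<Sum>i\<in>UNIV. X j (\<xi> i) p * \<gamma> i))"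
        by (simp only: sum_distrib_left[of "_ * _"] sum_distrib_left[of "\<rho>"] \<gamma>[OF X_in, symmetric]) (simp only: mult_ac)
      also have "\<dots> = (\<Sum>i\<in>UNIV. (\<Sum>j\<in>UNIV. v $ j * X j (\<xi> i) p) * \<gamma> i)"
        unfolding sum_distrib_left sum_distrib_right by (subst sum.swap) (simp add: mult.assoc)
      finally show "(\<Sum>j\<in>UNIV. v $ j * X j f p) = 0" using \<rho>(2) v by simp
    qed
    then show ?thesis by (simp add: vec_eq_iff)
  qed
  then have "det ?N \<noteq> 0"
    using matrix_left_invertible_ker[of ?N] invertible_det_nz[of ?N] invertible_left_inverse by blast
  then show ?thesis
    using \<rho>(2) \<xi>(1) ex by (intro exI[of _ "\<rho> p * \<rho> p"] exI[of _ \<xi>]) simp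
qed

text \<open>The coefficients solve the square system obtained by testing on the
  \<open>\<xi> i\<close>; equality on these functions propagates to all \<open>f\<close> by the
  common linear formula.\<close>

lemma frame_pointwise:
  assumes Y: "Y \<in> V" shows "\<exists>c. \<forall>f\<in>C. Y f p = (\<Sum>j\<in>UNIV. c j * X j f p)"
proof -
  obtain \<rho> and \<xi> :: "'m \<Rightarrow> 'a \<Rightarrow> real" where "\<rho> \<noteq> 0 \<and> (\<forall>i. \<xi> i \<in> C) \<and>
    (\<forall>f\<in>C. \<exists>\<gamma>. \<forall>Y\<in>V. \<rho> * Y f p = (\<Sum>i\<in>UNIV. Y (\<xi> i) p * \<gamma> i)) \<and>
    det (\<chi> i j. X j (\<xi> i) p) \<noteq> 0"
    using frame_matrix[of p] by (elim exE)
  then have \<rho>: "\<rho> \<noteq> 0" and d: "det (\<chi> i j. X j (\<xi> i) p) \<noteq> 0"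
    and ex: "\<And>f. f \<in> C \<Longrightarrow> \<exists>\<gamma>. \<forall>Y\<in>V. \<rho> * Y f p = (\<Sum>i\<in>UNIV. Y (\<xi> i) p * \<gamma> i)"
    by simp_all
  let ?N = "\<chi> i j. X j (\<xi> i) p"
  obtain v where "?N *v v = (\<chi> i. Y (\<xi> i) p)"
    using cramer[OF d, of _ "\<chi> i. Y (\<xi> i) p"] by blast
  then have v: "Y (\<xi> i) p = (\<Sum>j\<in>UNIV. v $ j * X j (\<xi> i) p)" for i
    by (simp add: matrix_vector_mult_def vec_eq_iff mult.commute)
  have "Y f p = (\<Sum>j\<in>UNIV. v $ j * X j f p)" if f: "f \<in> C" for f
  proof -
    obtain \<gamma> where \<gamma>: "\<And>Y. Y \<in> V \<Longrightarrow> \<rho> * Y f p = (\<Sum>i\<in>UNIV. Y (\<xi> i) p * \<gamma> i)"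
      using ex[OF f] by blast
    have "\<rho> * (\<Sum>j\<in>UNIV. v $ j * X j f p) = (\<Sum>j\<in>UNIV. v $ j * (\<Sum>i\<in>UNIV. X j (\<xi> i) p * \<gamma> i))"
      by (simp only: sum_distrib_left[of "_ * _"] sum_distrib_left[of "\<rho>"] \<gamma>[OF X_in, symmetric]) (simp only: mult_ac)
    also have "\<dots> = (\<Sum>i\<in>UNIV. (\<Sum>j\<in>UNIV. v $ j * X j (\<xi> i) p) * \<gamma> i)"
      unfolding sum_distrib_left sum_distrib_right by (subst sum.swap) (simp add: mult.assoc)
    also have "\<dots> = \<rho> * Y f p" by (simp add: \<gamma>[OF Y] v)
    finally show ?thesis using \<rho> by simp
  qed
  then show ?thesis by (intro exI[of _ "\<lambda>j. v $ j"]) blast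
qed

text \<open>The values of the dual 1-forms. The choice is made separately at each point and carries
  no regularity; uniqueness of the coefficients is what later allows a comparison with a smooth
  formula.\<close>

definition coframe :: "'m \<Rightarrow> 'a vfield \<Rightarrow> 'a \<Rightarrow> real" where
  "coframe j Y p = (SOME c. \<forall>f\<in>C. Y f p = (\<Sum>j\<in>UNIV. c j * X j f p)) j"

lemma coframe_apply: "Y \<in> V \<Longrightarrow> f \<in> C \<Longrightarrow> Y f p = (\<Sum>j\<in>UNIV. coframe j Y p * X j f p)"
  unfolding coframe_def using someI_ex[OF frame_pointwise] by blast

lemma coframe_unique:
  assumes "Y \<in> V" "\<And>f. f \<in> C \<Longrightarrow> Y f p = (\<Sum>j\<in>UNIV. c j * X j f p)"
  shows "coframe j Y p = c j"
proof -
  have "coframe j Y p - c j = 0"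
    by (rule X_independent[of "\<lambda>j. coframe j Y p - c j"])
      (use coframe_apply[OF assms(1)] assms(2) in \<open>simp add: left_diff_distrib sum_subtractf\<close>)
  then show ?thesis by simp
qed

text \<open>The functions \<open>\<xi> i\<close> found at \<open>p\<close> remain usable at every
  point where the determinant is nonzero. There Cramer's rule gives the coefficient as a quotient of
  determinants with smooth entries.\<close>

lemma coframe_smooth:
  assumes Y: "Y \<in> V" shows "coframe k Y \<in> C"
proof (rule smooth_local_quotient)
  fix p
  obtain \<xi> :: "'m \<Rightarrow> 'a \<Rightarrow> real" where \<xi>: "\<And>i. \<xi> i \<in> C" and d: "det (\<chi> i j. X j (\<xi> i) p) \<noteq> 0"
    using frame_matrix[of p] by auto
  let ?N = "\<lambda>q. (\<chi> i j. X j (\<xi> i) q)"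
  let ?M = "\<lambda>q. (\<chi> i j. if j = k then Y (\<xi> i) q else X j (\<xi> i) q)"
  have "coframe k Y q = det (?M q) / det (?N q)" if "det (?N q) \<noteq> 0" for q
  proof -
    have "?N q *v (\<chi> j. coframe j Y q) = (\<chi> i. Y (\<xi> i) q)"
      using coframe_apply[OF Y \<xi>] by (simp add: matrix_vector_mult_def vec_eq_iff mult.commute)
    from iffD1[OF cramer[OF that] this]
    have "(\<chi> j. coframe j Y q) $ k =
        det (\<chi> i j. if j = k then (\<chi> i. Y (\<xi> i) q) $ i else ?N q $ i $ j) / det (?N q)"
      by (metis (lifting) vec_lambda_beta)
    then show ?thesis by (simp cong: if_cong)
  qed
  moreover have "(\<lambda>q. det (?M q)) \<in> C"
  proof (rule smooth_det)
    show "(\<lambda>q. ?M q $ i $ j) \<in> C" for i j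
      by (cases "j = k") (simp_all add: vector_field_smooth Y X_in)
  qed
  moreover have "(\<lambda>q. det (?N q)) \<in> C"
    using vector_field_smooth[OF X_in] by (intro smooth_det) simp
  ultimately show "\<exists>a\<in>C. \<exists>b\<in>C. b p \<noteq> 0 \<and> (\<forall>q. b q \<noteq> 0 \<longrightarrow> coframe k Y q = a q * inverse (b q))"
    using d by (auto simp: divide_inverse intro!: bexI)
qed

end

section \<open>The exterior algebra\<close>

text \<open>Unlike \<open>interior_product\<close>, this does not test its argument for being a
  form, so its identities are unconditional.\<close>

definition contract :: "'a vfield \<Rightarrow> 'a form \<Rightarrow> 'a form" where
  "contract Y \<omega> = (\<lambda>Ys. \<omega> (Y # Ys))"

text \<open>The grading automorphism. It expresses the sign of the Leibniz rule without requiring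
  the first factor to be homogeneous.\<close>

definition parity_involution :: "'a form \<Rightarrow> 'a form" where
  "parity_involution \<omega> = (\<lambda>Ys. gsign (length Ys) (\<omega> Ys))"

definition form_scale :: "('a \<Rightarrow> real) \<Rightarrow> 'a form \<Rightarrow> 'a form" where
  "form_scale f \<omega> = (\<lambda>Ys. f * \<omega> Ys)"

definition shuffle_inversions :: "nat \<Rightarrow> nat set \<Rightarrow> (nat \<times> nat) set" where
  "shuffle_inversions n S = {(i, j). i < j \<and> j < n \<and> i \<notin> S \<and> j \<in> S}"

lemma finite_shuffle_inversions: "finite (shuffle_inversions n S)"
  by (rule finite_subset[of _ "{..<n} \<times> {..<n}"]) (auto simp: shuffle_inversions_def)

text \<open>A first argument that goes to the left factor is in no inversion: it would have to be
  the larger index of the pair, but it is 0.\<close>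

lemma card_shuffle_inversions_insert_0:
  "card (shuffle_inversions (Suc n) (insert 0 (Suc ` S))) = card (shuffle_inversions n S)"
proof -
  have "shuffle_inversions (Suc n) (insert 0 (Suc ` S)) = map_prod Suc Suc ` shuffle_inversions n S"
  proof (intro equalityI subsetI)
    fix z assume "z \<in> shuffle_inversions (Suc n) (insert 0 (Suc ` S))"
    then obtain i j where z: "z = (i, j)" "i < j" "j < Suc n" "i \<noteq> 0" "i \<notin> Suc ` S" "j \<in> insert 0 (Suc ` S)"
      by (auto simp: shuffle_inversions_def)
    then obtain i' j' where "i = Suc i'" "j = Suc j'" by (metis not0_implies_Suc less_zeroE)
    then show "z \<in> map_prod Suc Suc ` shuffle_inversions n S"
      using z by (auto simp: shuffle_inversions_def intro!: image_eqI[of _ _ "(i', j')"])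
  qed (auto simp: shuffle_inversions_def)
  moreover have "inj_on (map_prod Suc Suc) (shuffle_inversions n S)" by (auto simp: inj_on_def)
  ultimately show ?thesis by (simp add: card_image)
qed

text \<open>A first argument that goes to the right factor is inverted with every element of
  \<open>S\<close>. The additional \<open>card S\<close> becomes the sign of passing over the left
  factor.\<close>

lemma card_shuffle_inversions_Suc:
  assumes "S \<subseteq> {..<n}"
  shows "card (shuffle_inversions (Suc n) (Suc ` S)) = card (shuffle_inversions n S) + card S"
proof -
  have "shuffle_inversions (Suc n) (Suc ` S)
      = map_prod Suc Suc ` shuffle_inversions n S \<union> (\<lambda>j. (0, Suc j)) ` S" (is "?L = ?R")
  proof (intro equalityI subsetI)
    fix z assume "z \<in> ?L"
    then obtain i j where z: "z = (i, Suc j)" "i < Suc j" "j < n" "i \<notin> Suc ` S" "j \<in> S"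
      by (auto simp: shuffle_inversions_def)
    show "z \<in> ?R"
    proof (cases i)
      case 0
      then show ?thesis using z by simp
    next
      case (Suc i')
      then have "(i', j) \<in> shuffle_inversions n S" using z by (auto simp: shuffle_inversions_def)
      then show ?thesis using z(1) Suc by (intro UnI1 image_eqI[of _ _ "(i', j)"]) simp_all
    qed
  qed (use assms in \<open>auto simp: shuffle_inversions_def\<close>)
  moreover have "card (map_prod Suc Suc ` shuffle_inversions n S \<union> (\<lambda>j. (0, Suc j)) ` S)
      = card (map_prod Suc Suc ` shuffle_inversions n S) + card ((\<lambda>j. (0::nat, Suc j)) ` S)"
    using finite_subset[OF assms] finite_shuffle_inversions by (intro card_Un_disjoint) auto
  moreover have "inj_on (map_prod Suc Suc) (shuffle_inversions n S)" "inj_on (\<lambda>j. (0::nat, Suc j)) S"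
    by (auto simp: inj_on_def)
  ultimately show ?thesis by (simp add: card_image)
qed

lemma Pow_lessThan_Suc:
  "Pow {..<Suc n} = (\<lambda>S. insert 0 (Suc ` S)) ` Pow {..<n} \<union> (\<lambda>S. Suc ` S) ` Pow {..<n}"
proof -
  have "{..<Suc n} = insert 0 (Suc ` {..<n})" by (rule lessThan_Suc_eq_insert_0)
  then show ?thesis by (simp add: Pow_insert image_Pow_surj[symmetric] image_image Un_commute)
qed

lemma wedge_alt:
  "wedge \<alpha> \<beta> Xs p = (\<Sum>S\<in>Pow {..<length Xs}. (-1) ^ card (shuffle_inversions (length Xs) S) *
     \<alpha> (nths Xs S) p * \<beta> (nths Xs (- S)) p)"
  by (simp add: wedge_def shuffle_inversions_def)

lemma gsign_apply: "gsign n f x = (-1) ^ n * (f x :: real)"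
  by (simp add: gsign_def)

lemma wedge_Nil: "wedge \<alpha> \<beta> [] = \<alpha> [] * \<beta> []"
  by (rule ext) (simp add: wedge_def)

text \<open>
  The recursion along the list of arguments reduces the identities of the exterior algebra to
  inductions on lists, without any computation with shuffles. It holds for arbitrary functions of lists.
\<close>

lemma contract_wedge:
  "contract Y (wedge \<alpha> \<beta>) = wedge (contract Y \<alpha>) \<beta> + wedge (parity_involution \<alpha>) (contract Y \<beta>)"
  for Y :: "'a vfield"
proof (intro ext)
  fix Ys :: "'a vfield list" and p :: 'a
  let ?n = "length Ys" and ?P = "Pow {..<length Ys}"
  let ?t = "\<lambda>S. (-1) ^ card (shuffle_inversions (Suc ?n) S) *
     \<alpha> (nths (Y # Ys) S) p * \<beta> (nths (Y # Ys) (- S)) p"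
  have inj: "inj_on (\<lambda>S. insert 0 (Suc ` S)) ?P" "inj_on (\<lambda>S. Suc ` S) ?P"
    by (auto simp: inj_on_def)
  \<comment> \<open>The shuffles are split by whether the first argument \<open>Y\<close> goes to
    \<open>\<alpha>\<close> or to \<open>\<beta>\<close>.\<close>
  have "wedge \<alpha> \<beta> (Y # Ys) p = sum ?t ((\<lambda>S. insert 0 (Suc ` S)) ` ?P) + sum ?t ((\<lambda>S. Suc ` S) ` ?P)"
    unfolding wedge_alt length_Cons Pow_lessThan_Suc by (rule sum.union_disjoint) auto
  also have "sum ?t ((\<lambda>S. insert 0 (Suc ` S)) ` ?P) = wedge (contract Y \<alpha>) \<beta> Ys p"
  proof -
    have e: "{j. Suc j \<notin> Suc ` S} = - S" "{j. Suc j \<in> Suc ` S} = S" for S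
      by auto
    show ?thesis
      unfolding sum.reindex[OF inj(1)] wedge_alt
      by (rule sum.cong) (simp_all add: nths_Cons e card_shuffle_inversions_insert_0 contract_def)
  qed
  also have "sum ?t ((\<lambda>S. Suc ` S) ` ?P) = wedge (parity_involution \<alpha>) (contract Y \<beta>) Ys p"
  proof -
    have e: "{j. Suc j \<notin> Suc ` S} = - S" "{j. Suc j \<in> Suc ` S} = S" for S
      by auto
    \<comment> \<open>The left factor receives \<open>card S\<close> arguments, so the extra sign is
      exactly that of \<open>parity_involution\<close>.\<close>
    have l: "length (nths Ys S) = card S" if "S \<in> ?P" for S
      using that by (auto simp: length_nths intro!: arg_cong[where f=card])
    show ?thesis
      unfolding sum.reindex[OF inj(2)] wedge_alt
      by (rule sum.cong) (simp_all add: nths_Cons e card_shuffle_inversions_Suc contract_def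
          parity_involution_def gsign_apply l power_add)
  qed
  finally show "contract Y (wedge \<alpha> \<beta>) Ys p =
      (wedge (contract Y \<alpha>) \<beta> + wedge (parity_involution \<alpha>) (contract Y \<beta>)) Ys p"
    by (simp add: contract_def)
qed

lemma wedge_Cons:
  "wedge \<alpha> \<beta> (Y # Ys) = wedge (contract Y \<alpha>) \<beta> Ys + wedge (parity_involution \<alpha>) (contract Y \<beta>) Ys"
  using contract_wedge[of Y \<alpha> \<beta>] by (simp add: contract_def fun_eq_iff)

lemma wedge_add_left: "wedge (\<alpha> + \<beta>) \<gamma> = wedge \<alpha> \<gamma> + wedge \<beta> \<gamma>"
  by (intro ext) (simp add: wedge_def sum.distrib[symmetric] algebra_simps)

lemma wedge_add_right: "wedge \<gamma> (\<alpha> + \<beta>) = wedge \<gamma> \<alpha> + wedge \<gamma> \<beta>"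
  by (intro ext) (simp add: wedge_def sum.distrib[symmetric] algebra_simps)

lemma wedge_zero_left [simp]: "wedge 0 \<gamma> = 0" and wedge_zero_right [simp]: "wedge \<gamma> 0 = 0"
  by (simp_all add: wedge_def fun_eq_iff)

lemma wedge_uminus_left [simp]: "wedge (- \<alpha>) \<gamma> = - wedge \<alpha> \<gamma>"
  and wedge_uminus_right [simp]: "wedge \<gamma> (- \<alpha>) = - wedge \<gamma> \<alpha>"
  by (simp_all add: wedge_def fun_eq_iff sum_negf)

lemma wedge_minus_left: "wedge (\<alpha> - \<beta>) \<gamma> = wedge \<alpha> \<gamma> - wedge \<beta> \<gamma>"
  using wedge_add_left[of \<alpha> "- \<beta>" \<gamma>] by simp

lemma wedge_minus_right: "wedge \<gamma> (\<alpha> - \<beta>) = wedge \<gamma> \<alpha> - wedge \<gamma> \<beta>"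
  using wedge_add_right[of \<gamma> \<alpha> "- \<beta>"] by simp

lemma wedge_scale_left: "wedge (form_scale f \<alpha>) \<gamma> = form_scale f (wedge \<alpha> \<gamma>)"
  by (intro ext) (simp add: wedge_def form_scale_def sum_distrib_left mult_ac)

lemma wedge_scale_right: "wedge \<gamma> (form_scale f \<alpha>) = form_scale f (wedge \<gamma> \<alpha>)"
  by (intro ext) (simp add: wedge_def form_scale_def sum_distrib_left mult_ac)

lemma gsign_add: "gsign n (a + b) = gsign n a + (gsign n b :: 'b::ab_group_add)"
  and gsign_minus: "gsign n (a - b) = gsign n a - (gsign n b :: 'b::ab_group_add)"
  and gsign_zero [simp]: "gsign n (0 :: 'b::ab_group_add) = 0"
  and gsign_uminus: "gsign n (- a) = - (gsign n a :: 'b::ab_group_add)"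
  by (simp_all add: gsign_def)

lemma gsign_gsign: "gsign n (gsign m a) = (gsign (n + m) a :: 'b::ab_group_add)"
  by (simp add: gsign_def)

lemma gsign_cong: "even n = even m \<Longrightarrow> gsign n a = gsign m a"
  by (simp add: gsign_def)

lemma gsign_fun_apply: "gsign n f x = gsign n (f x)" for f :: "'b \<Rightarrow> 'c::ab_group_add"
  by (simp add: gsign_def)

lemma wedge_gsign_left: "wedge (gsign n \<alpha>) \<beta> = gsign n (wedge \<alpha> \<beta>)"
  and wedge_gsign_right: "wedge \<alpha> (gsign n \<beta>) = gsign n (wedge \<alpha> \<beta>)"
  by (simp_all add: gsign_def)

lemma contract_simps [simp]:
  "contract Y (\<alpha> + \<beta>) = contract Y \<alpha> + contract Y \<beta>"
  "contract Y (\<alpha> - \<beta>) = contract Y \<alpha> - contract Y \<beta>"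
  "contract Y (- \<alpha>) = - contract Y \<alpha>"
  "contract Y 0 = 0"
  "contract Y (form_scale f \<alpha>) = form_scale f (contract Y \<alpha>)"
  "contract Y (zero_form f) = 0"
  by (simp_all add: contract_def form_scale_def zero_form_def fun_eq_iff)

lemma parity_involution_involutive [simp]: "parity_involution (parity_involution \<alpha>) = \<alpha>"
  by (rule ext) (simp add: parity_involution_def gsign_gsign, simp add: gsign_def)

lemma parity_involution_add: "parity_involution (\<alpha> + \<beta>) = parity_involution \<alpha> + parity_involution \<beta>"
  by (rule ext) (simp add: parity_involution_def gsign_add)

lemma contract_parity_involution:
  "contract Y (parity_involution \<alpha>) = - parity_involution (contract Y \<alpha>)"
  by (simp add: contract_def parity_involution_def fun_eq_iff gsign_def)

lemma parity_involution_zero_form [simp]: "parity_involution (zero_form f) = zero_form f"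
  by (simp add: parity_involution_def zero_form_def gsign_def fun_eq_iff)

lemma parity_involution_wedge:
  "parity_involution (wedge \<alpha> \<beta>) = wedge (parity_involution \<alpha>) (parity_involution \<beta>)"
proof
  show "parity_involution (wedge \<alpha> \<beta>) Ys = wedge (parity_involution \<alpha>) (parity_involution \<beta>) Ys" for Ys
  proof (induction Ys arbitrary: \<alpha> \<beta>)
    case Nil
    then show ?case by (simp add: parity_involution_def wedge_Nil gsign_def)
  next
    case (Cons Y Ys)
    have "parity_involution (wedge \<alpha> \<beta>) (Y # Ys) = - parity_involution (contract Y (wedge \<alpha> \<beta>)) Ys"
      using contract_parity_involution[of Y "wedge \<alpha> \<beta>"] by (simp add: contract_def fun_eq_iff)
    also have "\<dots> = - (wedge (parity_involution (contract Y \<alpha>)) (parity_involution \<beta>) Ys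
        + wedge \<alpha> (parity_involution (contract Y \<beta>)) Ys)"
      by (simp add: contract_wedge parity_involution_add Cons.IH)
    finally show ?case by (simp add: wedge_Cons contract_parity_involution)
  qed
qed

text \<open>Contraction acts on both sides by the same three-term Leibniz rule; on the empty list
  the claim is associativity of multiplication.\<close>

lemma wedge_assoc: "wedge (wedge \<alpha> \<beta>) \<gamma> = wedge \<alpha> (wedge \<beta> \<gamma>)"
proof
  show "wedge (wedge \<alpha> \<beta>) \<gamma> Ys = wedge \<alpha> (wedge \<beta> \<gamma>) Ys" for Ys
    by (induction Ys arbitrary: \<alpha> \<beta> \<gamma>)
      (simp_all add: wedge_Nil mult.assoc wedge_Cons contract_wedge wedge_add_left wedge_add_right
        parity_involution_wedge add.assoc)
qed

lemma wedge_zero_form_left: "wedge (zero_form f) \<omega> = form_scale f \<omega>"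
proof
  show "wedge (zero_form f) \<omega> Ys = form_scale f \<omega> Ys" for Ys
    by (induction Ys arbitrary: \<omega>)
      (simp_all add: wedge_Nil wedge_Cons form_scale_def fun_cong[OF zero_form_def], simp add: contract_def)
qed

lemma wedge_zero_form_right: "wedge \<omega> (zero_form f) = form_scale f \<omega>"
proof
  show "wedge \<omega> (zero_form f) Ys = form_scale f \<omega> Ys" for Ys
    by (induction Ys arbitrary: \<omega>)
      (simp_all add: wedge_Nil wedge_Cons form_scale_def fun_cong[OF zero_form_def] mult.commute, simp add: contract_def)
qed

text \<open>The grading condition alone, separated from membership in the space of forms, so that
  graded commutativity needs no manifold.\<close>

definition has_parity :: "nat \<Rightarrow> 'a form \<Rightarrow> bool" where
  "has_parity r \<omega> \<longleftrightarrow> (\<forall>Xs. odd (length Xs + r) \<longrightarrow> \<omega> Xs = 0)"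

lemma parity_involution_has_parity: "has_parity r \<omega> \<Longrightarrow> parity_involution \<omega> = gsign r \<omega>"
  unfolding has_parity_def parity_involution_def gsign_def fun_eq_iff by auto

lemma has_parity_contract: "has_parity r \<omega> \<Longrightarrow> has_parity (Suc r) (contract Y \<omega>)"
  by (simp add: has_parity_def contract_def)

text \<open>Parity is an eigenvalue condition for the multiplicative map
  \<open>parity_involution\<close>. At a list of the wrong length the two signs differ, so the value
  equals its own negative.\<close>

lemma has_parity_wedge:
  assumes "has_parity r \<alpha>" "has_parity s \<beta>" shows "has_parity (r + s) (wedge \<alpha> \<beta>)"
proof -
  have "parity_involution (wedge \<alpha> \<beta>) = gsign (r + s) (wedge \<alpha> \<beta>)"
    by (simp add: parity_involution_wedge parity_involution_has_parity[OF assms(1)]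
        parity_involution_has_parity[OF assms(2)] wedge_gsign_left wedge_gsign_right gsign_gsign add.commute)
  then have "gsign (length Xs) (wedge \<alpha> \<beta> Xs p) = gsign (r + s) (wedge \<alpha> \<beta> Xs p)" for Xs p
    by (simp add: parity_involution_def fun_eq_iff gsign_fun_apply)
  then show ?thesis
    unfolding has_parity_def fun_eq_iff gsign_def
    by (metis add.inverse_neutral even_add neg_equal_0_iff_equal equal_neg_zero zero_fun_apply)
qed

text \<open>Contracting one factor raises its parity by one; the change of the exponent
  \<open>r * s\<close> this causes is compensated by the sign in the recursion for the exchanged
  product.\<close>

lemma wedge_graded_commute:
  fixes \<alpha> \<beta> :: "'a form"
  assumes "has_parity r \<alpha>" "has_parity s \<beta>" shows "wedge \<alpha> \<beta> = gsign (r * s) (wedge \<beta> \<alpha>)"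
proof
  show "wedge \<alpha> \<beta> Ys = gsign (r * s) (wedge \<beta> \<alpha>) Ys" for Ys
    using assms
  proof (induction Ys arbitrary: \<alpha> \<beta> r s)
    case Nil
    have "odd r \<Longrightarrow> \<alpha> [] = 0" "odd s \<Longrightarrow> \<beta> [] = 0"
      using Nil by (simp_all add: has_parity_def)
    then show ?case by (auto simp: wedge_Nil gsign_def mult.commute)
  next
    case (Cons Y Ys)
    note p = parity_involution_has_parity[OF Cons.prems(1)] parity_involution_has_parity[OF Cons.prems(2)]
    have "wedge \<alpha> \<beta> (Y # Ys) = gsign (Suc r * s) (wedge \<beta> (contract Y \<alpha>) Ys)
        + gsign r (gsign (r * Suc s) (wedge (contract Y \<beta>) \<alpha> Ys))"
      using Cons.IH[OF has_parity_contract[OF Cons.prems(1)] Cons.prems(2), of Y]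
        Cons.IH[OF Cons.prems(1) has_parity_contract[OF Cons.prems(2)], of Y]
      by (simp add: wedge_Cons p wedge_gsign_left gsign_fun_apply[where ?'b="'a vfield list"])
    also have "\<dots> = gsign (r * s) (wedge \<beta> \<alpha> (Y # Ys))"
      by (simp add: wedge_Cons p wedge_gsign_left gsign_fun_apply[where ?'b="'a vfield list"]) (simp add: gsign_def)
    finally show ?case by (simp add: gsign_fun_apply[where ?'b="'a vfield list"])
  qed
qed

section \<open>Differential forms and Lie derivatives\<close>

text \<open>
  Forms and vector fields are functions of two arguments. The simplifier may push the operations
  to the first argument only, so that values stay in the ring of functions on the manifold.
\<close>

declare plus_fun_apply [simp del] zero_fun_apply [simp del] times_fun_apply [simp del]
  minus_apply [simp del] uminus_apply [simp del]

lemma form_apply [simp]: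
  fixes \<alpha> \<beta> :: "'a form"
  shows "(\<alpha> + \<beta>) Xs = \<alpha> Xs + \<beta> Xs" "(\<alpha> - \<beta>) Xs = \<alpha> Xs - \<beta> Xs" "(- \<alpha>) Xs = - \<alpha> Xs"
    "(0 :: 'a form) Xs = 0"
  by (simp_all add: plus_fun_apply minus_apply uminus_apply zero_fun_apply)

lemma vfield_apply:
  fixes Y Z :: "'a vfield"
  shows "(Y + Z) f = Y f + Z f" "(Y - Z) f = Y f - Z f" "(- Y) f = - Y f" "(0 :: 'a vfield) f = 0"
  by (simp_all add: plus_fun_apply minus_apply uminus_apply zero_fun_apply)

lemmas pointwise = plus_fun_apply minus_apply uminus_apply zero_fun_apply times_fun_apply

context smooth_manifold
begin

abbreviation \<Omega> :: "'a form set" where "\<Omega> \<equiv> diff_forms A"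

lemma vector_fieldI:
  assumes "\<And>f. f \<notin> C \<Longrightarrow> Y f = 0" "\<And>f. f \<in> C \<Longrightarrow> Y f \<in> C"
    "\<And>f h. f \<in> C \<Longrightarrow> h \<in> C \<Longrightarrow> Y (f + h) = Y f + Y h"
    "\<And>c f. f \<in> C \<Longrightarrow> Y (\<lambda>p. c * f p) = (\<lambda>p. c * Y f p)"
    "\<And>f h. f \<in> C \<Longrightarrow> h \<in> C \<Longrightarrow> Y (f * h) = Y f * h + f * Y h"
  shows "Y \<in> V"
  using assms unfolding vector_fields_def by simp

lemma vector_field_combination:
  assumes "Y \<in> V" "Z \<in> V" "f \<in> C" "h \<in> C"
  shows "vf_scale f Y + vf_scale h Z \<in> V"
proof (rule vector_fieldI)
  fix k assume "k \<in> C"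
  then show "(vf_scale f Y + vf_scale h Z) k \<in> C"
    using assms by (simp add: vfield_apply vf_scale_def smooth_plus smooth_times vector_field_smooth)
qed (use assms in \<open>simp_all add: vfield_apply vf_scale_def vector_field_not_smooth vector_field_add
    vector_field_scale vector_field_mult algebra_simps pointwise fun_eq_iff\<close>)

lemma lie_bracket_in:
  assumes "Y \<in> V" "Z \<in> V" shows "lie_bracket Y Z \<in> V"
proof (rule vector_fieldI)
  fix f show "f \<notin> C \<Longrightarrow> lie_bracket Y Z f = 0"
    using assms by (simp add: lie_bracket_def vector_field_not_smooth vector_field_zero)
  fix f assume f: "f \<in> C"
  then show "lie_bracket Y Z f \<in> C"
    using assms by (simp add: lie_bracket_def smooth_minus vector_field_smooth)
  show "lie_bracket Y Z (\<lambda>p. c * f p) = (\<lambda>p. c * lie_bracket Y Z f p)" for c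
    using assms f by (simp add: lie_bracket_def vector_field_scale vector_field_smooth fun_eq_iff algebra_simps pointwise)
  fix h assume h: "h \<in> C"
  show "lie_bracket Y Z (f + h) = lie_bracket Y Z f + lie_bracket Y Z h"
    using assms f h by (simp add: lie_bracket_def vector_field_add vector_field_smooth)
  show "lie_bracket Y Z (f * h) = lie_bracket Y Z f * h + f * lie_bracket Y Z h"
    using assms f h by (simp add: lie_bracket_def vector_field_mult vector_field_add
        smooth_times vector_field_smooth algebra_simps)
qed

text \<open>The right-hand side is grouped into two two-term combinations so that
  \<open>contract_add_field\<close> followed by \<open>form_linear_0\<close> applies to it.\<close>

lemma lie_bracket_combination:
  assumes "Y \<in> V" "Z \<in> V" "W \<in> V" "f \<in> C" "h \<in> C"
  shows "lie_bracket Y (vf_scale f Z + vf_scale h W) =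
    (vf_scale f (lie_bracket Y Z) + vf_scale h (lie_bracket Y W)) + (vf_scale (Y f) Z + vf_scale (Y h) W)"
proof
  fix k
  show "lie_bracket Y (vf_scale f Z + vf_scale h W) k =
    ((vf_scale f (lie_bracket Y Z) + vf_scale h (lie_bracket Y W)) + (vf_scale (Y f) Z + vf_scale (Y h) W)) k"
    using assms by (simp add: vfield_apply lie_bracket_def vf_scale_def vector_field_mult vector_field_add
        smooth_times vector_field_smooth algebra_simps)
qed

lemma lie_bracket_jacobi:
  assumes "Y \<in> V" "Z \<in> V" "W \<in> V"
  shows "lie_bracket (lie_bracket Y Z) W = lie_bracket Y (lie_bracket Z W) - lie_bracket Z (lie_bracket Y W)"
  using assms by (simp add: lie_bracket_def vector_field_minus vector_field_smooth fun_eq_iff pointwise)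

section \<open>Working rules and a criterion for differential forms\<close>

lemma form_outside: "\<omega> \<in> \<Omega> \<Longrightarrow> \<not> set Xs \<subseteq> V \<Longrightarrow> \<omega> Xs = 0"
  unfolding diff_forms_def by simp

lemma form_smooth: "\<omega> \<in> \<Omega> \<Longrightarrow> \<omega> Xs \<in> C"
  by (cases "set Xs \<subseteq> V") (simp_all add: form_outside smooth_zero, simp add: diff_forms_def)

lemma form_bounded: assumes "\<omega> \<in> \<Omega>" obtains n where "\<And>Xs. n < length Xs \<Longrightarrow> \<omega> Xs = 0"
  using assms unfolding diff_forms_def by auto

text \<open>The position is marked by splitting the list, which suits induction along the prefix. No
  condition on the other arguments is required, because all terms vanish if one of them is not a
  vector field.\<close>

lemma form_linear:
  assumes "\<omega> \<in> \<Omega>" "Y \<in> V" "Z \<in> V" "f \<in> C" "h \<in> C"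
  shows "\<omega> (Xs @ (vf_scale f Y + vf_scale h Z) # Ys) = f * \<omega> (Xs @ Y # Ys) + h * \<omega> (Xs @ Z # Ys)"
proof (cases "set (Xs @ Ys) \<subseteq> V")
  case True
  have *: "\<forall>Xs i. set Xs \<subseteq> V \<longrightarrow> i < length Xs \<longrightarrow>
      (\<forall>Y\<in>V. \<forall>Z\<in>V. \<forall>f\<in>C. \<forall>h\<in>C.
         \<omega> (Xs[i := vf_scale f Y + vf_scale h Z]) = f * \<omega> (Xs[i := Y]) + h * \<omega> (Xs[i := Z]))"
    using assms(1) unfolding diff_forms_def by simp
  have "set (Xs @ Y # Ys) \<subseteq> V" "length Xs < length (Xs @ Y # Ys)" using True assms(2) by simp_all
  from *[rule_format, OF this assms(2-5)] show ?thesis by simp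
next
  case False
  then have "\<omega> (Xs @ W # Ys) = 0" for W by (intro form_outside[OF assms(1)]) auto
  then show ?thesis by simp
qed

lemma form_linear_0:
  assumes "\<omega> \<in> \<Omega>" "Y \<in> V" "Z \<in> V" "f \<in> C" "h \<in> C"
  shows "contract (vf_scale f Y + vf_scale h Z) \<omega> = form_scale f (contract Y \<omega>) + form_scale h (contract Z \<omega>)"
  using form_linear[OF assms, of "[]"] by (simp add: contract_def form_scale_def fun_eq_iff)

lemma vf_scale_one: "vf_scale 1 Y = Y"
  by (simp add: vf_scale_def)

lemma form_add:
  assumes "\<omega> \<in> \<Omega>" "Y \<in> V" "Z \<in> V"
  shows "\<omega> (Xs @ (Y + Z) # Ys) = \<omega> (Xs @ Y # Ys) + \<omega> (Xs @ Z # Ys)"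
  using form_linear[OF assms smooth_one smooth_one, of Xs Ys] by (simp add: vf_scale_one)

lemma contract_add_field:
  "\<omega> \<in> \<Omega> \<Longrightarrow> Y \<in> V \<Longrightarrow> Z \<in> V \<Longrightarrow> contract (Y + Z) \<omega> = contract Y \<omega> + contract Z \<omega>"
  using form_add[of \<omega> Y Z "[]"] by (simp add: contract_def fun_eq_iff)

lemma form_alternating:
  assumes "\<omega> \<in> \<Omega>" shows "\<omega> (Xs @ Y # Y # Ys) = 0"
proof -
  have "\<forall>Xs i j. i < j \<longrightarrow> j < length Xs \<longrightarrow> Xs ! i = Xs ! j \<longrightarrow> \<omega> Xs = 0"
    using assms unfolding diff_forms_def by simp
  from this[rule_format, of "length Xs" "Suc (length Xs)"] show ?thesis by (simp add: nth_append)
qed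

text \<open>Polarisation. It is stated for an arbitrary \<open>\<omega>\<close> because the
  criterion below needs it before \<open>\<omega>\<close> is known to be a form.\<close>

lemma skew_of_alternating:
  assumes out: "\<And>Xs. \<not> set Xs \<subseteq> V \<Longrightarrow> \<omega> Xs = (0 :: 'a \<Rightarrow> real)"
    and lin: "\<And>Xs Y Z Ys. Y \<in> V \<Longrightarrow> Z \<in> V \<Longrightarrow> \<omega> (Xs @ (Y + Z) # Ys) = \<omega> (Xs @ Y # Ys) + \<omega> (Xs @ Z # Ys)"
    and alt: "\<And>Xs Y Ys. \<omega> (Xs @ Y # Y # Ys) = 0"
  shows "\<omega> (Xs @ Y # Z # Ys) = - \<omega> (Xs @ Z # Y # Ys)"
proof (cases "Y \<in> V \<and> Z \<in> V")
  case True
  have "0 = \<omega> (Xs @ (Y + Z) # (Y + Z) # Ys)" by (simp add: alt)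
  also have "\<dots> = \<omega> (Xs @ Y # (Y + Z) # Ys) + \<omega> (Xs @ Z # (Y + Z) # Ys)"
    using True by (simp add: lin)
  also have "\<dots> = \<omega> (Xs @ Y # Z # Ys) + \<omega> (Xs @ Z # Y # Ys)"
    using True lin[of Y Z "Xs @ [Y]" Ys] lin[of Y Z "Xs @ [Z]" Ys] by (simp add: alt)
  finally show ?thesis by (metis eq_neg_iff_add_eq_0)
next
  case False
  then have "\<not> set (Xs @ Y # Z # Ys) \<subseteq> V" "\<not> set (Xs @ Z # Y # Ys) \<subseteq> V" by auto
  then show ?thesis using out by simp
qed

lemma form_skew: "\<omega> \<in> \<Omega> \<Longrightarrow> \<omega> (Xs @ Y # Z # Ys) = - \<omega> (Xs @ Z # Y # Ys)"
  by (rule skew_of_alternating) (simp_all add: form_outside form_add form_alternating)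

lemma contract_alternating: "\<omega> \<in> \<Omega> \<Longrightarrow> contract Y (contract Y \<omega>) = 0"
  using form_alternating[of \<omega> "[]"] by (simp add: contract_def fun_eq_iff)

lemma contract_skew: "\<omega> \<in> \<Omega> \<Longrightarrow> contract Y (contract Z \<omega>) = - contract Z (contract Y \<omega>)"
  using form_skew[of \<omega> "[]"] by (simp add: contract_def fun_eq_iff)

text \<open>Alternation is asked for adjacent equal arguments only; this is the case that the
  recursions along the list can reach.\<close>

lemma formI:
  assumes out: "\<And>Xs. \<not> set Xs \<subseteq> V \<Longrightarrow> \<omega> Xs = 0"
    and smooth: "\<And>Xs. \<omega> Xs \<in> C"
    and lin: "\<And>Xs Y Z f h Ys. set (Xs @ Ys) \<subseteq> V \<Longrightarrow> Y \<in> V \<Longrightarrow> Z \<in> V \<Longrightarrow> f \<in> C \<Longrightarrow> h \<in> C \<Longrightarrow>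
      \<omega> (Xs @ (vf_scale f Y + vf_scale h Z) # Ys) = f * \<omega> (Xs @ Y # Ys) + h * \<omega> (Xs @ Z # Ys)"
    and alt: "\<And>Xs Y Ys. set (Y # Xs @ Ys) \<subseteq> V \<Longrightarrow> \<omega> (Xs @ Y # Y # Ys) = 0"
    and bounded: "\<And>Xs. n < length Xs \<Longrightarrow> \<omega> Xs = 0"
  shows "\<omega> \<in> \<Omega>"
proof -
  have alt': "\<omega> (Xs @ Y # Y # Ys) = 0" for Xs Y Ys
    using alt[of Y Xs Ys] out[of "Xs @ Y # Y # Ys"] by (cases "set (Y # Xs @ Ys) \<subseteq> V") auto
  have add: "\<omega> (Xs @ (Y + Z) # Ys) = \<omega> (Xs @ Y # Ys) + \<omega> (Xs @ Z # Ys)" if "Y \<in> V" "Z \<in> V" for Xs Y Z Ys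
  proof (cases "set (Xs @ Ys) \<subseteq> V")
    case True
    from lin[OF this that smooth_one smooth_one] show ?thesis by (simp add: vf_scale_one)
  next
    case False
    then have "\<omega> (Xs @ W # Ys) = 0" for W by (intro out) auto
    then show ?thesis by simp
  qed
  note skew = skew_of_alternating[of \<omega>, OF out add alt']
  \<comment> \<open>Adjacent transpositions move the left copy of \<open>Y\<close> to the right
    until the two copies meet.\<close>
  have far: "\<omega> (Xs @ Y # Ws @ Y # Ys) = 0" for Xs Y Ws Ys
  proof (induction Ws arbitrary: Xs)
    case Nil
    then show ?case by (simp add: alt')
  next
    case (Cons W Ws)
    have "\<omega> (Xs @ Y # W # (Ws @ Y # Ys)) = - \<omega> ((Xs @ [W]) @ Y # Ws @ Y # Ys)"
      using skew[of Xs Y W "Ws @ Y # Ys"] by simp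
    then show ?case using Cons.IH[of "Xs @ [W]"] by simp
  qed
  have "\<omega> Xs = 0" if "i < j" "j < length Xs" "Xs ! i = Xs ! j" for Xs i j
  proof -
    have "Xs = take i Xs @ Xs ! i # drop (Suc i) Xs"
      using that by (intro id_take_nth_drop) simp
    moreover have "drop (Suc i) Xs = take (j - Suc i) (drop (Suc i) Xs) @ Xs ! j # drop (Suc j) Xs"
      using that id_take_nth_drop[of "j - Suc i" "drop (Suc i) Xs"] by simp
    ultimately show ?thesis using far that(3) by metis
  qed
  moreover have "\<omega> (Xs[i := vf_scale f Y + vf_scale h Z]) = f * \<omega> (Xs[i := Y]) + h * \<omega> (Xs[i := Z])"
    if "set Xs \<subseteq> V" "i < length Xs" "Y \<in> V" "Z \<in> V" "f \<in> C" "h \<in> C" for Xs i Y Z f h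
  proof -
    have "set (take i Xs @ drop (Suc i) Xs) \<subseteq> V"
      using that(1) set_take_subset[of i Xs] set_drop_subset[of "Suc i" Xs] by auto
    from lin[OF this that(3-6)] show ?thesis
      using that(2) by (simp add: upd_conv_take_nth_drop)
  qed
  ultimately show ?thesis
    unfolding diff_forms_def mem_Collect_eq
    by (intro conjI exI[of _ n]) (auto intro: out smooth bounded)
qed

section \<open>Closure properties of the space of forms\<close>

lemma form_zero: "0 \<in> \<Omega>"
  by (rule formI[of _ 0]) (simp_all add: smooth_zero)

lemma form_plus:
  assumes "\<alpha> \<in> \<Omega>" "\<beta> \<in> \<Omega>" shows "\<alpha> + \<beta> \<in> \<Omega>"
proof -
  obtain n m where "\<And>Xs. n < length Xs \<Longrightarrow> \<alpha> Xs = 0" "\<And>Xs. m < length Xs \<Longrightarrow> \<beta> Xs = 0"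
    using form_bounded[OF assms(1)] form_bounded[OF assms(2)] by metis
  then show ?thesis using assms
    by (intro formI[of _ "max n m"]) (simp_all add: form_outside form_smooth smooth_plus form_linear
        form_alternating algebra_simps)
qed

lemma form_form_scale:
  assumes "\<alpha> \<in> \<Omega>" "f \<in> C" shows "form_scale f \<alpha> \<in> \<Omega>"
proof -
  obtain n where "\<And>Xs. n < length Xs \<Longrightarrow> \<alpha> Xs = 0"
    using form_bounded[OF assms(1)] by metis
  then show ?thesis using assms
    by (intro formI[of _ n]) (simp_all add: form_scale_def form_outside form_smooth smooth_times form_linear
        form_alternating algebra_simps)
qed

lemma form_scale_const: "form_scale (\<lambda>_. c) \<alpha> = (\<lambda>Xs p. c * \<alpha> Xs p)"
  by (simp add: form_scale_def fun_eq_iff pointwise)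

lemma form_real_scale: "\<alpha> \<in> \<Omega> \<Longrightarrow> (\<lambda>Xs p. c * \<alpha> Xs p) \<in> \<Omega>"
  using form_form_scale[OF _ smooth_const[of c]] by (simp add: form_scale_const)

lemma form_uminus: "\<alpha> \<in> \<Omega> \<Longrightarrow> - \<alpha> \<in> \<Omega>"
  using form_real_scale[of \<alpha> "-1"] by (simp add: fun_Compl_def)

lemma form_minus: "\<alpha> \<in> \<Omega> \<Longrightarrow> \<beta> \<in> \<Omega> \<Longrightarrow> \<alpha> - \<beta> \<in> \<Omega>"
  using form_plus[OF _ form_uminus] by (metis diff_conv_add_uminus)

lemma form_gsign: "\<alpha> \<in> \<Omega> \<Longrightarrow> gsign n \<alpha> \<in> \<Omega>"
  by (simp add: gsign_def form_uminus)

lemma form_sum: "(\<And>i. i \<in> I \<Longrightarrow> \<alpha> i \<in> \<Omega>) \<Longrightarrow> sum \<alpha> I \<in> \<Omega>"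
  by (induction I rule: infinite_finite_induct) (auto intro: form_zero form_plus)

lemma form_zero_form: "f \<in> C \<Longrightarrow> zero_form f \<in> \<Omega>"
  by (rule formI[of _ 0]) (auto simp: zero_form_def smooth_zero)

lemma form_contract:
  assumes "\<alpha> \<in> \<Omega>" shows "contract Y \<alpha> \<in> \<Omega>"
proof -
  obtain n where n: "\<And>Xs. n < length Xs \<Longrightarrow> \<alpha> Xs = 0"
    using form_bounded[OF assms(1)] by metis
  show ?thesis
  proof (rule formI[of _ n])
    show "contract Y \<alpha> Xs = 0" if "\<not> set Xs \<subseteq> V" for Xs
      unfolding contract_def using that by (intro form_outside[OF assms]) simp
    show "contract Y \<alpha> (Xs @ (vf_scale f U + vf_scale h Z) # Ys) =
        f * contract Y \<alpha> (Xs @ U # Ys) + h * contract Y \<alpha> (Xs @ Z # Ys)"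
      if "U \<in> V" "Z \<in> V" "f \<in> C" "h \<in> C" for Xs Ys U Z f h
      using form_linear[OF assms that, of "Y # Xs" Ys] by (simp add: contract_def)
    show "contract Y \<alpha> (Xs @ U # U # Ys) = 0" for Xs U Ys
      using form_alternating[OF assms, of "Y # Xs"] by (simp add: contract_def)
  qed (simp_all add: contract_def form_smooth assms n)
qed

lemma contract_outside: "\<alpha> \<in> \<Omega> \<Longrightarrow> Y \<notin> V \<Longrightarrow> contract Y \<alpha> = 0"
  by (simp add: contract_def fun_eq_iff form_outside)

lemma form_parity_involution:
  assumes "\<alpha> \<in> \<Omega>" shows "parity_involution \<alpha> \<in> \<Omega>"
proof -
  obtain n where n: "\<And>Xs. n < length Xs \<Longrightarrow> \<alpha> Xs = 0"
    using form_bounded[OF assms(1)] by metis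
  then show ?thesis using assms
    by (intro formI[of _ n]) (simp_all add: parity_involution_def form_outside form_smooth form_linear
        form_alternating gsign_def smooth_uminus)
qed

lemma wedge_smooth: "\<alpha> \<in> \<Omega> \<Longrightarrow> \<beta> \<in> \<Omega> \<Longrightarrow> wedge \<alpha> \<beta> Xs \<in> C"
  by (induction Xs arbitrary: \<alpha> \<beta>)
    (simp_all add: wedge_Nil wedge_Cons smooth_times smooth_plus form_smooth form_contract form_parity_involution)

lemma wedge_outside: "\<alpha> \<in> \<Omega> \<Longrightarrow> \<beta> \<in> \<Omega> \<Longrightarrow> \<not> set Xs \<subseteq> V \<Longrightarrow> wedge \<alpha> \<beta> Xs = 0"
proof (induction Xs arbitrary: \<alpha> \<beta>)
  case (Cons Y Xs)
  show ?case
  proof (cases "Y \<in> V")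
    case True
    then have "\<not> set Xs \<subseteq> V" using Cons.prems by simp
    then show ?thesis
      by (simp add: wedge_Cons Cons.IH form_contract form_parity_involution Cons.prems(1,2))
  next
    case False
    then show ?thesis by (simp add: wedge_Cons contract_outside Cons.prems(1,2))
  qed
qed simp

lemma wedge_linear:
  assumes "Y \<in> V" "Z \<in> V" "f \<in> C" "h \<in> C"
  shows "\<alpha> \<in> \<Omega> \<Longrightarrow> \<beta> \<in> \<Omega> \<Longrightarrow>
    wedge \<alpha> \<beta> (Xs @ (vf_scale f Y + vf_scale h Z) # Ys) =
    f * wedge \<alpha> \<beta> (Xs @ Y # Ys) + h * wedge \<alpha> \<beta> (Xs @ Z # Ys)"
proof (induction Xs arbitrary: \<alpha> \<beta>)
  case Nil
  then show ?case
    by (simp add: wedge_Cons form_linear_0 assms wedge_add_left wedge_add_right wedge_scale_left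
        wedge_scale_right distrib_left add_ac) (simp add: form_scale_def add_ac)
next
  case (Cons X Xs)
  then show ?case
    by (simp add: wedge_Cons Cons.IH form_contract form_parity_involution distrib_left add_ac)
qed

text \<open>Contracting twice with \<open>Y\<close> leaves two mixed terms, which cancel because
  contraction anticommutes with \<open>parity_involution\<close>.\<close>

lemma wedge_alternating:
  "\<alpha> \<in> \<Omega> \<Longrightarrow> \<beta> \<in> \<Omega> \<Longrightarrow> wedge \<alpha> \<beta> (Xs @ Y # Y # Ys) = 0"
proof (induction Xs arbitrary: \<alpha> \<beta>)
  case Nil
  then show ?case
    by (simp add: wedge_Cons contract_alternating contract_parity_involution)
next
  case (Cons X Xs)
  then show ?case by (simp add: wedge_Cons form_contract form_parity_involution)
qed

text \<open>The arguments are distributed over the two factors, so one of the factors receives more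
  than its bound.\<close>

lemma wedge_bounded:
  assumes "\<And>Xs. n < length Xs \<Longrightarrow> \<alpha> Xs = 0" "\<And>Xs. m < length Xs \<Longrightarrow> \<beta> Xs = 0" "n + m < length Xs"
  shows "wedge \<alpha> \<beta> Xs = 0"
proof
  fix p
  have "\<alpha> (nths Xs S) p * \<beta> (nths Xs (- S)) p = 0" for S
  proof -
    have "{..<length Xs} = {i. i < length Xs \<and> i \<in> S} \<union> {i. i < length Xs \<and> i \<notin> S}" by auto
    then have "length Xs = card ({i. i < length Xs \<and> i \<in> S} \<union> {i. i < length Xs \<and> i \<notin> S})"
      by (metis card_lessThan)
    also have "\<dots> \<le> length (nths Xs S) + length (nths Xs (- S))"
      by (simp add: length_nths card_Un_le)
    finally have "n < length (nths Xs S) \<or> m < length (nths Xs (- S))" using assms(3) by linarith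
    then show ?thesis using assms(1,2) by (auto simp: zero_fun_apply)
  qed
  then show "wedge \<alpha> \<beta> Xs p = 0 p"
    unfolding wedge_alt zero_fun_apply mult.assoc by (intro sum.neutral) simp
qed

lemma form_wedge:
  assumes "\<alpha> \<in> \<Omega>" "\<beta> \<in> \<Omega>" shows "wedge \<alpha> \<beta> \<in> \<Omega>"
proof -
  obtain n m where "\<And>Xs. n < length Xs \<Longrightarrow> \<alpha> Xs = 0" "\<And>Xs. m < length Xs \<Longrightarrow> \<beta> Xs = 0"
    using form_bounded[OF assms(1)] form_bounded[OF assms(2)] by metis
  note b = wedge_bounded[OF this]
  show ?thesis using assms
    by (intro formI[OF _ _ _ _ b]) (simp_all add: wedge_outside wedge_smooth wedge_linear wedge_alternating)
qed

section \<open>The Lie derivative\<close>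

lemma lie_derivative_Nil: "\<omega> \<in> \<Omega> \<Longrightarrow> lie_derivative A Y \<omega> [] = Y (\<omega> [])"
  by (simp add: lie_derivative_def)

lemma lie_derivative_not_form: "\<omega> \<notin> \<Omega> \<Longrightarrow> lie_derivative A Y \<omega> = 0"
  by (simp add: lie_derivative_def fun_eq_iff)

lemma contract_lie_derivative_outside: "Z \<notin> V \<Longrightarrow> contract Z (lie_derivative A Y \<omega>) = 0"
  by (simp add: lie_derivative_def contract_def fun_eq_iff)

text \<open>Cartan's identity, obtained by separating the summand of index 0. For Lie derivatives it
  is the recursion along the arguments that \<open>contract_wedge\<close> is for products.\<close>

lemma contract_lie_derivative:
  assumes "\<omega> \<in> \<Omega>" "Y \<in> V" "Z \<in> V"
  shows "contract Z (lie_derivative A Y \<omega>) =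
    lie_derivative A Y (contract Z \<omega>) - contract (lie_bracket Y Z) \<omega>"
proof
  fix Zs
  show "contract Z (lie_derivative A Y \<omega>) Zs =
    (lie_derivative A Y (contract Z \<omega>) - contract (lie_bracket Y Z) \<omega>) Zs"
  proof (cases "set Zs \<subseteq> V")
    case True
    then show ?thesis
      using assms form_contract[OF assms(1), of Z]
      by (simp add: contract_def lie_derivative_def sum.lessThan_Suc_shift del: sum.lessThan_Suc)
  next
    case False
    then show ?thesis
      by (simp add: contract_def lie_derivative_def form_outside[OF assms(1)])
  qed
qed

lemma lie_derivative_add:
  "\<alpha> \<in> \<Omega> \<Longrightarrow> \<beta> \<in> \<Omega> \<Longrightarrow> Y \<in> V \<Longrightarrow> lie_derivative A Y (\<alpha> + \<beta>) = lie_derivative A Y \<alpha> + lie_derivative A Y \<beta>"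
  by (rule ext) (simp add: lie_derivative_def form_plus vector_field_add form_smooth sum.distrib)

lemma lie_derivative_scale:
  "\<alpha> \<in> \<Omega> \<Longrightarrow> f \<in> C \<Longrightarrow> Y \<in> V \<Longrightarrow> lie_derivative A Y (form_scale f \<alpha>) =
    form_scale (Y f) \<alpha> + form_scale f (lie_derivative A Y \<alpha>)"
  using form_form_scale[of \<alpha> f]
  by (intro ext[where f="lie_derivative A Y _"]) (auto simp: lie_derivative_def vector_field_mult form_smooth
      form_scale_def sum_distrib_left right_diff_distrib form_outside add_diff_eq)

lemma lie_derivative_real_scale:
  "\<alpha> \<in> \<Omega> \<Longrightarrow> Y \<in> V \<Longrightarrow> lie_derivative A Y (\<lambda>Xs p. c * \<alpha> Xs p) = (\<lambda>Xs p. c * lie_derivative A Y \<alpha> Xs p)"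
  using lie_derivative_scale[of \<alpha> "\<lambda>_. c" Y]
  by (simp add: form_scale_const smooth_const vector_field_const) (simp add: form_scale_def fun_eq_iff)

lemma lie_derivative_zero: "Y \<in> V \<Longrightarrow> lie_derivative A Y 0 = 0"
  using lie_derivative_real_scale[OF form_zero, of Y 0] by (simp add: zero_fun_def)

lemma lie_derivative_uminus: "\<alpha> \<in> \<Omega> \<Longrightarrow> Y \<in> V \<Longrightarrow> lie_derivative A Y (- \<alpha>) = - lie_derivative A Y \<alpha>"
  using lie_derivative_real_scale[of \<alpha> Y "-1"] by (simp add: fun_Compl_def)

lemma lie_derivative_minus:
  "\<alpha> \<in> \<Omega> \<Longrightarrow> \<beta> \<in> \<Omega> \<Longrightarrow> Y \<in> V \<Longrightarrow> lie_derivative A Y (\<alpha> - \<beta>) = lie_derivative A Y \<alpha> - lie_derivative A Y \<beta>"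
  using lie_derivative_add[of \<alpha> "- \<beta>" Y] form_uminus[of \<beta>] lie_derivative_uminus[of \<beta> Y]
  by (metis diff_conv_add_uminus)

lemma lie_derivative_parity_involution:
  "\<alpha> \<in> \<Omega> \<Longrightarrow> Y \<in> V \<Longrightarrow>
    lie_derivative A Y (parity_involution \<alpha>) = parity_involution (lie_derivative A Y \<alpha>)"
  using form_parity_involution[of \<alpha>]
  by (intro ext) (simp add: lie_derivative_def parity_involution_def gsign_def
      vector_field_uminus form_smooth sum_negf)

lemma lie_derivative_smooth: "\<omega> \<in> \<Omega> \<Longrightarrow> Y \<in> V \<Longrightarrow> lie_derivative A Y \<omega> Xs \<in> C"
  by (simp add: lie_derivative_def smooth_minus vector_field_smooth smooth_sum_fun form_smooth smooth_zero)

text \<open>At the head of the list, the derivatives of the coefficients coming from the Lie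
  derivative of a scaled form cancel against those coming from the bracket with a scaled
  field.\<close>

lemma lie_derivative_linear:
  assumes "Y \<in> V" "Z \<in> V" "f \<in> C" "h \<in> C" "W \<in> V"
  shows "\<omega> \<in> \<Omega> \<Longrightarrow>
    lie_derivative A W \<omega> (Xs @ (vf_scale f Y + vf_scale h Z) # Ys) =
    f * lie_derivative A W \<omega> (Xs @ Y # Ys) + h * lie_derivative A W \<omega> (Xs @ Z # Ys)"
proof (induction Xs arbitrary: \<omega>)
  case Nil
  have c: "lie_derivative A W \<omega> (U # Ys) = contract U (lie_derivative A W \<omega>) Ys" for U
    by (simp add: contract_def)
  show ?case
    using assms Nil unfolding append_Nil c
    by (simp add: contract_lie_derivative vector_field_combination lie_bracket_combination
        contract_add_field form_linear_0 lie_derivative_add lie_derivative_scale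
        form_form_scale form_contract lie_bracket_in vector_field_smooth)
      (simp add: form_scale_def algebra_simps)
next
  case (Cons X Xs)
  have c: "lie_derivative A W \<omega> ((X # Xs) @ Zs) = contract X (lie_derivative A W \<omega>) (Xs @ Zs)" for Zs
    by (simp add: contract_def)
  show ?case
  proof (cases "X \<in> V")
    case True
    then show ?thesis
      unfolding c using assms Cons
      by (simp add: contract_lie_derivative form_contract form_linear[OF form_contract] algebra_simps)
  next
    case False
    then show ?thesis unfolding c by (simp add: contract_lie_derivative_outside)
  qed
qed

text \<open>Two contractions with \<open>Y\<close> produce the contractions with \<open>Y\<close>
  and \<open>lie_bracket W Y\<close> in both orders, whose sum is zero by skew-symmetry.\<close>

lemma lie_derivative_alternating:
  assumes "W \<in> V"
  shows "\<omega> \<in> \<Omega> \<Longrightarrow> lie_derivative A W \<omega> (Xs @ Y # Y # Ys) = 0"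
proof (induction Xs arbitrary: \<omega>)
  case Nil
  have "contract Y (contract Y (lie_derivative A W \<omega>)) = 0"
  proof (cases "Y \<in> V")
    case True
    have "contract Y (contract Y (lie_derivative A W \<omega>)) =
        lie_derivative A W (contract Y (contract Y \<omega>))
          - (contract (lie_bracket W Y) (contract Y \<omega>) + contract Y (contract (lie_bracket W Y) \<omega>))"
      using Nil assms True by (simp add: contract_lie_derivative form_contract)
    then show ?thesis
      using contract_skew[OF Nil, of Y "lie_bracket W Y"]
      by (simp add: contract_alternating Nil lie_derivative_zero assms)
  qed (simp add: contract_lie_derivative_outside)
  then show ?case by (simp add: contract_def fun_eq_iff)
next
  case (Cons X Xs)
  have c: "lie_derivative A W \<omega> ((X # Xs) @ Zs) = contract X (lie_derivative A W \<omega>) (Xs @ Zs)" for Zs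
    by (simp add: contract_def)
  show ?case
  proof (cases "X \<in> V")
    case True
    then show ?thesis
      unfolding c using assms Cons
      by (simp add: contract_lie_derivative form_contract form_alternating[OF form_contract])
  next
    case False
    then show ?thesis unfolding c by (simp add: contract_lie_derivative_outside)
  qed
qed

lemma form_lie_derivative:
  assumes "\<omega> \<in> \<Omega>" "Y \<in> V" shows "lie_derivative A Y \<omega> \<in> \<Omega>"
proof -
  obtain n where n: "\<And>Xs. n < length Xs \<Longrightarrow> \<omega> Xs = 0"
    using form_bounded[OF assms(1)] by metis
  have "lie_derivative A Y \<omega> Xs = 0" if "n < length Xs" for Xs
    using that by (simp add: lie_derivative_def n vector_field_zero assms(2))
  moreover have "lie_derivative A Y \<omega> Xs = 0" if "\<not> set Xs \<subseteq> V" for Xs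
    using that by (simp add: lie_derivative_def)
  ultimately show ?thesis using assms
    by (intro formI[of _ n]) (simp_all add: lie_derivative_smooth lie_derivative_linear lie_derivative_alternating)
qed

lemma lie_derivative_wedge:
  assumes "Y \<in> V"
  shows "\<alpha> \<in> \<Omega> \<Longrightarrow> \<beta> \<in> \<Omega> \<Longrightarrow>
    lie_derivative A Y (wedge \<alpha> \<beta>) = wedge (lie_derivative A Y \<alpha>) \<beta> + wedge \<alpha> (lie_derivative A Y \<beta>)"
proof
  show "\<alpha> \<in> \<Omega> \<Longrightarrow> \<beta> \<in> \<Omega> \<Longrightarrow> lie_derivative A Y (wedge \<alpha> \<beta>) Zs =
      (wedge (lie_derivative A Y \<alpha>) \<beta> + wedge \<alpha> (lie_derivative A Y \<beta>)) Zs" for Zs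
  proof (induction Zs arbitrary: \<alpha> \<beta>)
    case Nil
    then show ?case
      by (simp add: lie_derivative_Nil form_wedge wedge_Nil vector_field_mult assms form_smooth)
  next
    case (Cons Z Zs)
    note [simp] = Cons.prems form_contract form_wedge form_parity_involution form_lie_derivative assms
    have c: "\<gamma> (Z # Zs) = contract Z \<gamma> Zs" for \<gamma> :: "'a form" by (simp add: contract_def)
    show ?case
    proof (cases "Z \<in> V")
      case True
      then show ?thesis
        unfolding c
        by (simp add: contract_lie_derivative contract_wedge lie_derivative_add Cons.IH
            wedge_minus_left wedge_minus_right lie_derivative_parity_involution)
    next
      case False
      then show ?thesis
        unfolding c by (simp add: contract_wedge contract_lie_derivative_outside contract_outside)
    qed
  qed
qed

lemma interior_product_form: "\<omega> \<in> \<Omega> \<Longrightarrow> interior_product A Y \<omega> = contract Y \<omega>"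
  by (simp add: interior_product_def contract_def)

lemma interior_product_not_form: "\<omega> \<notin> \<Omega> \<Longrightarrow> interior_product A Y \<omega> = 0"
  by (simp add: interior_product_def fun_eq_iff)

text \<open>On the empty list this is the definition of the bracket; each further argument
  contributes iterated brackets that match by the Jacobi identity.\<close>

lemma lie_derivative_commutator:
  assumes "Y \<in> V" "Z \<in> V"
  shows "\<omega> \<in> \<Omega> \<Longrightarrow> lie_derivative A Y (lie_derivative A Z \<omega>) - lie_derivative A Z (lie_derivative A Y \<omega>)
    = lie_derivative A (lie_bracket Y Z) \<omega>"
proof
  show "\<omega> \<in> \<Omega> \<Longrightarrow> (lie_derivative A Y (lie_derivative A Z \<omega>) - lie_derivative A Z (lie_derivative A Y \<omega>)) Ws
    = lie_derivative A (lie_bracket Y Z) \<omega> Ws" for Ws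
  proof (induction Ws arbitrary: \<omega>)
    case Nil
    then show ?case
      by (simp add: lie_derivative_Nil form_lie_derivative assms) (simp add: lie_bracket_def)
  next
    case (Cons W Ws)
    have c: "\<gamma> (W # Ws) = contract W \<gamma> Ws" for \<gamma> :: "'a form" by (simp add: contract_def)
    note [simp] = Cons.prems form_contract form_lie_derivative assms lie_bracket_in
    show ?case
    proof (cases "W \<in> V")
      case True
      have "contract (lie_bracket Y (lie_bracket Z W)) \<omega> =
          contract (lie_bracket (lie_bracket Y Z) W) \<omega> + contract (lie_bracket Z (lie_bracket Y W)) \<omega>"
        using True contract_add_field[of \<omega> "lie_bracket (lie_bracket Y Z) W" "lie_bracket Z (lie_bracket Y W)"]
          lie_bracket_jacobi[of Y Z W] lie_bracket_in[of "lie_bracket Y Z" W] by simp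
      then show ?thesis
        using Cons.IH[of "contract W \<omega>"] True
        by (simp add: c contract_lie_derivative lie_derivative_minus algebra_simps)
    next
      case False
      then show ?thesis unfolding c by (simp add: contract_lie_derivative_outside)
    qed
  qed
qed

end

section \<open>Graded derivations\<close>

lemma fderiv_apply:
  fixes D E :: "'a fderiv"
  shows "(D + E) \<omega> = D \<omega> + E \<omega>" "(D - E) \<omega> = D \<omega> - E \<omega>" "(- D) \<omega> = - D \<omega>" "(0 :: 'a fderiv) \<omega> = 0"
  by (simp_all add: pointwise)

lemma der_scale_minus_left: "der_scale (\<alpha> - \<beta>) D = der_scale \<alpha> D - der_scale \<beta> D"
  by (simp add: der_scale_def wedge_minus_left fun_eq_iff pointwise)

lemma der_scale_gsign_left: "der_scale (gsign n \<alpha>) D = gsign n (der_scale \<alpha> D)"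
  by (simp add: der_scale_def gsign_def fun_eq_iff pointwise)

lemma der_scale_zero_left: "der_scale 0 D = 0" and der_scale_zero_right: "der_scale \<alpha> 0 = 0"
  by (simp_all add: der_scale_def fun_eq_iff pointwise)

lemma has_parity_cong: "even r = even s \<Longrightarrow> has_parity r \<omega> = has_parity s \<omega>"
  by (simp add: has_parity_def)

context smooth_manifold
begin

section \<open>Homogeneous forms\<close>

lemma diff_forms_deg_iff: "\<omega> \<in> diff_forms_deg A r \<longleftrightarrow> \<omega> \<in> \<Omega> \<and> has_parity r \<omega>"
  by (simp add: diff_forms_deg_def has_parity_def)

lemma diff_forms_deg_cong: "even r = even s \<Longrightarrow> diff_forms_deg A r = diff_forms_deg A s"
  by (rule set_eqI) (simp add: diff_forms_deg_iff has_parity_cong[of r s])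

lemma diff_forms_deg_subset: "\<omega> \<in> diff_forms_deg A r \<Longrightarrow> \<omega> \<in> \<Omega>"
  by (simp add: diff_forms_deg_iff)

lemma diff_forms_deg_zero: "0 \<in> diff_forms_deg A r"
  by (simp add: diff_forms_deg_iff form_zero has_parity_def)

lemma diff_forms_deg_add: "\<alpha> \<in> diff_forms_deg A r \<Longrightarrow> \<beta> \<in> diff_forms_deg A r \<Longrightarrow> \<alpha> + \<beta> \<in> diff_forms_deg A r"
  by (simp add: diff_forms_deg_iff form_plus has_parity_def)

lemma diff_forms_deg_minus: "\<alpha> \<in> diff_forms_deg A r \<Longrightarrow> \<beta> \<in> diff_forms_deg A r \<Longrightarrow> \<alpha> - \<beta> \<in> diff_forms_deg A r"
  by (simp add: diff_forms_deg_iff form_minus has_parity_def)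

lemma diff_forms_deg_gsign: "\<alpha> \<in> diff_forms_deg A r \<Longrightarrow> gsign n \<alpha> \<in> diff_forms_deg A r"
  by (simp add: diff_forms_deg_iff form_gsign has_parity_def) (simp add: gsign_def)

lemma diff_forms_deg_wedge:
  "\<alpha> \<in> diff_forms_deg A r \<Longrightarrow> \<beta> \<in> diff_forms_deg A s \<Longrightarrow> wedge \<alpha> \<beta> \<in> diff_forms_deg A (r + s)"
  by (simp add: diff_forms_deg_iff form_wedge has_parity_wedge)

lemma form_parity_decomposition:
  assumes "\<omega> \<in> \<Omega>"
  obtains \<alpha> \<beta> where "\<alpha> \<in> diff_forms_deg A 0" "\<beta> \<in> diff_forms_deg A 1" "\<omega> = \<alpha> + \<beta>"
proof
  \<comment> \<open>The factor 1/2 gives the projections onto the two eigenspaces of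
    \<open>parity_involution\<close>.\<close>
  let ?h = "\<lambda>_::'a. 1 / 2 :: real"
  let ?\<alpha> = "form_scale ?h (\<omega> + parity_involution \<omega>)" and ?\<beta> = "form_scale ?h (\<omega> - parity_involution \<omega>)"
  have "?\<alpha> \<in> \<Omega>" "?\<beta> \<in> \<Omega>"
    by (intro form_form_scale form_plus form_minus form_parity_involution smooth_const assms)+
  moreover have "has_parity 0 ?\<alpha>" "has_parity 1 ?\<beta>"
    by (simp_all add: has_parity_def form_scale_def parity_involution_def gsign_def)
  ultimately show "?\<alpha> \<in> diff_forms_deg A 0" "?\<beta> \<in> diff_forms_deg A 1"
    by (simp_all only: diff_forms_deg_iff simp_thms)
  show "\<omega> = ?\<alpha> + ?\<beta>"
  proof (intro ext)
    fix Xs p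
    show "\<omega> Xs p = (?\<alpha> + ?\<beta>) Xs p"
      by (simp add: form_scale_def times_fun_apply plus_fun_apply minus_apply algebra_simps)
  qed
qed

section \<open>Homogeneous derivations and their algebra\<close>

lemma derivations_degI:
  assumes "\<And>\<omega>. \<omega> \<notin> \<Omega> \<Longrightarrow> D \<omega> = 0"
    "\<And>s \<omega>. \<omega> \<in> diff_forms_deg A s \<Longrightarrow> D \<omega> \<in> diff_forms_deg A (r + s)"
    "\<And>\<alpha> \<beta>. \<alpha> \<in> \<Omega> \<Longrightarrow> \<beta> \<in> \<Omega> \<Longrightarrow> D (\<alpha> + \<beta>) = D \<alpha> + D \<beta>"
    "\<And>c \<alpha>. \<alpha> \<in> \<Omega> \<Longrightarrow> D (\<lambda>Xs p. c * \<alpha> Xs p) = (\<lambda>Xs p. c * D \<alpha> Xs p)"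
    "\<And>s \<alpha> \<beta>. \<alpha> \<in> diff_forms_deg A s \<Longrightarrow> \<beta> \<in> \<Omega> \<Longrightarrow>
      D (wedge \<alpha> \<beta>) = wedge (D \<alpha>) \<beta> + gsign (r * s) (wedge \<alpha> (D \<beta>))"
  shows "D \<in> derivations_deg A r"
  using assms unfolding derivations_deg_def by simp

context
  fixes D r assumes D: "D \<in> derivations_deg A r"
begin

lemma derivation_not_form: "\<omega> \<notin> \<Omega> \<Longrightarrow> D \<omega> = 0"
  using D unfolding derivations_deg_def by simp

lemma derivation_deg: "\<omega> \<in> diff_forms_deg A s \<Longrightarrow> D \<omega> \<in> diff_forms_deg A (r + s)"
  using D unfolding derivations_deg_def by simp

lemma derivation_add: "\<alpha> \<in> \<Omega> \<Longrightarrow> \<beta> \<in> \<Omega> \<Longrightarrow> D (\<alpha> + \<beta>) = D \<alpha> + D \<beta>"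
  using D unfolding derivations_deg_def by simp

lemma derivation_real_scale: "\<alpha> \<in> \<Omega> \<Longrightarrow> D (\<lambda>Xs p. c * \<alpha> Xs p) = (\<lambda>Xs p. c * D \<alpha> Xs p)"
  using D unfolding derivations_deg_def by simp

lemma derivation_wedge: "\<alpha> \<in> diff_forms_deg A s \<Longrightarrow> \<beta> \<in> \<Omega> \<Longrightarrow>
    D (wedge \<alpha> \<beta>) = wedge (D \<alpha>) \<beta> + gsign (r * s) (wedge \<alpha> (D \<beta>))"
  using D unfolding derivations_deg_def by simp

lemma derivation_zero: "D 0 = 0"
  using derivation_add[OF form_zero form_zero] by simp

lemma derivation_form: "D \<omega> \<in> \<Omega>"
proof (cases "\<omega> \<in> \<Omega>")
  case True
  then obtain \<alpha> \<beta> where ab: "\<alpha> \<in> diff_forms_deg A 0" "\<beta> \<in> diff_forms_deg A 1" "\<omega> = \<alpha> + \<beta>"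
    by (rule form_parity_decomposition)
  then show ?thesis
    using derivation_deg[OF ab(1)] derivation_deg[OF ab(2)]
    by (simp add: derivation_add diff_forms_deg_subset form_plus)
next
  case False
  then show ?thesis by (simp add: derivation_not_form form_zero)
qed

lemma derivation_uminus: "\<omega> \<in> \<Omega> \<Longrightarrow> D (- \<omega>) = - D \<omega>"
  using derivation_real_scale[of \<omega> "-1"] by (simp add: fun_Compl_def)

lemma derivation_gsign: "\<omega> \<in> \<Omega> \<Longrightarrow> D (gsign n \<omega>) = gsign n (D \<omega>)"
  by (simp add: gsign_def derivation_uminus)

lemma derivation_sum: "(\<And>i. i \<in> I \<Longrightarrow> \<alpha> i \<in> \<Omega>) \<Longrightarrow> D (sum \<alpha> I) = (\<Sum>i\<in>I. D (\<alpha> i))"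
  by (induction I rule: infinite_finite_induct) (simp_all add: derivation_zero derivation_add form_sum)

text \<open>The constant 1 is idempotent under the wedge product, so the product rule doubles its
  image. This is what later annihilates the pairings of the frame derivations.\<close>

lemma derivation_zero_form_const: "D (zero_form (\<lambda>_. c)) = 0"
proof -
  have one: "zero_form 1 \<in> diff_forms_deg A 0"
    by (simp add: diff_forms_deg_iff form_zero_form smooth_one has_parity_def) (simp add: zero_form_def)
  have "wedge (zero_form 1) (zero_form 1) = zero_form (1 :: 'a \<Rightarrow> real)"
    by (simp add: wedge_zero_form_left form_scale_def)
  then have "D (zero_form 1) = 0"
    using derivation_wedge[OF one diff_forms_deg_subset[OF one]]
    by (simp add: wedge_zero_form_left wedge_zero_form_right form_scale_def) (simp add: gsign_def)
  moreover have "zero_form (\<lambda>_. c) = (\<lambda>Xs p. c * zero_form (1 :: 'a \<Rightarrow> real) Xs p)"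
    by (simp add: zero_form_def fun_eq_iff one_fun_apply zero_fun_apply)
  ultimately show ?thesis
    using derivation_real_scale[OF diff_forms_deg_subset[OF one], of c] by (simp add: zero_fun_def)
qed

end

lemma derivations_deg_cong:
  assumes "even r = even s" shows "derivations_deg A r = derivations_deg A s"
proof -
  have "diff_forms_deg A (r + t) = diff_forms_deg A (s + t)" for t
    using assms by (intro diff_forms_deg_cong) simp
  moreover have "gsign (r * t) = (gsign (s * t) :: 'a form \<Rightarrow> 'a form)" for t
    using assms by (intro ext gsign_cong) simp
  ultimately show ?thesis unfolding derivations_deg_def by simp
qed

lemma derivations_deg_zero: "0 \<in> derivations_deg A r"
  by (rule derivations_degI) (simp_all add: fderiv_apply diff_forms_deg_zero, simp add: fun_eq_iff zero_fun_apply)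

lemma derivations_deg_add:
  assumes D: "D \<in> derivations_deg A r" and E: "E \<in> derivations_deg A r"
  shows "D + E \<in> derivations_deg A r"
proof (rule derivations_degI, goal_cases)
  case (4 c \<alpha>)
  then show ?case
    by (simp add: fderiv_apply derivation_real_scale[OF D] derivation_real_scale[OF E])
      (simp add: fun_eq_iff pointwise algebra_simps)
next
  case (5 s \<alpha> \<beta>)
  then show ?case
    by (simp add: fderiv_apply derivation_wedge[OF D] derivation_wedge[OF E] wedge_add_left
        wedge_add_right gsign_add)
qed (simp_all add: fderiv_apply derivation_not_form[OF D] derivation_not_form[OF E]
    derivation_deg[OF D] derivation_deg[OF E] derivation_add[OF D] derivation_add[OF E] diff_forms_deg_add)

lemma derivations_deg_uminus:
  assumes D: "D \<in> derivations_deg A r" shows "- D \<in> derivations_deg A r"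
proof (rule derivations_degI, goal_cases)
  case (2 s \<omega>)
  then show ?case
    using diff_forms_deg_gsign[OF derivation_deg[OF D 2], of 1] by (simp add: fderiv_apply gsign_def)
next
  case (4 c \<alpha>)
  then show ?case
    by (simp add: fderiv_apply derivation_real_scale[OF D]) (simp add: fun_eq_iff pointwise)
next
  case (5 s \<alpha> \<beta>)
  then show ?case by (simp add: fderiv_apply derivation_wedge[OF D] gsign_uminus)
qed (simp_all add: fderiv_apply derivation_not_form[OF D] derivation_add[OF D])

lemma derivations_deg_minus:
  "D \<in> derivations_deg A r \<Longrightarrow> E \<in> derivations_deg A r \<Longrightarrow> D - E \<in> derivations_deg A r"
  using derivations_deg_add[OF _ derivations_deg_uminus] by (metis diff_conv_add_uminus)

lemma derivations_deg_sum:
  "(\<And>i. i \<in> I \<Longrightarrow> D i \<in> derivations_deg A r) \<Longrightarrow> sum D I \<in> derivations_deg A r"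
  by (induction I rule: infinite_finite_induct) (auto intro: derivations_deg_zero derivations_deg_add)

lemma derivations_deg_der_scale:
  assumes D: "D \<in> derivations_deg A r" and \<alpha>: "\<alpha> \<in> diff_forms_deg A s"
  shows "der_scale \<alpha> D \<in> derivations_deg A (s + r)"
proof (rule derivations_degI, goal_cases)
  case (2 t \<omega>)
  then show ?case
    using diff_forms_deg_wedge[OF \<alpha> derivation_deg[OF D 2]] by (simp add: der_scale_def add.assoc)
next
  case (4 c \<beta>)
  then show ?case
    using wedge_scale_right[of \<alpha> "\<lambda>_. c"] by (simp add: der_scale_def derivation_real_scale[OF D] form_scale_const)
next
  case (5 t \<beta> \<gamma>)
  have p: "has_parity s \<alpha>" "has_parity t \<beta>" using \<alpha> 5 by (simp_all add: diff_forms_deg_iff)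
  have "wedge \<alpha> (D (wedge \<beta> \<gamma>)) =
      wedge (wedge \<alpha> (D \<beta>)) \<gamma> + gsign (r * t) (wedge (wedge \<alpha> \<beta>) (D \<gamma>))"
    by (simp add: derivation_wedge[OF D 5] wedge_add_right wedge_gsign_right wedge_assoc)
  \<comment> \<open>Moving \<open>\<alpha>\<close> past \<open>\<beta>\<close> costs the exponent
    \<open>s * t\<close>, which together with \<open>r * t\<close> makes up the sign of a derivation
    of degree \<open>s + r\<close>.\<close>
  also have "wedge \<alpha> \<beta> = gsign (s * t) (wedge \<beta> \<alpha>)" by (rule wedge_graded_commute[OF p])
  also have "gsign (r * t) (wedge (gsign (s * t) (wedge \<beta> \<alpha>)) (D \<gamma>)) =
      gsign ((s + r) * t) (wedge \<beta> (wedge \<alpha> (D \<gamma>)))"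
    by (simp add: wedge_gsign_left gsign_gsign wedge_assoc distrib_right add.commute)
  finally show ?case unfolding der_scale_def .
qed (simp_all add: der_scale_def derivation_not_form[OF D] derivation_add[OF D] wedge_add_right)

lemma lie_derivative_derivation: assumes "Y \<in> V" shows "lie_derivative A Y \<in> derivations_deg A 0"
proof (rule derivations_degI, goal_cases)
  case (2 s \<omega>)
  then have "lie_derivative A Y \<omega> Xs = 0" if "odd (length Xs + s)" for Xs
    using that assms by (simp add: lie_derivative_def diff_forms_deg_iff has_parity_def vector_field_zero)
  then show ?case using 2 assms by (simp add: diff_forms_deg_iff form_lie_derivative has_parity_def)
next
  case (5 s \<alpha> \<beta>)
  then show ?case using assms by (simp add: diff_forms_deg_iff lie_derivative_wedge) (simp add: gsign_def)
qed (simp_all add: lie_derivative_not_form lie_derivative_add lie_derivative_real_scale assms)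

lemma interior_product_derivation: "interior_product A Y \<in> derivations_deg A 1"
proof (rule derivations_degI, goal_cases)
  case (2 s \<omega>)
  then show ?case by (simp add: diff_forms_deg_iff interior_product_form form_contract has_parity_contract)
next
  case (4 c \<alpha>)
  then show ?case by (simp add: interior_product_form form_real_scale) (simp add: contract_def)
next
  case (5 s \<alpha> \<beta>)
  then show ?case
    by (simp add: diff_forms_deg_iff interior_product_form form_wedge contract_wedge
        parity_involution_has_parity[of s \<alpha>] wedge_gsign_left)
qed (simp_all add: interior_product_not_form interior_product_form form_plus)

lemma graded_commutator_derivation:
  assumes D: "D \<in> derivations_deg A r" and E: "E \<in> derivations_deg A s"
  shows "graded_commutator r s D E \<in> derivations_deg A (r + s)"
proof (rule derivations_degI, goal_cases)
  case (1 \<omega>)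
  then show ?case
    by (simp add: graded_commutator_def derivation_not_form[OF D] derivation_not_form[OF E]
        derivation_zero[OF D] derivation_zero[OF E])
next
  case (2 t \<omega>)
  have "D (E \<omega>) \<in> diff_forms_deg A (r + s + t)" "E (D \<omega>) \<in> diff_forms_deg A (r + s + t)"
    using derivation_deg[OF D derivation_deg[OF E 2]] derivation_deg[OF E derivation_deg[OF D 2]]
    by (simp_all add: add_ac)
  then show ?case unfolding graded_commutator_def by (intro diff_forms_deg_minus diff_forms_deg_gsign)
next
  case (3 \<alpha> \<beta>)
  then show ?case
    by (simp add: graded_commutator_def derivation_add[OF D] derivation_add[OF E]
        derivation_form[OF D] derivation_form[OF E] gsign_add)
next
  case (4 c \<alpha>)
  then show ?case
    by (simp add: graded_commutator_def derivation_real_scale[OF D] derivation_real_scale[OF E]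
        derivation_form[OF D] derivation_form[OF E])
      (simp add: gsign_def fun_eq_iff pointwise algebra_simps)
next
  case (5 t \<alpha> \<beta>)
  note \<alpha> = 5(1) and \<alpha>' = diff_forms_deg_subset[OF 5(1)] and \<beta> = 5(2)
  have DE: "D (E (wedge \<alpha> \<beta>)) = wedge (D (E \<alpha>)) \<beta> + gsign (r * (s + t)) (wedge (E \<alpha>) (D \<beta>))
      + (gsign (s * t) (wedge (D \<alpha>) (E \<beta>)) + gsign (s * t + r * t) (wedge \<alpha> (D (E \<beta>))))"
    using \<beta> by (simp add: derivation_wedge[OF E \<alpha>] derivation_add[OF D] form_wedge form_gsign
        derivation_form[OF E] \<alpha>' derivation_wedge[OF D derivation_deg[OF E \<alpha>]]
        derivation_gsign[OF D] derivation_wedge[OF D \<alpha>] gsign_add gsign_gsign)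
  have ED: "E (D (wedge \<alpha> \<beta>)) = wedge (E (D \<alpha>)) \<beta> + gsign (s * (r + t)) (wedge (D \<alpha>) (E \<beta>))
      + (gsign (r * t) (wedge (E \<alpha>) (D \<beta>)) + gsign (r * t + s * t) (wedge \<alpha> (E (D \<beta>))))"
    using \<beta> by (simp add: derivation_wedge[OF D \<alpha>] derivation_add[OF E] form_wedge form_gsign
        derivation_form[OF D] \<alpha>' derivation_wedge[OF E derivation_deg[OF D \<alpha>]]
        derivation_gsign[OF E] derivation_wedge[OF E \<alpha>] gsign_add gsign_gsign)
  \<comment> \<open>Congruences modulo 2 between the exponents. The first two make the mixed terms,
    with one derivation on each factor, cancel.\<close>
  have g: "gsign (r * s) (gsign (s * (r + t)) u) = gsign (s * t) u"
    "gsign (r * s) (gsign (r * t) u) = gsign (r * (s + t)) u"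
    "gsign (r * s) (gsign (r * t + s * t) u) = gsign ((r + s) * t) (gsign (r * s) u)"
    "gsign (s * t + r * t) u = gsign ((r + s) * t) u"
    for u :: "'a form"
    unfolding gsign_gsign by (rule gsign_cong, auto)+
  show ?case
    unfolding graded_commutator_def DE ED gsign_add g
    by (simp add: wedge_minus_left wedge_minus_right wedge_gsign_left wedge_gsign_right gsign_minus algebra_simps)
qed

lemma derivations_deg_subset:
  assumes "D \<in> derivations_deg A r" shows "D \<in> derivations A"
proof (cases "even r")
  case True
  then have "D \<in> derivations_deg A 0" using assms derivations_deg_cong[of r 0] by simp
  then show ?thesis
    unfolding derivations_def mem_Collect_eq
    by (intro exI[of _ D] exI[of _ 0]) (simp add: derivations_deg_zero)
next
  case False
  then have "D \<in> derivations_deg A 1" using assms derivations_deg_cong[of r 1] by simp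
  then show ?thesis
    unfolding derivations_def mem_Collect_eq
    by (intro exI[of _ 0] exI[of _ D]) (simp add: derivations_deg_zero)
qed

lemma derivationsE:
  assumes "D \<in> derivations A"
  obtains D0 D1 where "D0 \<in> derivations_deg A 0" "D1 \<in> derivations_deg A 1" "D = D0 + D1"
  using assms unfolding derivations_def by auto

lemma derivations_add:
  assumes "D \<in> derivations A" "E \<in> derivations A" shows "D + E \<in> derivations A"
proof -
  obtain D0 D1 E0 E1 where "D0 \<in> derivations_deg A 0" "D1 \<in> derivations_deg A 1" "D = D0 + D1"
    "E0 \<in> derivations_deg A 0" "E1 \<in> derivations_deg A 1" "E = E0 + E1"
    using assms by (elim derivationsE)
  then show ?thesis
    unfolding derivations_def mem_Collect_eq
    by (intro exI[of _ "D0 + E0"] exI[of _ "D1 + E1"]) (simp add: derivations_deg_add add_ac)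
qed

end

context smooth_manifold
begin

lemma zero_in_vector_fields: "0 \<in> V"
  by (rule vector_fieldI) (simp_all add: vfield_apply smooth_zero, simp add: zero_fun_def)

lemma vector_fields_sum:
  assumes "\<And>i. i \<in> I \<Longrightarrow> Y i \<in> V" shows "sum Y I \<in> V"
  using assms
proof (induction I rule: infinite_finite_induct)
  case (insert i I)
  then have "vf_scale 1 (Y i) + vf_scale 1 (sum Y I) \<in> V"
    by (intro vector_field_combination smooth_one) simp_all
  then show ?case using insert by (simp add: vf_scale_one)
qed (simp_all add: zero_in_vector_fields)

lemma vector_field_vf_scale: "Y \<in> V \<Longrightarrow> f \<in> C \<Longrightarrow> vf_scale f Y \<in> V"
  using vector_field_combination[of Y Y f 0]
  by (simp add: smooth_zero vf_scale_def plus_fun_def[where 'b="'a \<Rightarrow> real"])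

lemma form_linear_sum:
  assumes \<omega>: "\<omega> \<in> \<Omega>" and Y: "\<And>i. i \<in> I \<Longrightarrow> Y i \<in> V" and c: "\<And>i. i \<in> I \<Longrightarrow> c i \<in> C" and fin: "finite I"
  shows "\<omega> (Xs @ (\<Sum>i\<in>I. vf_scale (c i) (Y i)) # Ys) = (\<Sum>i\<in>I. c i * \<omega> (Xs @ Y i # Ys))"
  using fin Y c
proof (induction I)
  case empty
  show ?case
    using form_add[OF \<omega> zero_in_vector_fields zero_in_vector_fields, of Xs Ys] by simp
next
  case (insert i I)
  let ?S = "\<Sum>i\<in>I. vf_scale (c i) (Y i)"
  have S: "?S \<in> V" by (intro vector_fields_sum vector_field_vf_scale) (use insert in simp_all)
  have "\<omega> (Xs @ (vf_scale (c i) (Y i) + vf_scale 1 ?S) # Ys)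
      = c i * \<omega> (Xs @ Y i # Ys) + 1 * \<omega> (Xs @ ?S # Ys)"
    using insert.prems by (intro form_linear[OF \<omega> _ S _ smooth_one]) simp_all
  then show ?case using insert by (simp add: vf_scale_one)
qed

end

context parallelizable
begin

section \<open>Forms in terms of the frame\<close>

lemma coframe_expansion:
  assumes "Y \<in> V" shows "Y = (\<Sum>j\<in>UNIV. vf_scale (coframe j Y) (X j))"
proof (intro ext)
  fix f p
  show "Y f p = (\<Sum>j\<in>UNIV. vf_scale (coframe j Y) (X j)) f p"
  proof (cases "f \<in> C")
    case True
    then show ?thesis
      using coframe_apply[OF assms True, of p] by (simp add: sum_fun_apply vf_scale_def times_fun_apply)
  next
    case False
    then show ?thesis
      by (simp add: sum_fun_apply vf_scale_def vector_field_not_smooth[OF assms] vector_field_not_smooth[OF X_in])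
  qed
qed

lemma form_frame:
  assumes "\<omega> \<in> \<Omega>" "Y \<in> V"
  shows "\<omega> (Xs @ Y # Ys) = (\<Sum>j\<in>UNIV. coframe j Y * \<omega> (Xs @ X j # Ys))"
proof -
  have "\<omega> (Xs @ (\<Sum>j\<in>UNIV. vf_scale (coframe j Y) (X j)) # Ys) = (\<Sum>j\<in>UNIV. coframe j Y * \<omega> (Xs @ X j # Ys))"
    by (intro form_linear_sum) (simp_all add: assms X_in coframe_smooth)
  then show ?thesis using coframe_expansion[OF assms(2)] by simp
qed

text \<open>A bound on the degree that is uniform in the form, by multilinearity and the pigeonhole principle.\<close>

lemma form_zero_above_dim:
  assumes \<omega>: "\<omega> \<in> \<Omega>" and len: "CARD('m) < length Ys" shows "\<omega> Ys = 0"
proof -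
  \<comment> \<open>The indices \<open>js\<close> record the arguments already expanded in the
    frame. Once all are expanded there are more arguments than frame fields, so one occurs
    twice.\<close>
  have "\<omega> (map X js @ Zs) = 0" if "length js + length Zs = length Ys" for js Zs
    using that
  proof (induction Zs arbitrary: js)
    case Nil
    then have "\<not> distinct js" using len card_mono[of UNIV "set js"] distinct_card[of js] by auto
    then obtain i j where ij: "i < j" "j < length js" "js ! i = js ! j"
      unfolding distinct_conv_nth by (metis nat_neq_iff)
    have "\<forall>Xs i j. i < j \<longrightarrow> j < length Xs \<longrightarrow> Xs ! i = Xs ! j \<longrightarrow> \<omega> Xs = 0"
      using \<omega> unfolding diff_forms_def by simp
    from this[rule_format, of i j "map X js"] show ?case using ij by simp
  next
    case (Cons Z Zs)
    show ?case
    proof (cases "Z \<in> V")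
      case True
      have "\<omega> (map X js @ X j # Zs) = 0" for j
        using Cons.IH[of "js @ [j]"] Cons.prems by simp
      then show ?thesis by (simp add: form_frame[OF \<omega> True])
    next
      case False
      then show ?thesis by (intro form_outside[OF \<omega>]) simp
    qed
  qed
  from this[of "[]" Ys] show ?thesis by simp
qed

lemma coframe_combination:
  assumes "Y \<in> V" "Z \<in> V" "f \<in> C" "h \<in> C"
  shows "coframe j (vf_scale f Y + vf_scale h Z) = f * coframe j Y + h * coframe j Z"
proof
  fix p
  show "coframe j (vf_scale f Y + vf_scale h Z) p = (f * coframe j Y + h * coframe j Z) p"
  proof (rule coframe_unique[where c="\<lambda>j. (f * coframe j Y + h * coframe j Z) p"])
    fix k assume "k \<in> C"
    then show "(vf_scale f Y + vf_scale h Z) k p = (\<Sum>j\<in>UNIV. (f * coframe j Y + h * coframe j Z) p * X j k p)"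
      using coframe_apply[OF assms(1), of k p] coframe_apply[OF assms(2), of k p]
      by (simp add: pointwise vf_scale_def sum.distrib distrib_right sum_distrib_left mult.assoc)
  qed (rule vector_field_combination[OF assms])
qed

lemma coframe_X: "coframe j (X k) = (if j = k then 1 else 0)"
proof
  fix p
  have "X k f p = (\<Sum>j\<in>UNIV. (if j = k then 1 else 0) * X j f p)" for f
    by (simp add: if_distrib[of "\<lambda>c. c * _"] cong: if_cong)
  from coframe_unique[OF X_in this]
  show "coframe j (X k) p = (if j = k then 1 else 0) p"
    by (simp add: one_fun_apply zero_fun_apply)
qed

lemma coframe_zero: "coframe j 0 = 0"
proof
  show "coframe j 0 p = 0 p" for p
    by (rule coframe_unique[OF zero_in_vector_fields, where c="\<lambda>_. 0 p"]) (simp add: pointwise)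
qed

definition coframe_form :: "'m \<Rightarrow> 'a form" where
  "coframe_form j Ys = (if length Ys = 1 \<and> set Ys \<subseteq> V then coframe j (hd Ys) else 0)"

lemma contract_coframe_form: "contract Y (coframe_form j) = (if Y \<in> V then zero_form (coframe j Y) else 0)"
  by (auto simp: contract_def coframe_form_def zero_form_def fun_eq_iff zero_fun_apply)

lemma form_coframe_form: "coframe_form j \<in> \<Omega>"
proof (rule formI[of _ 1], goal_cases)
  case (3 Xs Y Z f h Ys)
  then show ?case
    by (auto simp: coframe_form_def coframe_combination vector_field_combination Cons_eq_append_conv)
qed (auto simp: coframe_form_def coframe_smooth smooth_zero length_Suc_conv)

lemma coframe_form_deg: "coframe_form j \<in> diff_forms_deg A 1"
  by (simp add: diff_forms_deg_iff form_coframe_form has_parity_def) (auto simp: coframe_form_def)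

lemma contract_frame:
  assumes "\<omega> \<in> \<Omega>" "Y \<in> V"
  shows "contract Y \<omega> Ys = (\<Sum>j\<in>UNIV. coframe j Y * contract (X j) \<omega> Ys)"
  using form_frame[OF assms, of "[]" Ys] by (simp add: contract_def)

text \<open>Euler's identity for the grading by degree. Evaluating the first argument gives the
  frame expansion of \<open>\<omega>\<close> once, plus the same identity for the contracted
  form.\<close>

lemma coframe_euler:
  "\<omega> \<in> \<Omega> \<Longrightarrow> (\<Sum>j\<in>UNIV. wedge (coframe_form j) (contract (X j) \<omega>) Ys) = of_nat (length Ys) * \<omega> Ys"
proof (induction Ys arbitrary: \<omega>)
  case Nil
  then show ?case by (simp add: wedge_Nil coframe_form_def)
next
  case (Cons Y Ys)
  note \<omega> = Cons.prems
  \<comment> \<open>This sign compensates the one from exchanging the contractions with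
    \<open>Y\<close> and \<open>X j\<close>.\<close>
  have p: "parity_involution (coframe_form j) = - coframe_form j" for j
    using parity_involution_has_parity[of 1 "coframe_form j"] coframe_form_deg[of j]
    by (simp add: diff_forms_deg_iff) (simp add: gsign_def)
  show ?case
  proof (cases "Y \<in> V")
    case True
    have "(\<Sum>j\<in>UNIV. wedge (coframe_form j) (contract (X j) \<omega>) (Y # Ys)) =
        (\<Sum>j\<in>UNIV. coframe j Y * contract (X j) \<omega> Ys)
        + (\<Sum>j\<in>UNIV. wedge (coframe_form j) (contract (X j) (contract Y \<omega>)) Ys)"
      using True contract_skew[OF \<omega>, of Y]
      by (simp add: wedge_Cons contract_coframe_form p wedge_zero_form_left sum.distrib) (simp add: form_scale_def)
    also have "\<dots> = \<omega> (Y # Ys) + of_nat (length Ys) * \<omega> (Y # Ys)"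
      unfolding Cons.IH[OF form_contract[OF \<omega>], of Y] contract_frame[OF \<omega> True, of Ys, symmetric]
      by (simp add: contract_def)
    finally show ?thesis by (simp add: algebra_simps)
  next
    case False
    then have "\<omega> (Y # Ys) = 0" by (intro form_outside[OF \<omega>]) simp
    moreover have "wedge (coframe_form j) (contract (X j) \<omega>) (Y # Ys) = 0" for j
      using False by (intro wedge_outside form_coframe_form form_contract \<omega>) simp
    ultimately show ?thesis by simp
  qed
qed

definition form_component :: "nat \<Rightarrow> 'a form \<Rightarrow> 'a form" where
  "form_component n \<omega> Xs = (if length Xs = n then \<omega> Xs else 0)"

lemma form_form_component: "\<omega> \<in> \<Omega> \<Longrightarrow> form_component n \<omega> \<in> \<Omega>"
  by (rule formI[of _ n]) (simp_all add: form_component_def form_outside form_smooth smooth_zero form_linear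
      form_alternating)

lemma contract_form_component: "contract Y (form_component (Suc n) \<omega>) = form_component n (contract Y \<omega>)"
  by (simp add: contract_def form_component_def fun_eq_iff)

text \<open>In degree \<open>Suc n\<close>, Euler's identity writes a multiple of the form as a sum
  of products of a coframe form and a form of degree \<open>n\<close>; both factors are killed, by
  assumption and by induction.\<close>

lemma derivation_eq_zero:
  assumes D: "D \<in> derivations_deg A r" and f: "\<And>f. f \<in> C \<Longrightarrow> D (zero_form f) = 0"
    and \<theta>: "\<And>j. D (coframe_form j) = 0"
  shows "D = 0"
proof -
  have comp: "D (form_component n \<omega>) = 0" if "\<omega> \<in> \<Omega>" for n \<omega>
    using that
  proof (induction n arbitrary: \<omega>)
    case 0
    have "form_component 0 \<omega> = zero_form (\<omega> [])"
      by (simp add: form_component_def zero_form_def fun_eq_iff)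
    then show ?case using f[OF form_smooth[OF 0]] by simp
  next
    case (Suc n)
    let ?\<omega> = "form_component (Suc n) \<omega>"
    have \<omega>: "?\<omega> \<in> \<Omega>" by (rule form_form_component[OF Suc.prems])
    have "(\<lambda>Xs p. real (Suc n) * ?\<omega> Xs p) = (\<Sum>j\<in>UNIV. wedge (coframe_form j) (contract (X j) ?\<omega>))"
    proof (intro ext)
      fix Xs :: "'a vfield list" and p :: 'a
      have "(of_nat (length Xs) :: 'a \<Rightarrow> real) p = real (length Xs)" by (induction Xs) (simp_all add: pointwise one_fun_apply)
      then have "(of_nat (length Xs) * ?\<omega> Xs) p = real (Suc n) * ?\<omega> Xs p"
        by (simp add: form_component_def pointwise)
      then show "real (Suc n) * ?\<omega> Xs p = (\<Sum>j\<in>UNIV. wedge (coframe_form j) (contract (X j) ?\<omega>)) Xs p"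
        using coframe_euler[OF \<omega>, of Xs] by (simp add: sum_fun_apply)
    qed
    then have "(\<lambda>Xs p. real (Suc n) * D ?\<omega> Xs p) = D (\<Sum>j\<in>UNIV. wedge (coframe_form j) (contract (X j) ?\<omega>))"
      using derivation_real_scale[OF D \<omega>, of "real (Suc n)"] by simp
    also have "\<dots> = (\<Sum>j\<in>UNIV. D (wedge (coframe_form j) (contract (X j) ?\<omega>)))"
      by (intro derivation_sum[OF D] form_wedge form_coframe_form form_contract \<omega>)
    also have "\<dots> = 0"
      unfolding contract_form_component
        derivation_wedge[OF D coframe_form_deg form_form_component[OF form_contract[OF Suc.prems]]]
        Suc.IH[OF form_contract[OF Suc.prems]] \<theta> by simp
    finally show ?case by (simp add: fun_eq_iff zero_fun_apply)
  qed
  show ?thesis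
  proof
    fix \<omega>
    show "D \<omega> = 0 \<omega>"
    proof (cases "\<omega> \<in> \<Omega>")
      case True
      have "\<omega> = (\<Sum>n\<le>CARD('m). form_component n \<omega>)"
      proof
        show "\<omega> Xs = (\<Sum>n\<le>CARD('m). form_component n \<omega>) Xs" for Xs
          using form_zero_above_dim[OF True, of Xs] by (auto simp: sum_fun_apply form_component_def not_le)
      qed
      moreover have "D (\<Sum>n\<le>CARD('m). form_component n \<omega>) = 0"
        by (simp add: derivation_sum[OF D] form_form_component True comp)
      ultimately show ?thesis unfolding fderiv_apply(4) by simp
    qed (simp add: derivation_not_form[OF D] fderiv_apply)
  qed
qed

section \<open>The expansion of a derivation in the frame derivations\<close>

lemma zero_form_deg: "f \<in> C \<Longrightarrow> zero_form f \<in> diff_forms_deg A 0"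
  by (simp add: diff_forms_deg_iff form_zero_form has_parity_def) (simp add: zero_form_def)

lemma zero_form_ring:
  "zero_form (f + h) = zero_form f + zero_form h"
  "zero_form (\<lambda>p. c * f p) = (\<lambda>Xs p. c * zero_form f Xs p)"
  "zero_form (f * h) = wedge (zero_form f) (zero_form h)"
  unfolding wedge_zero_form_left
  by (simp_all add: zero_form_def form_scale_def fun_eq_iff pointwise)

text \<open>Functions are even, so the product rule carries no sign on them: with the arguments
  \<open>Ys\<close> fixed, a derivation of forms becomes an ordinary vector field, and the coframe
  can be applied to it.\<close>

lemma derivation_on_functions:
  assumes D: "D \<in> derivations_deg A r" shows "(\<lambda>f. D (zero_form f) Ys) \<in> V"
proof (rule vector_fieldI, goal_cases)
  case (1 f)
  then have "zero_form f \<notin> \<Omega>" using form_smooth[of "zero_form f" "[]"] by (auto simp: zero_form_def)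
  then show ?case by (simp add: derivation_not_form[OF D])
next
  case (2 f)
  then show ?case by (simp add: form_smooth derivation_form[OF D])
next
  case (3 f h)
  then show ?case by (simp add: zero_form_ring derivation_add[OF D] form_zero_form)
next
  case (4 c f)
  then show ?case by (simp add: zero_form_ring derivation_real_scale[OF D] form_zero_form)
next
  case (5 f h)
  then show ?case
    unfolding zero_form_ring derivation_wedge[OF D zero_form_deg[OF 5(1)] form_zero_form[OF 5(2)]]
    by (simp add: wedge_zero_form_left wedge_zero_form_right)
      (simp add: gsign_def form_scale_def mult.commute)
qed

text \<open>On functions \<open>D\<close> amounts to a vector-field-valued form; this is its
  component along \<open>X j\<close>.\<close>

definition lie_coefficient :: "'a fderiv \<Rightarrow> 'm \<Rightarrow> 'a form" where
  "lie_coefficient D j Ys = coframe j (\<lambda>f. D (zero_form f) Ys)"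

lemma lie_coefficient_deg:
  assumes D: "D \<in> derivations_deg A r" shows "lie_coefficient D j \<in> diff_forms_deg A r"
proof -
  have z: "lie_coefficient D j Ys = 0" if "\<And>f. f \<in> C \<Longrightarrow> D (zero_form f) Ys = 0" for Ys
  proof -
    have "(\<lambda>f. D (zero_form f) Ys) = 0"
      using that vector_field_not_smooth[OF derivation_on_functions[OF D], of _ Ys]
      by (metis (no_types, lifting) ext vfield_apply(4))
    then show ?thesis by (simp add: lie_coefficient_def coframe_zero)
  qed
  note Df = derivation_form[OF D]
  have "lie_coefficient D j \<in> \<Omega>"
  proof (rule formI[of _ "CARD('m)"], goal_cases)
    case (1 Xs)
    then show ?case by (intro z form_outside Df)
  next
    case (2 Xs)
    then show ?case unfolding lie_coefficient_def by (intro coframe_smooth derivation_on_functions[OF D])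
  next
    case (3 Xs Y Z f h Ys)
    have "(\<lambda>k. D (zero_form k) (Xs @ (vf_scale f Y + vf_scale h Z) # Ys)) =
        vf_scale f (\<lambda>k. D (zero_form k) (Xs @ Y # Ys)) + vf_scale h (\<lambda>k. D (zero_form k) (Xs @ Z # Ys))"
      using 3 by (intro ext[where f="\<lambda>k. D (zero_form k) _"]) (simp add: form_linear[OF Df] vfield_apply, simp add: vf_scale_def)
    then show ?case
      using 3 by (simp add: lie_coefficient_def coframe_combination derivation_on_functions[OF D])
  next
    case (4 Y Xs Ys)
    then show ?case by (intro z form_alternating Df)
  next
    \<comment> \<open>A bound depending on the form would not do: the coefficient at
      \<open>Xs\<close> involves the images of all functions \<open>f\<close> under
      \<open>D\<close>.\<close>
    case (5 Xs)
    then show ?case by (intro z form_zero_above_dim Df)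
  qed
  moreover have "has_parity r (lie_coefficient D j)"
    unfolding has_parity_def
  proof (intro allI impI z)
    fix Xs :: "'a vfield list" and f assume "odd (length Xs + r)" "f \<in> C"
    then show "D (zero_form f) Xs = 0"
      using derivation_deg[OF D zero_form_deg] by (simp add: diff_forms_deg_iff has_parity_def)
  qed
  ultimately show ?thesis by (simp add: diff_forms_deg_iff)
qed

lemma lie_derivative_zero_form: "Y \<in> V \<Longrightarrow> f \<in> C \<Longrightarrow> lie_derivative A Y (zero_form f) = zero_form (Y f)"
  using form_zero_form[of f] by (intro ext) (auto simp: lie_derivative_def zero_form_def vector_field_zero)

lemma derivation_zero_form:
  assumes D: "D \<in> derivations_deg A r" and f: "f \<in> C"
  shows "D (zero_form f) = (\<Sum>j\<in>UNIV. wedge (lie_coefficient D j) (lie_derivative A (X j) (zero_form f)))"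
proof (intro ext)
  fix Ys p
  show "D (zero_form f) Ys p =
      (\<Sum>j\<in>UNIV. wedge (lie_coefficient D j) (lie_derivative A (X j) (zero_form f))) Ys p"
    using coframe_apply[OF derivation_on_functions[OF D] f, of Ys p]
    by (simp add: sum_fun_apply lie_derivative_zero_form X_in f wedge_zero_form_right)
      (simp add: form_scale_def lie_coefficient_def times_fun_apply mult.commute)
qed

text \<open>The conditions for the coefficients are triangular: interior products kill functions, so
  the Lie coefficients are settled by the values on functions and are not disturbed by the second
  correction.\<close>

lemma derivation_decomposition:
  assumes D: "D \<in> derivations_deg A r"
  shows "\<exists>\<alpha> \<beta>. (\<forall>j. \<alpha> j \<in> diff_forms_deg A r \<and> \<beta> j \<in> diff_forms_deg A (Suc r)) \<and>
    D = (\<Sum>j\<in>UNIV. der_scale (\<alpha> j) (lie_derivative A (X j)))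
      + (\<Sum>j\<in>UNIV. der_scale (\<beta> j) (interior_product A (X j)))"
proof (rule exI, rule exI, intro conjI allI)
  let ?\<alpha> = "lie_coefficient D"
  let ?L = "\<Sum>j\<in>UNIV. der_scale (?\<alpha> j) (lie_derivative A (X j))"
  \<comment> \<open>Contracting the coframe with the frame gives the Kronecker delta, so the value
    of the remainder on a coframe form is the coefficient itself.\<close>
  let ?\<beta> = "\<lambda>j. (D - ?L) (coframe_form j)"
  let ?I = "\<Sum>j\<in>UNIV. der_scale (?\<beta> j) (interior_product A (X j))"
  show \<alpha>: "?\<alpha> j \<in> diff_forms_deg A r" for j by (rule lie_coefficient_deg[OF D])
  have L: "?L \<in> derivations_deg A r"
    using derivations_deg_der_scale[OF lie_derivative_derivation[OF X_in] \<alpha>]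
    by (intro derivations_deg_sum) simp
  then have DL: "D - ?L \<in> derivations_deg A r" by (rule derivations_deg_minus[OF D])
  show \<beta>: "?\<beta> j \<in> diff_forms_deg A (Suc r)" for j
    using derivation_deg[OF DL coframe_form_deg[of j]] by simp
  have I: "?I \<in> derivations_deg A r"
    using derivations_deg_der_scale[OF interior_product_derivation \<beta>] derivations_deg_cong[of "Suc r + 1" r]
    by (intro derivations_deg_sum) simp
  have i_zero: "?I (zero_form f) = 0" if "f \<in> C" for f
    using that by (simp add: sum_fun_apply der_scale_def interior_product_form form_zero_form)
  have i_coframe: "?I (coframe_form k) = ?\<beta> k" for k
  proof -
    have "der_scale (?\<beta> j) (interior_product A (X j)) (coframe_form k) = (if j = k then ?\<beta> k else 0)" for j
      by (simp add: der_scale_def interior_product_form form_coframe_form contract_coframe_form X_in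
          coframe_X wedge_zero_form_right) (auto simp: form_scale_def fun_eq_iff pointwise one_fun_apply)
    then show ?thesis by (simp add: sum_fun_apply)
  qed
  have l_zero: "?L (zero_form f) = D (zero_form f)" if "f \<in> C" for f
    using derivation_zero_form[OF D that] by (simp add: sum_fun_apply der_scale_def)
  have "D - ?L - ?I = 0"
  proof (rule derivation_eq_zero[OF derivations_deg_minus[OF DL I]])
    show "(D - ?L - ?I) (zero_form f) = 0" if "f \<in> C" for f
      unfolding fderiv_apply(2)[of "D - ?L" ?I] fderiv_apply(2)[of D ?L "zero_form f"]
        i_zero[OF that] l_zero[OF that] by simp
    show "(D - ?L - ?I) (coframe_form k) = 0" for k
      unfolding fderiv_apply(2)[of "D - ?L" ?I] i_coframe[of k] by simp
  qed
  then show "D = ?L + ?I" by (simp only: diff_diff_eq right_minus_eq)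
qed

text \<open>The form in which the expansion is used: an additive property need be checked only on
  multiples of frame derivations. The coefficient of an odd frame derivation has the opposite
  parity.\<close>

lemma derivation_induct [consumes 1, case_names lie interior add]:
  assumes D: "D \<in> derivations_deg A r"
    and lie: "\<And>j \<alpha>. \<alpha> \<in> diff_forms_deg A r \<Longrightarrow> P (der_scale \<alpha> (lie_derivative A (X j)))"
    and int: "\<And>j \<alpha>. \<alpha> \<in> diff_forms_deg A (Suc r) \<Longrightarrow> P (der_scale \<alpha> (interior_product A (X j)))"
    and add: "\<And>D E. D \<in> derivations_deg A r \<Longrightarrow> E \<in> derivations_deg A r \<Longrightarrow> P D \<Longrightarrow> P E \<Longrightarrow> P (D + E)"
  shows "P D"
proof -
  obtain \<alpha> \<beta> where *: "\<forall>j. \<alpha> j \<in> diff_forms_deg A r \<and> \<beta> j \<in> diff_forms_deg A (Suc r)"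
    and eq: "D = (\<Sum>j\<in>UNIV. der_scale (\<alpha> j) (lie_derivative A (X j)))
      + (\<Sum>j\<in>UNIV. der_scale (\<beta> j) (interior_product A (X j)))"
    using derivation_decomposition[OF D] by (elim exE conjE)
  have ab: "\<And>j. \<alpha> j \<in> diff_forms_deg A r" "\<And>j. \<beta> j \<in> diff_forms_deg A (Suc r)" using * by simp_all
  have zero: "P 0"
    using lie[OF diff_forms_deg_zero] by (simp add: der_scale_zero_left)
  have sums: "sum E I \<in> derivations_deg A r \<and> P (sum E I)"
    if "\<And>j. E j \<in> derivations_deg A r" "\<And>j. P (E j)" for E :: "'m \<Rightarrow> 'a fderiv" and I
    by (induction I rule: infinite_finite_induct)
      (simp_all add: zero derivations_deg_zero derivations_deg_add that add)
  have "der_scale (\<alpha> j) (lie_derivative A (X j)) \<in> derivations_deg A r" for j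
    using derivations_deg_der_scale[OF lie_derivative_derivation[OF X_in] ab(1)] by simp
  moreover have "der_scale (\<beta> j) (interior_product A (X j)) \<in> derivations_deg A r" for j
    using derivations_deg_der_scale[OF interior_product_derivation ab(2)] derivations_deg_cong[of "Suc r + 1" r]
    by simp
  ultimately show ?thesis
    unfolding eq
    using sums[of "\<lambda>j. der_scale (\<alpha> j) (lie_derivative A (X j))" UNIV]
      sums[of "\<lambda>j. der_scale (\<beta> j) (interior_product A (X j))" UNIV]
    by (intro add) (simp_all add: lie[OF ab(1)] int[OF ab(2)])
qed

end

section \<open>The canonical connection\<close>

locale canonical = parallelizable A X
  for A :: "('a::t2_space, 'm::finite) chart set" and X :: "'m \<Rightarrow> 'a vfield" +
  fixes nabla :: "'a gconnection"
  assumes canonical: "canonical_connection A X nabla"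
begin

abbreviation L :: "'m \<Rightarrow> 'a fderiv" where "L j \<equiv> lie_derivative A (X j)"
abbreviation I :: "'m \<Rightarrow> 'a fderiv" where "I j \<equiv> interior_product A (X j)"

lemma L_deg: "L j \<in> derivations_deg A 0"
  by (rule lie_derivative_derivation[OF X_in])

lemma I_deg: "I j \<in> derivations_deg A 1"
  by (rule interior_product_derivation)

lemma nabla_connection: "graded_connection A nabla"
  using canonical by (simp add: canonical_connection_def)

lemma nabla_L: "D \<in> derivations A \<Longrightarrow> nabla D (L j) = 0"
  and nabla_I: "D \<in> derivations A \<Longrightarrow> nabla D (I j) = 0"
  using canonical by (simp_all add: canonical_connection_def)

lemma nabla_deg:
  "D \<in> derivations_deg A r \<Longrightarrow> E \<in> derivations_deg A s \<Longrightarrow> nabla D E \<in> derivations_deg A (r + s)"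
  using nabla_connection unfolding graded_connection_def by simp

lemma nabla_add_right:
  "D \<in> derivations A \<Longrightarrow> E \<in> derivations A \<Longrightarrow> F \<in> derivations A \<Longrightarrow> nabla D (E + F) = nabla D E + nabla D F"
  using nabla_connection unfolding graded_connection_def by simp

lemma nabla_scale_right:
  "D \<in> derivations_deg A r \<Longrightarrow> \<alpha> \<in> diff_forms_deg A s \<Longrightarrow> E \<in> derivations A \<Longrightarrow>
    nabla D (der_scale \<alpha> E) = der_scale (D \<alpha>) E + gsign (r * s) (der_scale \<alpha> (nabla D E))"
  using nabla_connection unfolding graded_connection_def by simp

lemma nabla_scale_parallel:
  assumes "D \<in> derivations_deg A r" "\<alpha> \<in> diff_forms_deg A s" "E \<in> derivations A" "nabla D E = 0"
  shows "nabla D (der_scale \<alpha> E) = der_scale (D \<alpha>) E"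
  using nabla_scale_right[OF assms(1-3)] by (simp add: assms(4) der_scale_zero_right)

lemma nabla_in:
  assumes D: "D \<in> derivations_deg A r" and E: "E \<in> derivations A" shows "nabla D E \<in> derivations A"
proof -
  obtain E0 E1 where e: "E0 \<in> derivations_deg A 0" "E1 \<in> derivations_deg A 1" "E = E0 + E1"
    using E by (rule derivationsE)
  then show ?thesis
    using nabla_deg[OF D e(1)] nabla_deg[OF D e(2)]
    by (simp add: nabla_add_right derivations_deg_subset[OF D] derivations_deg_subset derivations_add)
qed

section \<open>Torsion\<close>

lemma torsion_frame:
  "torsion nabla 0 0 (L j) (L l) = - lie_derivative A (lie_bracket (X j) (X l))"
  "torsion nabla 0 1 (L j) (I l) = - interior_product A (lie_bracket (X j) (X l))"
  "torsion nabla 1 0 (I j) (L l) = interior_product A (lie_bracket (X l) (X j))"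
  "torsion nabla 1 1 (I j) (I l) = 0"
proof -
  note D = derivations_deg_subset[OF L_deg] derivations_deg_subset[OF I_deg]
  have t: "torsion nabla r s D E = - graded_commutator r s D E" if "nabla D E = 0" "nabla E D = 0" for r s D E
    using that by (simp add: torsion_def)
  have "graded_commutator 0 0 (L j) (L l) = lie_derivative A (lie_bracket (X j) (X l))"
  proof
    show "graded_commutator 0 0 (L j) (L l) \<omega> = lie_derivative A (lie_bracket (X j) (X l)) \<omega>" for \<omega>
      using lie_derivative_commutator[OF X_in X_in, of \<omega>]
      by (cases "\<omega> \<in> \<Omega>") (simp_all add: graded_commutator_def lie_derivative_not_form
          lie_derivative_zero X_in gsign_def)
  qed
  then show "torsion nabla 0 0 (L j) (L l) = - lie_derivative A (lie_bracket (X j) (X l))"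
    by (simp add: t nabla_L D)
  have LI: "L j (I l \<omega>) - I l (L j \<omega>) = interior_product A (lie_bracket (X j) (X l)) \<omega>" for j l \<omega>
    by (cases "\<omega> \<in> \<Omega>") (simp_all add: interior_product_form form_lie_derivative contract_lie_derivative X_in
        form_contract lie_derivative_not_form interior_product_not_form lie_derivative_zero form_zero)
  have "graded_commutator 0 1 (L j) (I l) = interior_product A (lie_bracket (X j) (X l))"
    using LI by (intro ext[where f="graded_commutator _ _ _ _"]) (simp add: graded_commutator_def gsign_def)
  then show "torsion nabla 0 1 (L j) (I l) = - interior_product A (lie_bracket (X j) (X l))"
    by (simp add: t nabla_L nabla_I D)
  \<comment> \<open>The sign exponent is 0, so this commutator is the preceding one with its terms
    exchanged; the torsion then loses its minus sign.\<close>
  have "graded_commutator 1 0 (I j) (L l) = - interior_product A (lie_bracket (X l) (X j))"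
    by (intro ext[where f="graded_commutator _ _ _ _"])
      (simp add: graded_commutator_def gsign_def LI[symmetric] fderiv_apply)
  then show "torsion nabla 1 0 (I j) (L l) = interior_product A (lie_bracket (X l) (X j))"
    by (simp add: t nabla_L nabla_I D)
  have "graded_commutator 1 1 (I j) (I l) = 0"
  proof
    show "graded_commutator 1 1 (I j) (I l) \<omega> = 0 \<omega>" for \<omega>
      using contract_skew[of \<omega> "X j" "X l"]
      by (cases "\<omega> \<in> \<Omega>") (simp_all add: graded_commutator_def gsign_def interior_product_form form_contract
          interior_product_not_form form_zero fderiv_apply)
  qed
  then show "torsion nabla 1 1 (I j) (I l) = 0" by (simp add: t nabla_I D)
qed

section \<open>Curvature\<close>

text \<open>On multiples of a parallel \<open>B\<close>, the covariant derivative along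
  \<open>F\<close> is just \<open>F\<close> acting on the coefficient, so the curvature measures the
  failure of the graded commutator to be the commutator, which is zero.\<close>

lemma curvature_scale_parallel:
  assumes D: "D \<in> derivations_deg A r" and E: "E \<in> derivations_deg A s" and \<alpha>: "\<alpha> \<in> diff_forms_deg A t"
    and B: "B \<in> derivations A" "\<And>D. D \<in> derivations A \<Longrightarrow> nabla D B = 0"
  shows "curvature nabla r s D E (der_scale \<alpha> B) = 0"
proof -
  have n: "nabla F (der_scale \<beta> B) = der_scale (F \<beta>) B"
    if "F \<in> derivations_deg A u" "\<beta> \<in> diff_forms_deg A v" for F u \<beta> v
    using that by (intro nabla_scale_parallel B derivations_deg_subset)
  have DE: "nabla D (nabla E (der_scale \<alpha> B)) = der_scale (D (E \<alpha>)) B"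
    unfolding n[OF E \<alpha>] by (rule n[OF D derivation_deg[OF E \<alpha>]])
  have ED: "nabla E (nabla D (der_scale \<alpha> B)) = der_scale (E (D \<alpha>)) B"
    unfolding n[OF D \<alpha>] by (rule n[OF E derivation_deg[OF D \<alpha>]])
  have "nabla (graded_commutator r s D E) (der_scale \<alpha> B) =
      der_scale (D (E \<alpha>) - gsign (r * s) (E (D \<alpha>))) B"
    unfolding n[OF graded_commutator_derivation[OF D E] \<alpha>] by (simp add: graded_commutator_def)
  then show ?thesis
    unfolding curvature_def DE ED by (simp add: der_scale_minus_left der_scale_gsign_left)
qed

lemma curvature_add:
  assumes D: "D \<in> derivations_deg A r" and E: "E \<in> derivations_deg A s"
    and F: "F \<in> derivations A" "G \<in> derivations A"
  shows "curvature nabla r s D E (F + G) = curvature nabla r s D E F + curvature nabla r s D E G"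
  using F derivations_deg_subset[OF D] derivations_deg_subset[OF E] nabla_in[OF D] nabla_in[OF E]
    derivations_deg_subset[OF graded_commutator_derivation[OF D E]]
  by (simp add: curvature_def nabla_add_right gsign_add)

lemma curvature_zero:
  assumes D: "D \<in> derivations_deg A r" and E: "E \<in> derivations_deg A s" and F: "F \<in> derivations_deg A t"
  shows "curvature nabla r s D E F = 0"
  using F
proof (induction rule: derivation_induct)
  case (lie j \<alpha>)
  then show ?case
    by (rule curvature_scale_parallel[OF D E]) (simp_all add: derivations_deg_subset[OF L_deg] nabla_L)
next
  case (interior j \<alpha>)
  then show ?case
    by (rule curvature_scale_parallel[OF D E]) (simp_all add: derivations_deg_subset[OF I_deg] nabla_I)
next
  case (add F G)
  then show ?case by (simp add: curvature_add[OF D E] derivations_deg_subset)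
qed

lemma canonical_flat: "flat_connection A nabla"
  unfolding flat_connection_def
proof (intro allI ballI)
  fix r s D E F
  assume D: "D \<in> derivations_deg A r" and E: "E \<in> derivations_deg A s" and F: "F \<in> derivations A"
  obtain F0 F1 where f: "F0 \<in> derivations_deg A 0" "F1 \<in> derivations_deg A 1" "F = F0 + F1"
    using F by (rule derivationsE)
  then show "curvature nabla r s D E F = 0"
    by (simp add: curvature_add[OF D E] derivations_deg_subset curvature_zero[OF D E f(1)]
        curvature_zero[OF D E f(2)])
qed

section \<open>The metric identity\<close>

context
  fixes g :: "'a vfield \<Rightarrow> 'a vfield \<Rightarrow> ('a \<Rightarrow> real)" and G :: "'a gform"
  assumes orthonormal: "\<And>j l. g (X j) (X l) = (if j = l then 1 else 0)"
    and G: "is_graded_metric_of A g G"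
begin

lemma G_form: "D \<in> derivations A \<Longrightarrow> E \<in> derivations A \<Longrightarrow> G D E \<in> \<Omega>"
  using G unfolding is_graded_metric_of_def graded_symmetric_form_def by simp

lemma G_add_left:
  "D \<in> derivations A \<Longrightarrow> E \<in> derivations A \<Longrightarrow> F \<in> derivations A \<Longrightarrow> G (D + E) F = G D F + G E F"
  using G unfolding is_graded_metric_of_def graded_symmetric_form_def by simp

lemma G_add_right:
  "D \<in> derivations A \<Longrightarrow> E \<in> derivations A \<Longrightarrow> F \<in> derivations A \<Longrightarrow> G D (E + F) = G D E + G D F"
  using G unfolding is_graded_metric_of_def graded_symmetric_form_def by simp

lemma G_scale_left:
  "\<alpha> \<in> \<Omega> \<Longrightarrow> D \<in> derivations A \<Longrightarrow> E \<in> derivations A \<Longrightarrow> G (der_scale \<alpha> D) E = wedge \<alpha> (G D E)"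
  using G unfolding is_graded_metric_of_def graded_symmetric_form_def by simp

lemma G_scale_right:
  assumes "D \<in> derivations_deg A r" "\<alpha> \<in> diff_forms_deg A s" "E \<in> derivations A"
  shows "G D (der_scale \<alpha> E) = gsign (r * s) (wedge \<alpha> (G D E))"
proof -
  have "wedge \<alpha> (G D E) = gsign (r * s) (G D (der_scale \<alpha> E))"
    using G assms unfolding is_graded_metric_of_def graded_symmetric_form_def by simp
  then show ?thesis by (simp add: gsign_gsign) (simp add: gsign_def)
qed

text \<open>Orthonormality makes the functions \<open>g (X j) (X l)\<close> constant, so their
  differentials vanish. Constancy is recorded because constants are killed by all
  derivations.\<close>

lemma G_frame:
  "\<exists>c. G (L j) (L l) = zero_form (\<lambda>_. c)" "\<exists>c. G (L j) (I l) = zero_form (\<lambda>_. c)"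
  "\<exists>c. G (I j) (L l) = zero_form (\<lambda>_. c)" "\<exists>c. G (I j) (I l) = zero_form (\<lambda>_. c)"
proof -
  let ?c = "if j = l then 1 else 0 :: real"
  have g: "g (X j) (X l) = (\<lambda>_. ?c)"
    by (simp add: orthonormal one_fun_def zero_fun_def)
  have z: "zero_form (\<lambda>_. 0) = (0 :: 'a form)" by (simp add: zero_form_def fun_eq_iff pointwise)
  have "differential A (\<lambda>_. ?c) = 0"
  proof
    fix Ys :: "'a vfield list"
    show "differential A (\<lambda>_. ?c) Ys = 0 Ys"
      by (cases Ys) (auto simp: differential_def vector_field_const)
  qed
  then have "G (L j) (L l) = zero_form (\<lambda>_. 0)" "G (L j) (I l) = zero_form (\<lambda>_. ?c)"
    "G (I j) (L l) = zero_form (\<lambda>_. ?c)" "G (I j) (I l) = zero_form (\<lambda>_. 0)"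
    using G X_in unfolding is_graded_metric_of_def z by (simp_all only: g simp_thms)
  then show "\<exists>c. G (L j) (L l) = zero_form (\<lambda>_. c)" "\<exists>c. G (L j) (I l) = zero_form (\<lambda>_. c)"
    "\<exists>c. G (I j) (L l) = zero_form (\<lambda>_. c)" "\<exists>c. G (I j) (I l) = zero_form (\<lambda>_. c)"
    by blast+
qed

context
  fixes D r assumes D: "D \<in> derivations_deg A r"
begin

lemma D_in: "D \<in> derivations A"
  by (rule derivations_deg_subset[OF D])

lemma D_G_frame: "D (G (L j) (L l)) = 0" "D (G (L j) (I l)) = 0" "D (G (I j) (L l)) = 0" "D (G (I j) (I l)) = 0"
  using G_frame[of j l] derivation_zero_form_const[OF D] by auto

text \<open>The metric identity for a left argument from the frame: its covariant derivative is
  zero, so the corresponding term is left out.\<close>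

lemma metric_scale_right:
  assumes B: "B \<in> derivations_deg A b" and B': "B' \<in> derivations A" "nabla D B' = 0"
    and const: "D (G B B') = 0" and \<alpha>: "\<alpha> \<in> diff_forms_deg A t"
  shows "D (G B (der_scale \<alpha> B')) = gsign (r * b) (G B (nabla D (der_scale \<alpha> B')))"
proof -
  note B_in = derivations_deg_subset[OF B]
  have "D (G B (der_scale \<alpha> B')) = gsign (b * t) (wedge (D \<alpha>) (G B B'))"
    by (simp add: G_scale_right[OF B \<alpha> B'(1)] derivation_gsign[OF D] form_wedge diff_forms_deg_subset[OF \<alpha>]
        G_form B_in B'(1) derivation_wedge[OF D \<alpha>] const)
  \<comment> \<open>The exponents \<open>b * t\<close> and \<open>r * b + b * (r + t)\<close> have
    the same parity.\<close>
  also have "\<dots> = gsign (r * b) (gsign (b * (r + t)) (wedge (D \<alpha>) (G B B')))"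
    unfolding gsign_gsign by (rule gsign_cong) auto
  finally show ?thesis
    by (simp add: nabla_scale_parallel[OF D \<alpha> B'] G_scale_right[OF B derivation_deg[OF D \<alpha>] B'(1)])
qed

lemma metric_add_right:
  assumes "B \<in> derivations A" "E \<in> derivations A" "F \<in> derivations A"
    "D (G B E) = gsign n (G B (nabla D E))" "D (G B F) = gsign n (G B (nabla D F))"
  shows "D (G B (E + F)) = gsign n (G B (nabla D (E + F)))"
  using assms by (simp add: G_add_right nabla_add_right D_in nabla_in[OF D] derivation_add[OF D] G_form gsign_add)

text \<open>Both kinds of frame derivations are treated in one induction on \<open>E\<close>. The
  exponents \<open>r * 0\<close> and \<open>r * 1\<close> display their degrees.\<close>

lemma metric_frame_left:
  assumes E: "E \<in> derivations_deg A t"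
  shows "D (G (L j) E) = gsign (r * 0) (G (L j) (nabla D E)) \<and> D (G (I j) E) = gsign (r * 1) (G (I j) (nabla D E))"
  using E
proof (induction rule: derivation_induct)
  case (lie l \<alpha>)
  then show ?case
    by (intro conjI metric_scale_right L_deg I_deg) (simp_all add: derivations_deg_subset[OF L_deg] nabla_L D_in D_G_frame)
next
  case (interior l \<alpha>)
  then show ?case
    by (intro conjI metric_scale_right L_deg I_deg) (simp_all add: derivations_deg_subset[OF I_deg] nabla_I D_in D_G_frame)
next
  case (add E F)
  then show ?case
    by (intro conjI metric_add_right) (simp_all add: derivations_deg_subset[OF L_deg] derivations_deg_subset[OF I_deg]
        derivations_deg_subset)
qed

text \<open>The two terms of the product rule for \<open>\<alpha>\<close> become the two terms of
  the metric identity. The degree \<open>s\<close> is tied to \<open>t + b\<close> by parity only,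
  because the coefficient of an interior product has degree \<open>Suc s\<close> while the product
  counts as degree \<open>s\<close>.\<close>

lemma metric_scale_left:
  assumes B: "B \<in> derivations A" "nabla D B = 0" and E: "E \<in> derivations A"
    and BE: "D (G B E) = gsign (r * b) (G B (nabla D E))" and \<alpha>: "\<alpha> \<in> diff_forms_deg A t"
    and s: "even s = even (t + b)"
  shows "D (G (der_scale \<alpha> B) E) =
    G (nabla D (der_scale \<alpha> B)) E + gsign (r * s) (G (der_scale \<alpha> B) (nabla D E))"
proof -
  note \<alpha>' = diff_forms_deg_subset[OF \<alpha>]
  have "D (G (der_scale \<alpha> B) E) =
      wedge (D \<alpha>) (G B E) + gsign (r * t + r * b) (wedge \<alpha> (G B (nabla D E)))"
    by (simp add: G_scale_left \<alpha>' B(1) E derivation_wedge[OF D \<alpha>] G_form BE wedge_gsign_right gsign_gsign)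
  also have "gsign (r * t + r * b) = (gsign (r * s) :: 'a form \<Rightarrow> 'a form)"
    using s by (intro ext gsign_cong) auto
  finally show ?thesis
    by (simp add: nabla_scale_parallel[OF D \<alpha> B] G_scale_left \<alpha>' B(1) E derivation_form[OF D] nabla_in[OF D]
        del: form_apply)
qed

lemma metric_identity:
  assumes E: "E \<in> derivations_deg A s" and F: "F \<in> derivations_deg A t"
  shows "D (G E F) = G (nabla D E) F + gsign (r * s) (G E (nabla D F))"
  using E
proof (induction rule: derivation_induct)
  case (lie j \<alpha>)
  show ?case
    by (rule metric_scale_left[OF _ _ _ conjunct1[OF metric_frame_left[OF F]] lie])
      (simp_all add: derivations_deg_subset[OF L_deg] derivations_deg_subset[OF F] nabla_L D_in)
next
  case (interior j \<alpha>)
  show ?case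
    by (rule metric_scale_left[OF _ _ _ conjunct2[OF metric_frame_left[OF F]] interior])
      (simp_all add: derivations_deg_subset[OF I_deg] derivations_deg_subset[OF F] nabla_I D_in)
next
  case (add E E')
  then show ?case
    using derivations_deg_subset[OF F] nabla_in[OF D]
    by (simp add: G_add_left nabla_add_right D_in derivation_add[OF D] G_form gsign_add derivations_deg_subset
        add_ac del: form_apply)
qed

end

lemma canonical_metric: "metric_connection A nabla G"
  unfolding metric_connection_def using metric_identity by blast

end

end

theorem proposition5p2:
  fixes A :: "('a::{t2_space, second_countable_topology}, 'm::finite) chart set"
    and X :: "'m \<Rightarrow> 'a vfield"
    and nabla_c :: "'a gconnection"
  assumes "parallelizable_manifold A X"
    and "canonical_connection A X nabla_c"
  shows "(\<forall>j l.
        torsion nabla_c 0 0 (lie_derivative A (X j)) (lie_derivative A (X l))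
          = - lie_derivative A (lie_bracket (X j) (X l)) \<and>
        torsion nabla_c 0 1 (lie_derivative A (X j)) (interior_product A (X l))
          = - interior_product A (lie_bracket (X j) (X l)) \<and>
        torsion nabla_c 1 0 (interior_product A (X j)) (lie_derivative A (X l))
          = interior_product A (lie_bracket (X l) (X j)) \<and>
        torsion nabla_c 1 1 (interior_product A (X j)) (interior_product A (X l)) = 0)
    \<and> flat_connection A nabla_c
    \<and> (\<forall>g G. riemannian_metric A g \<longrightarrow>
        (\<forall>j l. g (X j) (X l) = (if j = l then 1 else 0)) \<longrightarrow>
        is_graded_metric_of A g G \<longrightarrow>
        metric_connection A nabla_c G)"
proof -
  interpret canonical A X nabla_c
    using assms by unfold_locales (simp_all add: parallelizable_manifold_def)
  show ?thesis
    by (intro conjI allI impI torsion_frame canonical_flat) (rule canonical_metric, simp_all)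
qed

end
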